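(* In the Cantor domain, an element is strongly maximal if and only if it is both sharp and maximal. In the Baire domain, the strongly maximal elements are exactly the elements that are both sharp and maximal if and only if Markov's Principle holds.
   Context: We work constructively: informal set theory without excluded middle or choice. For a set $A$, let $A^*$ be the set of finite sequences on $A$ ordered by the prefix order $\preceq$, and let $\mathcal A$ be its ideal completion: the set of subsets of $A^*$ that are lower sets and directed (inhabited, any two elements have a common extension in the subset), ordered by inclusion, with directed suprema given by unions. The Cantor domain is this construction for $A=\{0,1\}$, and the Baire domain for $A=\mathbb N$. In a dcpo, $x\ll y$ if for every directed $S$ with $y\sqsubseteq\bigsqcup S$ some $s\in S$ has $x\sqsubseteq s$. Scott open sets are upper sets $U$ such that $\bigsqcup S\in U$ for directed $S$ implies some $s\in S$ lies in $U$. An element $x$ is maximal if $x\sqsubseteq y$ implies $y\sqsubseteq x$; sharp if for all $u\ll v$, $u\ll x$ or $\neg(v\sqsubseteq x)$; strongly maximal if for all $u\ll v$, $u\ll x$ or there are disjoint Scott opens containing $v$ and $x$ respectively. Markov's Principle: for every $\phi:\mathbb N\to\{0,1\}$, if $\neg(\forall n\,\phi(n)=0)$ then there exists $k$ with $\phi(k)=1$. *)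

theory Defs
  imports Main
begin

text \<open>
  HOL is classical, so the theorem is stated as derivability in a deeply embedded intuitionistic
  set theory, IZF (intuitionistic first-order logic with equality, full separation, power set,
  collection and set induction; neither excluded middle nor choice).
\<close>

section \<open>Intuitionistic first-order logic over the signature of set theory\<close>

text \<open>De Bruijn indices; the only terms are variables, so substitution is renaming.\<close>

datatype fm =
    Bot
  | Mem nat nat
  | Eq nat nat
  | And fm fm
  | Or fm fm
  | Imp fm fm
  | All fm
  | Ex fm

definition lift :: "(nat \<Rightarrow> nat) \<Rightarrow> nat \<Rightarrow> nat" where
  "lift r = case_nat 0 (\<lambda>k. Suc (r k))"

primrec ren :: "(nat \<Rightarrow> nat) \<Rightarrow> fm \<Rightarrow> fm" where
  "ren r Bot = Bot"
| "ren r (Mem i j) = Mem (r i) (r j)"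
| "ren r (Eq i j) = Eq (r i) (r j)"
| "ren r (And p q) = And (ren r p) (ren r q)"
| "ren r (Or p q) = Or (ren r p) (ren r q)"
| "ren r (Imp p q) = Imp (ren r p) (ren r q)"
| "ren r (All p) = All (ren (lift r) p)"
| "ren r (Ex p) = Ex (ren (lift r) p)"

definition inst :: "nat \<Rightarrow> fm \<Rightarrow> fm" where
  "inst y = ren (case_nat y (\<lambda>k. k))"

text \<open>
  Natural deduction from a set \<open>T\<close> of axioms and a set \<open>\<Gamma>\<close> of hypotheses. Free variables of
  axioms are read universally; those of hypotheses are shifted below quantifiers.
\<close>

inductive derives :: "fm set \<Rightarrow> fm set \<Rightarrow> fm \<Rightarrow> bool" for T :: "fm set" where
  Axiom: "p \<in> T \<Longrightarrow> derives T \<Gamma> p"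
| Assm: "p \<in> \<Gamma> \<Longrightarrow> derives T \<Gamma> p"
| BotE: "derives T \<Gamma> Bot \<Longrightarrow> derives T \<Gamma> p"
| AndI: "derives T \<Gamma> p \<Longrightarrow> derives T \<Gamma> q \<Longrightarrow> derives T \<Gamma> (And p q)"
| AndE1: "derives T \<Gamma> (And p q) \<Longrightarrow> derives T \<Gamma> p"
| AndE2: "derives T \<Gamma> (And p q) \<Longrightarrow> derives T \<Gamma> q"
| OrI1: "derives T \<Gamma> p \<Longrightarrow> derives T \<Gamma> (Or p q)"
| OrI2: "derives T \<Gamma> q \<Longrightarrow> derives T \<Gamma> (Or p q)"
| OrE: "derives T \<Gamma> (Or p q) \<Longrightarrow> derives T (insert p \<Gamma>) r \<Longrightarrow> derives T (insert q \<Gamma>) r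
    \<Longrightarrow> derives T \<Gamma> r"
| ImpI: "derives T (insert p \<Gamma>) q \<Longrightarrow> derives T \<Gamma> (Imp p q)"
| ImpE: "derives T \<Gamma> (Imp p q) \<Longrightarrow> derives T \<Gamma> p \<Longrightarrow> derives T \<Gamma> q"
| AllI: "derives T (ren Suc ` \<Gamma>) p \<Longrightarrow> derives T \<Gamma> (All p)"
| AllE: "derives T \<Gamma> (All p) \<Longrightarrow> derives T \<Gamma> (inst y p)"
| ExI: "derives T \<Gamma> (inst y p) \<Longrightarrow> derives T \<Gamma> (Ex p)"
| ExE: "derives T \<Gamma> (Ex p) \<Longrightarrow> derives T (insert p (ren Suc ` \<Gamma>)) (ren Suc q) \<Longrightarrow> derives T \<Gamma> q"
| EqI: "derives T \<Gamma> (Eq x x)"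
| EqE: "derives T \<Gamma> (Eq x y) \<Longrightarrow> derives T \<Gamma> (inst x p) \<Longrightarrow> derives T \<Gamma> (inst y p)"

section \<open>Readable syntax for formulas\<close>

text \<open>
  To write formulas with Isabelle's own binders, a formula is given as a function of the number
  \<open>n\<close> of enclosing quantifiers, and a bound variable is the number of quantifiers outside its own
  (its level). In a context of depth \<open>n\<close>, level \<open>x\<close> is the index \<open>n - Suc x\<close>, and the free
  variable \<open>k\<close> of the whole formula is the index \<open>n + k\<close>.
\<close>

type_synonym var = nat
type_synonym form = "nat \<Rightarrow> fm"

definition fmem :: "var \<Rightarrow> var \<Rightarrow> form" (infix "\<^bold>\<in>" 50) where
  "x \<^bold>\<in> y = (\<lambda>n. Mem (n - Suc x) (n - Suc y))"

definition feq :: "var \<Rightarrow> var \<Rightarrow> form" (infix "\<^bold>=" 50) where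
  "x \<^bold>= y = (\<lambda>n. Eq (n - Suc x) (n - Suc y))"

definition fand :: "form \<Rightarrow> form \<Rightarrow> form" (infixr "\<^bold>\<and>" 35) where
  "(P \<^bold>\<and> Q) = (\<lambda>n. And (P n) (Q n))"

definition f_or :: "form \<Rightarrow> form \<Rightarrow> form" (infixr "\<^bold>\<or>" 30) where
  "(P \<^bold>\<or> Q) = (\<lambda>n. Or (P n) (Q n))"

definition fimp :: "form \<Rightarrow> form \<Rightarrow> form" (infixr "\<^bold>\<longrightarrow>" 25) where
  "(P \<^bold>\<longrightarrow> Q) = (\<lambda>n. Imp (P n) (Q n))"

definition fiff :: "form \<Rightarrow> form \<Rightarrow> form" (infix "\<^bold>\<longleftrightarrow>" 25) where
  "(P \<^bold>\<longleftrightarrow> Q) = ((P \<^bold>\<longrightarrow> Q) \<^bold>\<and> (Q \<^bold>\<longrightarrow> P))"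

definition fnot :: "form \<Rightarrow> form" ("\<^bold>\<not> _" [40] 40) where
  "(\<^bold>\<not> P) = (\<lambda>n. Imp (P n) Bot)"

definition fall :: "(var \<Rightarrow> form) \<Rightarrow> form" (binder "\<^bold>\<forall>" 10) where
  "fall F = (\<lambda>n. All (F n (Suc n)))"

definition fex :: "(var \<Rightarrow> form) \<Rightarrow> form" (binder "\<^bold>\<exists>" 10) where
  "fex F = (\<lambda>n. Ex (F n (Suc n)))"

text \<open>
  Formula parameters of axiom schemes: the indices \<open>0\<close> (and \<open>1\<close>) of \<open>p\<close> are its arguments, the
  remaining ones are parameters, i.e. free variables of the whole scheme instance.
\<close>

definition app1 :: "fm \<Rightarrow> var \<Rightarrow> form" where
  "app1 p x = (\<lambda>n. ren (case_nat (n - Suc x) (\<lambda>k. n + k)) p)"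

definition app2 :: "fm \<Rightarrow> var \<Rightarrow> var \<Rightarrow> form" where
  "app2 p x y = (\<lambda>n. ren (case_nat (n - Suc x) (case_nat (n - Suc y) (\<lambda>k. n + k))) p)"

section \<open>The axioms of IZF\<close>

definition subset_fm :: "var \<Rightarrow> var \<Rightarrow> form" (infix "\<^bold>\<subseteq>" 50) where
  "(x \<^bold>\<subseteq> y) = (\<^bold>\<forall>z. z \<^bold>\<in> x \<^bold>\<longrightarrow> z \<^bold>\<in> y)"

definition is_empty :: "var \<Rightarrow> form" where
  "is_empty x = (\<^bold>\<forall>z. \<^bold>\<not> z \<^bold>\<in> x)"

text \<open>\<open>p = {x, y}\<close>\<close>
definition is_upair :: "var \<Rightarrow> var \<Rightarrow> var \<Rightarrow> form" where
  "is_upair p x y = (\<^bold>\<forall>z. z \<^bold>\<in> p \<^bold>\<longleftrightarrow> z \<^bold>= x \<^bold>\<or> z \<^bold>= y)"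

text \<open>\<open>y = x \<union> {x}\<close>\<close>
definition is_succ :: "var \<Rightarrow> var \<Rightarrow> form" where
  "is_succ y x = (\<^bold>\<forall>z. z \<^bold>\<in> y \<^bold>\<longleftrightarrow> z \<^bold>\<in> x \<^bold>\<or> z \<^bold>= x)"

definition is_inductive :: "var \<Rightarrow> form" where
  "is_inductive i =
     ((\<^bold>\<exists>z. z \<^bold>\<in> i \<^bold>\<and> is_empty z) \<^bold>\<and> (\<^bold>\<forall>x. x \<^bold>\<in> i \<^bold>\<longrightarrow> (\<^bold>\<exists>y. y \<^bold>\<in> i \<^bold>\<and> is_succ y x)))"

definition ax_extensionality :: form where
  "ax_extensionality = (\<^bold>\<forall>x. \<^bold>\<forall>y. (\<^bold>\<forall>z. z \<^bold>\<in> x \<^bold>\<longleftrightarrow> z \<^bold>\<in> y) \<^bold>\<longrightarrow> x \<^bold>= y)"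

definition ax_pairing :: form where
  "ax_pairing = (\<^bold>\<forall>x. \<^bold>\<forall>y. \<^bold>\<exists>p. is_upair p x y)"

definition ax_union :: form where
  "ax_union = (\<^bold>\<forall>a. \<^bold>\<exists>u. \<^bold>\<forall>x. x \<^bold>\<in> u \<^bold>\<longleftrightarrow> (\<^bold>\<exists>y. y \<^bold>\<in> a \<^bold>\<and> x \<^bold>\<in> y))"

definition ax_powerset :: form where
  "ax_powerset = (\<^bold>\<forall>a. \<^bold>\<exists>p. \<^bold>\<forall>x. x \<^bold>\<in> p \<^bold>\<longleftrightarrow> x \<^bold>\<subseteq> a)"

definition ax_infinity :: form where
  "ax_infinity = (\<^bold>\<exists>i. is_inductive i)"

definition ax_separation :: "fm \<Rightarrow> form" where
  "ax_separation p = (\<^bold>\<forall>a. \<^bold>\<exists>b. \<^bold>\<forall>x. x \<^bold>\<in> b \<^bold>\<longleftrightarrow> x \<^bold>\<in> a \<^bold>\<and> app1 p x)"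

definition ax_collection :: "fm \<Rightarrow> form" where
  "ax_collection p =
     (\<^bold>\<forall>a. (\<^bold>\<forall>x. x \<^bold>\<in> a \<^bold>\<longrightarrow> (\<^bold>\<exists>y. app2 p x y)) \<^bold>\<longrightarrow>
       (\<^bold>\<exists>b. \<^bold>\<forall>x. x \<^bold>\<in> a \<^bold>\<longrightarrow> (\<^bold>\<exists>y. y \<^bold>\<in> b \<^bold>\<and> app2 p x y)))"

definition ax_set_induction :: "fm \<Rightarrow> form" where
  "ax_set_induction p =
     ((\<^bold>\<forall>x. (\<^bold>\<forall>y. y \<^bold>\<in> x \<^bold>\<longrightarrow> app1 p y) \<^bold>\<longrightarrow> app1 p x) \<^bold>\<longrightarrow> (\<^bold>\<forall>x. app1 p x))"

definition IZF :: "fm set" where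
  "IZF =
     {ax_extensionality 0, ax_pairing 0, ax_union 0, ax_powerset 0, ax_infinity 0}
     \<union> range (\<lambda>p. ax_separation p 0)
     \<union> range (\<lambda>p. ax_collection p 0)
     \<union> range (\<lambda>p. ax_set_induction p 0)"

definition IZF_proves :: "form \<Rightarrow> bool" where
  "IZF_proves P \<longleftrightarrow> derives IZF {} (P 0)"

section \<open>Numbers, functions, finite sequences\<close>

text \<open>
  Natural numbers are von Neumann numerals, so that \<open>n = {0, \<dots>, n - 1}\<close>. Sets such as
  \<open>\<nat>\<close> and \<open>{0,1}\<close> are given by their membership predicates, of type \<^typ>\<open>var \<Rightarrow> form\<close>.
\<close>

definition is_nat :: "var \<Rightarrow> form" where
  "is_nat n = (\<^bold>\<forall>i. is_inductive i \<^bold>\<longrightarrow> n \<^bold>\<in> i)"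

definition is_one :: "var \<Rightarrow> form" where
  "is_one x = (\<^bold>\<exists>z. is_empty z \<^bold>\<and> is_succ x z)"

definition is_bit :: "var \<Rightarrow> form" where
  "is_bit x = (is_empty x \<^bold>\<or> is_one x)"

text \<open>The Kuratowski pair \<open>p = {{x}, {x, y}}\<close>\<close>
definition is_opair :: "var \<Rightarrow> var \<Rightarrow> var \<Rightarrow> form" where
  "is_opair p x y = (\<^bold>\<forall>z. z \<^bold>\<in> p \<^bold>\<longleftrightarrow> is_upair z x x \<^bold>\<or> is_upair z x y)"

text \<open>\<open>(x, y) \<in> f\<close>, i.e. \<open>f(x) = y\<close> when \<open>f\<close> is a function\<close>
definition maps_to :: "var \<Rightarrow> var \<Rightarrow> var \<Rightarrow> form" where
  "maps_to f x y = (\<^bold>\<exists>p. p \<^bold>\<in> f \<^bold>\<and> is_opair p x y)"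

definition is_function :: "var \<Rightarrow> (var \<Rightarrow> form) \<Rightarrow> (var \<Rightarrow> form) \<Rightarrow> form" where
  "is_function f A B =
     ((\<^bold>\<forall>p. p \<^bold>\<in> f \<^bold>\<longrightarrow> (\<^bold>\<exists>x. \<^bold>\<exists>y. A x \<^bold>\<and> B y \<^bold>\<and> is_opair p x y)) \<^bold>\<and>
      (\<^bold>\<forall>x. A x \<^bold>\<longrightarrow> (\<^bold>\<exists>y. maps_to f x y)) \<^bold>\<and>
      (\<^bold>\<forall>x. \<^bold>\<forall>y. \<^bold>\<forall>z. maps_to f x y \<^bold>\<and> maps_to f x z \<^bold>\<longrightarrow> y \<^bold>= z))"

definition is_finseq :: "(var \<Rightarrow> form) \<Rightarrow> var \<Rightarrow> form" where
  "is_finseq A s = (\<^bold>\<exists>n. is_nat n \<^bold>\<and> is_function s (\<lambda>i. i \<^bold>\<in> n) A)"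

text \<open>As sequences are functions on initial segments, the prefix order is inclusion of graphs.\<close>
definition prefix_fm :: "var \<Rightarrow> var \<Rightarrow> form" (infix "\<^bold>\<preceq>" 50) where
  "(s \<^bold>\<preceq> t) = (s \<^bold>\<subseteq> t)"

definition markovs_principle :: form where
  "markovs_principle =
     (\<^bold>\<forall>f. is_function f is_nat is_bit \<^bold>\<and>
        \<^bold>\<not> (\<^bold>\<forall>n. is_nat n \<^bold>\<longrightarrow> (\<^bold>\<exists>z. is_empty z \<^bold>\<and> maps_to f n z)) \<^bold>\<longrightarrow>
        (\<^bold>\<exists>k. is_nat k \<^bold>\<and> (\<^bold>\<exists>u. is_one u \<^bold>\<and> maps_to f k u)))"

section \<open>Domains\<close>

text \<open>\<open>D\<close> is the (membership predicate of the) carrier and \<open>le\<close> the order.\<close>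

type_synonym carrier = "var \<Rightarrow> form"
type_synonym ordering = "var \<Rightarrow> var \<Rightarrow> form"

definition is_directed :: "carrier \<Rightarrow> ordering \<Rightarrow> var \<Rightarrow> form" where
  "is_directed D le S =
     ((\<^bold>\<forall>x. x \<^bold>\<in> S \<^bold>\<longrightarrow> D x) \<^bold>\<and>
      (\<^bold>\<exists>x. x \<^bold>\<in> S) \<^bold>\<and>
      (\<^bold>\<forall>x. \<^bold>\<forall>y. x \<^bold>\<in> S \<^bold>\<and> y \<^bold>\<in> S \<^bold>\<longrightarrow> (\<^bold>\<exists>z. z \<^bold>\<in> S \<^bold>\<and> le x z \<^bold>\<and> le y z)))"

definition is_supremum :: "carrier \<Rightarrow> ordering \<Rightarrow> var \<Rightarrow> var \<Rightarrow> form" where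
  "is_supremum D le S z =
     (D z \<^bold>\<and> (\<^bold>\<forall>x. x \<^bold>\<in> S \<^bold>\<longrightarrow> le x z) \<^bold>\<and>
      (\<^bold>\<forall>y. D y \<^bold>\<and> (\<^bold>\<forall>x. x \<^bold>\<in> S \<^bold>\<longrightarrow> le x y) \<^bold>\<longrightarrow> le z y))"

definition way_below :: "carrier \<Rightarrow> ordering \<Rightarrow> var \<Rightarrow> var \<Rightarrow> form" where
  "way_below D le x y =
     (\<^bold>\<forall>S. \<^bold>\<forall>z. is_directed D le S \<^bold>\<and> is_supremum D le S z \<^bold>\<and> le y z \<^bold>\<longrightarrow>
        (\<^bold>\<exists>s. s \<^bold>\<in> S \<^bold>\<and> le x s))"

definition scott_open :: "carrier \<Rightarrow> ordering \<Rightarrow> var \<Rightarrow> form" where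
  "scott_open D le U =
     ((\<^bold>\<forall>x. x \<^bold>\<in> U \<^bold>\<longrightarrow> D x) \<^bold>\<and>
      (\<^bold>\<forall>x. \<^bold>\<forall>y. x \<^bold>\<in> U \<^bold>\<and> D y \<^bold>\<and> le x y \<^bold>\<longrightarrow> y \<^bold>\<in> U) \<^bold>\<and>
      (\<^bold>\<forall>S. \<^bold>\<forall>z. is_directed D le S \<^bold>\<and> is_supremum D le S z \<^bold>\<and> z \<^bold>\<in> U \<^bold>\<longrightarrow>
        (\<^bold>\<exists>s. s \<^bold>\<in> S \<^bold>\<and> s \<^bold>\<in> U)))"

definition is_maximal :: "carrier \<Rightarrow> ordering \<Rightarrow> var \<Rightarrow> form" where
  "is_maximal D le x = (\<^bold>\<forall>y. D y \<^bold>\<and> le x y \<^bold>\<longrightarrow> le y x)"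

definition is_sharp :: "carrier \<Rightarrow> ordering \<Rightarrow> var \<Rightarrow> form" where
  "is_sharp D le x =
     (\<^bold>\<forall>u. \<^bold>\<forall>v. D u \<^bold>\<and> D v \<^bold>\<and> way_below D le u v \<^bold>\<longrightarrow>
        way_below D le u x \<^bold>\<or> \<^bold>\<not> le v x)"

definition is_strongly_maximal :: "carrier \<Rightarrow> ordering \<Rightarrow> var \<Rightarrow> form" where
  "is_strongly_maximal D le x =
     (\<^bold>\<forall>u. \<^bold>\<forall>v. D u \<^bold>\<and> D v \<^bold>\<and> way_below D le u v \<^bold>\<longrightarrow>
        way_below D le u x \<^bold>\<or>
        (\<^bold>\<exists>U. \<^bold>\<exists>V. scott_open D le U \<^bold>\<and> scott_open D le V \<^bold>\<and> v \<^bold>\<in> U \<^bold>\<and> x \<^bold>\<in> V \<^bold>\<and>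
           \<^bold>\<not> (\<^bold>\<exists>z. z \<^bold>\<in> U \<^bold>\<and> z \<^bold>\<in> V)))"

text \<open>
  The ideal completion of \<open>A\<^sup>*\<close>, to be ordered by inclusion (suprema of directed sets are then
  unions). For a set \<open>A\<close> it is a set in IZF, by power set and separation, so quantifying over the
  predicate is quantifying over that set.
\<close>

definition is_ideal :: "carrier \<Rightarrow> var \<Rightarrow> form" where
  "is_ideal A I =
     (is_directed (is_finseq A) (\<^bold>\<preceq>) I \<^bold>\<and>
      (\<^bold>\<forall>s. \<^bold>\<forall>t. s \<^bold>\<in> I \<^bold>\<and> is_finseq A t \<^bold>\<and> t \<^bold>\<preceq> s \<^bold>\<longrightarrow> t \<^bold>\<in> I))"

definition in_cantor :: carrier where
  "in_cantor = is_ideal is_bit"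

definition in_baire :: carrier where
  "in_baire = is_ideal is_nat"

end

theory Submission
  imports Defs Complex_Main "HOL-Library.Countable"
begin

text \<open>
  Derivability reduces to truth in a topological model. If \<open>\<Gamma>\<close> is finite and does not derive \<open>p\<close>, a
  Henkin construction (fresh variables remain available since only finitely many formulas have been
  used at each stage) extends \<open>\<Gamma>\<close> to a prime theory without \<open>p\<close> over the same variables. The prime theories
  form a space in which a formula denotes the open set of the theories containing it; disjunction and
  existence are pointwise, implication and universal quantification hold at a point if they hold
  pointwise near it, and individuals are simply the variables. So one argues in classical HOL about the
  truth values at a point, and to establish an implication or a universal statement one uses only
  assumptions whose truth is an open condition.

  In the domain of ideals of finite sequences, \<open>u\<close> is way below \<open>v\<close> iff \<open>v\<close> has an element of which all
  elements of \<open>u\<close> are prefixes. Hence an ideal \<open>x\<close> is sharp iff membership of sequences in \<open>x\<close> is decidable,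
  and strongly maximal iff each sequence is in \<open>x\<close> or incomparable to an element of \<open>x\<close>. Strong
  maximality therefore implies sharpness and maximality. Conversely it suffices that a sharp maximal
  ideal has elements of every length \<open>n\<close>. Given an element of length \<open>n\<close>, maximality excludes that all its
  one-step extensions are missing, and membership of each of them is decidable; over a finite alphabet
  this yields an extension in the ideal, and over \<open>\<nat>\<close> it does so by Markov's Principle. For the last
  implication, let \<open>f\<close> be a binary sequence that is not constantly \<open>0\<close>. The constant sequences whose
  value is the least \<open>k\<close> with \<open>f(k) = 1\<close> form a sharp maximal ideal. If it is strongly maximal, comparing
  it with the sequence \<open>\<langle>0\<rangle>\<close> produces a nonempty element, hence \<open>k\<close>.
\<close>

section \<open>Renaming\<close>

text \<open>The same variables serve as individuals at every point. In a Kripke model of prime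
  theories ordered by inclusion, such a constant domain would validate principles that are not
  intuitionistic, and an infinite theory may use up all variables, so that none is fresh.
  Neighbourhoods given by finite sets of formulas cure both: what holds near a point follows from a
  finite part of its theory. Truth values are classical at each point, so case distinctions there
  are legitimate; but failure at a point is weaker than truth of the negation, which is failure near
  the point. Decidability closes this gap, since a decidable statement that fails at a point fails
  near it. This also shows where the two domains differ. If at some point an ideal has no element
  with an entry at position \<open>n\<close>, decidability excludes each candidate value on a
  neighbourhood. Two neighbourhoods contain a common one, which settles the Cantor domain;
  infinitely many need not, and over the numbers Markov's Principle bridges this gap.\<close>

lemma lift_simps [simp]: "lift r 0 = 0" "lift r (Suc k) = Suc (r k)"
  by (simp_all add: lift_def)

lemma lift_comp: "lift r \<circ> lift r' = lift (r \<circ> r')"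
  by (rule ext) (simp add: lift_def split: nat.split)

lemma ren_ren [simp]: "ren r (ren r' p) = ren (r \<circ> r') p"
  by (induction p arbitrary: r r') (simp_all add: lift_comp)

lemma lift_id: "lift (\<lambda>k. k) = (\<lambda>k. k)"
  by (rule ext) (simp add: lift_def split: nat.split)

lemma ren_id [simp]: "ren (\<lambda>k. k) p = p"
  by (induction p) (simp_all add: lift_id)

lemma ren_inst: "ren r (inst y p) = inst (r y) (ren (lift r) p)"
proof -
  have "r \<circ> case_nat y (\<lambda>k. k) = case_nat (r y) (\<lambda>k. k) \<circ> lift r"
    by (rule ext) (simp split: nat.split)
  then show ?thesis by (simp add: inst_def)
qed

lemma inst_ren_lift: "inst y (ren (lift r) p) = ren (case_nat y r) p"
proof -
  have "case_nat y (\<lambda>k. k) \<circ> lift r = case_nat y r"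
    by (rule ext) (simp split: nat.split)
  then show ?thesis by (simp add: inst_def)
qed

lemma ren_Suc_ren: "ren Suc (ren r p) = ren (lift r) (ren Suc p)"
proof -
  have "Suc \<circ> r = lift r \<circ> Suc" by (rule ext) simp
  then show ?thesis by simp
qed

text \<open>Only finitely many indices occur in a formula. Freshness of a variable is expressed by
  such a bound rather than by a set of free variables.\<close>

lemma ren_bounded: "\<exists>N. \<forall>r r'. (\<forall>i<N. r i = r' i) \<longrightarrow> ren r p = ren r' p"
proof (induction p)
  case Bot
  show ?case by simp
next
  case (Mem i j)
  show ?case by (rule exI[of _ "Suc (max i j)"]) (auto simp: less_Suc_eq_le)
next
  case (Eq i j)
  show ?case by (rule exI[of _ "Suc (max i j)"]) (auto simp: less_Suc_eq_le)
next
  case (And p q)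
  then obtain M N where
    "\<And>r r'. (\<forall>i<M. r i = r' i) \<longrightarrow> ren r p = ren r' p"
    "\<And>r r'. (\<forall>i<N. r i = r' i) \<longrightarrow> ren r q = ren r' q"
    by metis
  then show ?case by (intro exI[of _ "max M N"]) simp
next
  case (Or p q)
  then obtain M N where
    "\<And>r r'. (\<forall>i<M. r i = r' i) \<longrightarrow> ren r p = ren r' p"
    "\<And>r r'. (\<forall>i<N. r i = r' i) \<longrightarrow> ren r q = ren r' q"
    by metis
  then show ?case by (intro exI[of _ "max M N"]) simp
next
  case (Imp p q)
  then obtain M N where
    "\<And>r r'. (\<forall>i<M. r i = r' i) \<longrightarrow> ren r p = ren r' p"
    "\<And>r r'. (\<forall>i<N. r i = r' i) \<longrightarrow> ren r q = ren r' q"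
    by metis
  then show ?case by (intro exI[of _ "max M N"]) simp
next
  case (All p)
  then obtain N where N: "\<And>r r'. (\<forall>i<N. r i = r' i) \<longrightarrow> ren r p = ren r' p" by metis
  show ?case
    by (rule exI[of _ N]) (auto simp: lift_def intro!: N[rule_format] split: nat.split)
next
  case (Ex p)
  then obtain N where N: "\<And>r r'. (\<forall>i<N. r i = r' i) \<longrightarrow> ren r p = ren r' p" by metis
  show ?case
    by (rule exI[of _ N]) (auto simp: lift_def intro!: N[rule_format] split: nat.split)
qed

lemma ren_bounded_finite:
  assumes "finite G"
  shows "\<exists>N. \<forall>p\<in>G. \<forall>r r'. (\<forall>i<N. r i = r' i) \<longrightarrow> ren r p = ren r' p"
proof -
  obtain b where b: "\<And>p r r'. (\<forall>i<b p. r i = r' i) \<longrightarrow> ren r p = ren r' p"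
    using ren_bounded by metis
  have "b p \<le> Max (b ` G)" if "p \<in> G" for p
    using that assms by simp
  then show ?thesis
    by (intro exI[of _ "Max (b ` G)"]) (meson b less_le_trans)
qed

section \<open>Derivations\<close>

lemma derives_mono: "derives T G p \<Longrightarrow> G \<subseteq> D \<Longrightarrow> derives T D p"
proof (induction arbitrary: D rule: derives.induct)
  case (OrE G p q r)
  then show ?case by (metis derives.OrE insert_mono)
next
  case (ImpI p G q)
  then show ?case by (metis derives.ImpI insert_mono)
next
  case (AllI G p)
  then show ?case by (metis derives.AllI image_mono)
next
  case (ExE G p q)
  then show ?case by (metis derives.ExE image_mono insert_mono)
next
  case (Assm p G)
  then show ?case by (simp add: derives.Assm subsetD)
next
  case (Axiom p G)
  then show ?case by (simp add: derives.Axiom)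
next
  case (BotE G p)
  then show ?case using derives.BotE by blast
next
  case (AndI G p q)
  then show ?case by (simp add: derives.AndI)
next
  case (AndE1 G p q)
  then show ?case by (meson derives.AndE1)
next
  case (AndE2 G p q)
  then show ?case by (meson derives.AndE2)
next
  case (OrI1 G p q)
  then show ?case by (simp add: derives.OrI1)
next
  case (OrI2 G p q)
  then show ?case by (simp add: derives.OrI2)
next
  case (ImpE G p q)
  then show ?case by (meson derives.ImpE)
next
  case (AllE G p y)
  then show ?case by (meson derives.AllE)
next
  case (ExI G y p)
  then show ?case by (meson derives.ExI)
next
  case (EqI G x)
  show ?case by (rule derives.EqI)
next
  case (EqE G x y p)
  show ?case by (rule derives.EqE[OF EqE.IH(1)[OF EqE.prems] EqE.IH(2)[OF EqE.prems]])
qed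

lemma derives_cut: "derives T G p \<Longrightarrow> derives T (insert p G) q \<Longrightarrow> derives T G q"
  using derives.ImpE derives.ImpI by blast

text \<open>\<open>AllI\<close> shifts the hypotheses but leaves the axioms alone. Closure under
  renaming expresses that free variables of axioms are read universally, and makes derivations
  stable under renaming.\<close>

locale axiom_set =
  fixes T :: "fm set"
  assumes ren_axiom: "p \<in> T \<Longrightarrow> ren r p \<in> T"
begin

lemma derives_ren: "derives T G p \<Longrightarrow> derives T (ren r ` G) (ren r p)"
proof (induction arbitrary: r rule: derives.induct)
  case (Axiom p G)
  then show ?case by (simp add: derives.Axiom ren_axiom)
next
  case (OrE G p q s)
  show ?case
    by (rule derives.OrE[of T _ "ren r p" "ren r q"])
      (use OrE.IH[of r] in \<open>simp_all only: ren.simps image_insert\<close>)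
next
  case (ImpI p G q)
  then show ?case by (simp add: derives.ImpI)
next
  case (ImpE G p q)
  show ?case
    by (rule derives.ImpE[of T _ "ren r p"]) (use ImpE.IH[of r] in \<open>simp_all only: ren.simps\<close>)
next
  case (AllI G p)
  have "ren Suc ` ren r ` G = ren (lift r) ` ren Suc ` G"
    by (simp only: image_image ren_Suc_ren)
  then show ?case using AllI.IH[of "lift r"] by (simp only: ren.simps derives.AllI)
next
  case (AllE G p y)
  then show ?case using derives.AllE by (simp add: ren_inst)
next
  case (ExI G y p)
  show ?case
    using derives.ExI[of T "ren r ` G" "r y" "ren (lift r) p"] ExI.IH[of r] by (simp add: ren_inst)
next
  case (ExE G p q)
  have eq: "ren Suc ` ren r ` G = ren (lift r) ` ren Suc ` G"
    by (simp only: image_image ren_Suc_ren)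
  show ?case
  proof (rule derives.ExE)
    show "derives T (ren r ` G) (Ex (ren (lift r) p))" using ExE.IH(1)[of r] by simp
    show "derives T (insert (ren (lift r) p) (ren Suc ` ren r ` G)) (ren Suc (ren r q))"
      using ExE.IH(2)[of "lift r"] by (simp only: eq image_insert ren_Suc_ren)
  qed
next
  case (EqE G x y p)
  show ?case
    unfolding ren_inst
    by (rule derives.EqE[of T _ "r x"]) (use EqE.IH[of r] in \<open>simp_all only: ren.simps ren_inst\<close>)
next
  case (Assm p G)
  then show ?case by (simp add: derives.Assm)
next
  case (BotE G p)
  then show ?case using derives.BotE by simp
next
  case (AndE1 G p q)
  show ?case using AndE1.IH[of r] by (auto intro: derives.AndE1)
next
  case (AndE2 G p q)
  show ?case using AndE2.IH[of r] by (auto intro: derives.AndE2)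
qed (simp_all add: derives.AndI derives.OrI1 derives.OrI2 derives.EqI)

text \<open>The renaming that swaps a fresh variable \<open>y\<close> for the index \<open>0\<close> of a new quantifier.\<close>

lemma fresh_variable:
  assumes "finite G"
  obtains y r where "\<And>q. q \<in> G \<Longrightarrow> ren r q = ren Suc q" "ren r (inst y p) = p"
    "ren r s = ren Suc s"
proof -
  obtain N where N: "\<And>q r r'. q \<in> insert (Ex p) (insert s G) \<Longrightarrow> (\<forall>i<N. r i = r' i) \<Longrightarrow>
      ren r q = ren r' q"
    using ren_bounded_finite[of "insert (Ex p) (insert s G)"] assms by (metis finite.insertI)
  \<comment> \<open>\<open>N\<close> exceeds every index in use, so \<open>r\<close> agrees with
    \<open>Suc\<close> there, while \<open>N\<close> itself becomes the index 0 of a new quantifier.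
    The bound is taken for \<open>Ex p\<close>, whose free indices are those of \<open>p\<close>
    other than 0, lowered by one.\<close>
  define r where "r = (\<lambda>k. if k = N then 0 else Suc k)"
  have "ren r (Ex p) = ren Suc (Ex p)"
    by (rule N) (auto simp: r_def)
  then have "ren (lift r) p = ren (lift Suc) p" by simp
  then have "ren r (inst N p) = inst 0 (ren (lift Suc) p)"
    by (simp add: ren_inst r_def)
  moreover have "case_nat 0 Suc = (\<lambda>k. k)"
    by (rule ext) (simp split: nat.split)
  ultimately have "ren r (inst N p) = p" by (simp add: inst_ren_lift)
  then show thesis
    by (intro that[of r N]) (auto intro!: N simp: r_def)
qed

lemma All_intro_finite:
  assumes "finite G" and "\<And>y. derives T G (inst y p)"
  shows "derives T G (All p)"
proof -
  obtain y r where r: "\<And>q. q \<in> G \<Longrightarrow> ren r q = ren Suc q" "ren r (inst y p) = p"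
    using fresh_variable[OF assms(1), of p Bot] by metis
  have "ren r ` G = ren Suc ` G" using r(1) by auto
  then show ?thesis using derives_ren[OF assms(2)[of y], of r] r(2) derives.AllI by simp
qed

lemma Ex_elim_finite:
  assumes "finite G" and "derives T G (Ex p)" and "\<And>y. derives T (insert (inst y p) G) q"
  shows "derives T G q"
proof -
  obtain y r where r: "\<And>q. q \<in> G \<Longrightarrow> ren r q = ren Suc q" "ren r (inst y p) = p"
      "ren r q = ren Suc q"
    using fresh_variable[OF assms(1), of p q] by metis
  have "ren r ` insert (inst y p) G = insert p (ren Suc ` G)" using r(1,2) by auto
  then show ?thesis
    using derives_ren[OF assms(3)[of y], of r] r(3) assms(2) derives.ExE by metis
qed

section \<open>Prime theories\<close>

text \<open>Closure refers to finite subsets, matching the finite stages of the construction, and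
  existential witnesses are variables, so that the language stays the same.\<close>

definition prime_theory :: "fm set \<Rightarrow> bool" where
  "prime_theory w \<longleftrightarrow>
     Bot \<notin> w \<and>
     (\<forall>G p. finite G \<longrightarrow> G \<subseteq> w \<longrightarrow> derives T G p \<longrightarrow> p \<in> w) \<and>
     (\<forall>p q. Or p q \<in> w \<longrightarrow> p \<in> w \<or> q \<in> w) \<and>
     (\<forall>p. Ex p \<in> w \<longrightarrow> (\<exists>y. inst y p \<in> w))"

end

instance fm :: countable
  by countable_datatype

context axiom_set
begin

text \<open>If \<open>p\<close> can be added without deriving \<open>r\<close>, it is added,
  together with an instance when it is existential: were every instance to derive \<open>r\<close>,
  so would \<open>p\<close>. Otherwise the derivation of \<open>r\<close> from \<open>p\<close>
  records why \<open>p\<close> was left out.\<close>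

lemma prime_extension_step:
  assumes G: "finite G" "\<not> derives T G r"
  shows "\<exists>G'. finite G' \<and> \<not> derives T G' r \<and> G \<subseteq> G' \<and>
    (derives T (insert p G) r \<or> p \<in> G' \<and> (\<forall>q. p = Ex q \<longrightarrow> (\<exists>y. inst y q \<in> G')))"
proof (cases "derives T (insert p G) r")
  case True
  then show ?thesis using G by blast
next
  case False
  show ?thesis
  proof (cases "\<exists>q. p = Ex q")
    case True
    then obtain q where q: "p = Ex q" by blast
    have "\<exists>y. \<not> derives T (insert (inst y q) (insert p G)) r"
      using Ex_elim_finite[of "insert p G" q r] False G q derives.Assm by blast
    then obtain y where "\<not> derives T (insert (inst y q) (insert p G)) r" ..
    then show ?thesis using G(1) q
      by (intro exI[of _ "insert (inst y q) (insert p G)"] conjI disjI2) auto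
  next
    case False': False
    show ?thesis using G False False' by (intro exI[of _ "insert p G"]) auto
  qed
qed

theorem prime_extension:
  assumes G: "finite G" "\<not> derives T G r"
  obtains w where "prime_theory w" "G \<subseteq> w" "r \<notin> w"
proof -
  let ?Q = "\<lambda>p A B. A \<subseteq> B \<and>
    (derives T (insert p A) r \<or> p \<in> B \<and> (\<forall>q. p = Ex q \<longrightarrow> (\<exists>y. inst y q \<in> B)))"
  \<comment> \<open>Stage \<open>n\<close> treats the formula with code \<open>n\<close>, so every
    formula has its turn.\<close>
  have "\<exists>f. \<forall>n. (finite (f n) \<and> \<not> derives T (f n) r \<and> G \<subseteq> f n) \<and> ?Q (from_nat n) (f n) (f (Suc n))"
  proof (rule dependent_nat_choice)
    show "\<exists>x. finite x \<and> \<not> derives T x r \<and> G \<subseteq> x" using G by blast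
  next
    fix x n
    assume "finite x \<and> \<not> derives T x r \<and> G \<subseteq> x"
    then show "\<exists>y. (finite y \<and> \<not> derives T y r \<and> G \<subseteq> y) \<and> ?Q (from_nat n) x y"
      using prime_extension_step[of x r "from_nat n"] by blast
  qed
  then obtain f where fin: "\<And>n. finite (f n)" and nd: "\<And>n. \<not> derives T (f n) r"
    and Gf: "\<And>n. G \<subseteq> f n" and step: "\<And>n. ?Q (from_nat n) (f n) (f (Suc n))"
    by blast
  have mono: "f m \<subseteq> f n" if "m \<le> n" for m n
    by (rule lift_Suc_mono_le[OF _ that]) (use step in blast)
  let ?w = "\<Union>n. f n"
  have sub: "\<exists>n. H \<subseteq> f n" if "finite H" "H \<subseteq> ?w" for H
    using that
  proof (induction rule: finite_induct)
    case (insert p H)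
    then obtain m n where "p \<in> f m" "H \<subseteq> f n" by auto
    then have "insert p H \<subseteq> f (max m n)"
      using mono[of m "max m n"] mono[of n "max m n"] by auto
    then show ?case ..
  qed simp
  have consistent: "\<not> derives T H r" if "finite H" "H \<subseteq> ?w" for H
    using sub[OF that] nd derives_mono by blast
  \<comment> \<open>A formula that is consistent with every stage was accepted at the stage numbered
    by its own code.\<close>
  have max: "p \<in> ?w" if "\<And>n. \<not> derives T (insert p (f n)) r" for p
    using step[of "to_nat p"] that[of "to_nat p"] by auto
  have closed: "p \<in> ?w" if H: "finite H" "H \<subseteq> ?w" "derives T H p" for H p
  proof (rule max)
    fix n
    \<comment> \<open>\<open>H\<close> need not lie in stage \<open>n\<close>, but both lie in the
      union, so together they still do not derive \<open>r\<close>.\<close>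
    have "derives T (f n \<union> H) p" using H(3) by (rule derives_mono) simp
    moreover have "\<not> derives T (f n \<union> H) r"
      using H fin by (intro consistent) auto
    ultimately have "\<not> derives T (insert p (f n \<union> H)) r"
      using derives_cut by blast
    then show "\<not> derives T (insert p (f n)) r"
      by (meson derives_mono insert_mono Un_upper1)
  qed
  \<comment> \<open>If both disjuncts were rejected, the stages that derive \<open>r\<close> from
    \<open>p\<close> and from \<open>q\<close> would together derive it from \<open>Or p q\<close>,
    against the consistency of finite parts of the union.\<close>
  have Or: "p \<in> ?w \<or> q \<in> ?w" if "Or p q \<in> ?w" for p q
  proof (rule ccontr)
    assume "\<not> (p \<in> ?w \<or> q \<in> ?w)"
    then have "p \<notin> ?w" "q \<notin> ?w" by auto
    then obtain m n where mn: "derives T (insert p (f m)) r" "derives T (insert q (f n)) r"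
      using max[of p] max[of q] by fast
    let ?H = "insert (Or p q) (f m \<union> f n)"
    have "derives T (insert p ?H) r" by (rule derives_mono[OF mn(1)]) blast
    moreover have "derives T (insert q ?H) r" by (rule derives_mono[OF mn(2)]) blast
    moreover have "derives T ?H (Or p q)" by (rule derives.Assm) simp
    ultimately have "derives T ?H r" by (rule derives.OrE[rotated])
    moreover have "\<not> derives T ?H r"
      using that fin by (intro consistent) auto
    ultimately show False by contradiction
  qed
  have Ex: "\<exists>y. inst y p \<in> ?w" if "Ex p \<in> ?w" for p
  proof -
    let ?n = "to_nat (Ex p)"
    have "\<not> derives T (insert (Ex p) (f ?n)) r"
      using that fin by (intro consistent) auto
    then show ?thesis using step[of ?n] by auto
  qed
  have r: "r \<notin> ?w" using nd derives.Assm by blast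
  moreover have "Bot \<notin> ?w"
    using nd derives.Assm derives.BotE by blast
  ultimately have "prime_theory ?w"
    unfolding prime_theory_def using closed Or Ex by blast
  moreover have "G \<subseteq> ?w" using Gf by blast
  ultimately show thesis using r that[of ?w] by simp
qed

end

section \<open>Topological semantics\<close>

text \<open>
  Propositions are open sets of a space of points, and individuals range over the variables. Falsity,
  conjunction, disjunction and the existential quantifier are pointwise, while implication and the
  universal quantifier are interiors, i.e. hold at a point if they do so pointwise near it.
\<close>

primrec sat :: "('w::topological_space \<Rightarrow> nat \<Rightarrow> nat \<Rightarrow> bool) \<Rightarrow> ('w \<Rightarrow> nat \<Rightarrow> nat \<Rightarrow> bool) \<Rightarrow>
    'w \<Rightarrow> (nat \<Rightarrow> nat) \<Rightarrow> fm \<Rightarrow> bool" where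
  "sat M E w e Bot = False"
| "sat M E w e (Mem i j) = M w (e i) (e j)"
| "sat M E w e (Eq i j) = E w (e i) (e j)"
| "sat M E w e (And p q) = (sat M E w e p \<and> sat M E w e q)"
| "sat M E w e (Or p q) = (sat M E w e p \<or> sat M E w e q)"
| "sat M E w e (Imp p q) = (\<forall>\<^sub>F v in nhds w. sat M E v e p \<longrightarrow> sat M E v e q)"
| "sat M E w e (All p) = (\<forall>\<^sub>F v in nhds w. \<forall>a. sat M E v (case_nat a e) p)"
| "sat M E w e (Ex p) = (\<exists>a. sat M E w (case_nat a e) p)"

lemma sat_ren: "sat M E w e (ren r p) = sat M E w (\<lambda>k. e (r k)) p"
proof (induction p arbitrary: w e r)
  case (All p)
  have "(\<lambda>k. case_nat a e (lift r k)) = case_nat a (\<lambda>k. e (r k))" for a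
    by (rule ext) (simp add: lift_def split: nat.split)
  then show ?case by (simp add: All)
next
  case (Ex p)
  have "(\<lambda>k. case_nat a e (lift r k)) = case_nat a (\<lambda>k. e (r k))" for a
    by (rule ext) (simp add: lift_def split: nat.split)
  then show ?case by (simp add: Ex)
qed simp_all

lemma open_eventually_nhds: "open {w. eventually P (nhds w)}"
proof -
  have "{w. eventually P (nhds w)} = \<Union>{S. open S \<and> (\<forall>x\<in>S. P x)}"
    by (auto simp: eventually_nhds)
  then show ?thesis by (simp add: open_Union)
qed

text \<open>Equality is an open congruence and not identity, because distinct variables may be equal
  according to some prime theories only. The axioms hold in all environments, which reads their free
  variables universally.\<close>

locale izf_model =
  fixes M E :: "'w::topological_space \<Rightarrow> nat \<Rightarrow> nat \<Rightarrow> bool"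
  assumes open_M: "open {w. M w a b}"
    and open_E: "open {w. E w a b}"
    and E_refl: "E w a a"
    and E_sym: "E w a b \<Longrightarrow> E w b a"
    and E_trans: "E w a b \<Longrightarrow> E w b c \<Longrightarrow> E w a c"
    and M_cong: "E w a a' \<Longrightarrow> E w b b' \<Longrightarrow> M w a b \<Longrightarrow> M w a' b'"
    and sat_IZF: "p \<in> IZF \<Longrightarrow> sat M E w e p"

section \<open>The canonical model of prime theories of IZF\<close>

text \<open>The single axioms are closed. In a scheme instance only the parameters of the formula
  are free, so renaming yields the instance for the formula renamed below its one or two
  arguments.\<close>

lemma ren_IZF:
  assumes "p \<in> IZF"
  shows "ren r p \<in> IZF"
proof -
  have [simp]: "ren r (ax_extensionality 0) = ax_extensionality 0"
    "ren r (ax_pairing 0) = ax_pairing 0" "ren r (ax_union 0) = ax_union 0"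
    "ren r (ax_powerset 0) = ax_powerset 0" "ren r (ax_infinity 0) = ax_infinity 0"
    by (simp_all add: ax_extensionality_def ax_pairing_def ax_union_def ax_powerset_def
        ax_infinity_def is_upair_def is_inductive_def is_succ_def is_empty_def subset_fm_def
        fall_def fex_def fimp_def fiff_def fand_def f_or_def fnot_def fmem_def feq_def
        numeral_2_eq_2 numeral_3_eq_3)
  have sep: "ren r (ax_separation q 0) = ax_separation (ren (lift r) q) 0" for q
    by (simp add: ax_separation_def app1_def fall_def fex_def fiff_def fimp_def fand_def fmem_def
        numeral_2_eq_2)
      (auto simp: fun_eq_iff split: nat.split intro!: arg_cong2[of _ _ _ _ ren])
  have coll: "ren r (ax_collection q 0) = ax_collection (ren (lift (lift r)) q) 0" for q
    by (simp add: ax_collection_def app2_def fall_def fex_def fiff_def fimp_def fand_def fmem_def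
        numeral_2_eq_2)
      (auto simp: fun_eq_iff split: nat.split intro!: arg_cong2[of _ _ _ _ ren])
  have ind: "ren r (ax_set_induction q 0) = ax_set_induction (ren (lift r) q) 0" for q
    by (simp add: ax_set_induction_def app1_def fall_def fex_def fiff_def fimp_def fand_def fmem_def
        numeral_2_eq_2)
      (auto simp: fun_eq_iff split: nat.split intro!: arg_cong2[of _ _ _ _ ren])
  show ?thesis using assms by (auto simp: IZF_def sep coll ind)
qed

interpretation izf: axiom_set IZF
  by unfold_locales (rule ren_IZF)

text \<open>
  Types are not empty, so the space of points consists of junk should there be no prime theory.
\<close>

typedef point = "{w. izf.prime_theory w \<or> (\<forall>u. \<not> izf.prime_theory u)}"
  by blast

instantiation point :: topological_space
begin

definition open_point :: "point set \<Rightarrow> bool" where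
  "open_point S \<longleftrightarrow> (\<forall>w\<in>S. \<exists>H. finite H \<and> H \<subseteq> Rep_point w \<and> (\<forall>v. H \<subseteq> Rep_point v \<longrightarrow> v \<in> S))"

instance
proof
  show "open (UNIV :: point set)" unfolding open_point_def by auto
next
  fix S T :: "point set"
  assume ST: "open S" "open T"
  show "open (S \<inter> T)"
    unfolding open_point_def
  proof
    fix w
    assume "w \<in> S \<inter> T"
    then have "w \<in> S" "w \<in> T" by simp_all
    obtain H where H: "finite H" "H \<subseteq> Rep_point w" "\<forall>v. H \<subseteq> Rep_point v \<longrightarrow> v \<in> S"
      using ST(1)[unfolded open_point_def, rule_format, OF \<open>w \<in> S\<close>] by blast
    obtain K where K: "finite K" "K \<subseteq> Rep_point w" "\<forall>v. K \<subseteq> Rep_point v \<longrightarrow> v \<in> T"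
      using ST(2)[unfolded open_point_def, rule_format, OF \<open>w \<in> T\<close>] by blast
    from H K show "\<exists>H. finite H \<and> H \<subseteq> Rep_point w \<and> (\<forall>v. H \<subseteq> Rep_point v \<longrightarrow> v \<in> S \<inter> T)"
      by (intro exI[of _ "H \<union> K"]) simp
  qed
next
  fix K :: "point set set"
  assume "\<forall>S\<in>K. open S"
  then show "open (\<Union>K)" unfolding open_point_def by (meson UnionE UnionI)
qed

end

definition point_mem :: "point \<Rightarrow> nat \<Rightarrow> nat \<Rightarrow> bool" where
  "point_mem w i j \<longleftrightarrow> Mem i j \<in> Rep_point w"

definition point_eq :: "point \<Rightarrow> nat \<Rightarrow> nat \<Rightarrow> bool" where
  "point_eq w i j \<longleftrightarrow> Eq i j \<in> Rep_point w"

lemma eventually_nhds_point: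
  "eventually P (nhds w) \<longleftrightarrow>
    (\<exists>H. finite H \<and> H \<subseteq> Rep_point w \<and> (\<forall>v. H \<subseteq> Rep_point v \<longrightarrow> P v))"
proof
  assume "eventually P (nhds w)"
  then show "\<exists>H. finite H \<and> H \<subseteq> Rep_point w \<and> (\<forall>v. H \<subseteq> Rep_point v \<longrightarrow> P v)"
    by (simp add: eventually_nhds open_point_def) meson
next
  assume "\<exists>H. finite H \<and> H \<subseteq> Rep_point w \<and> (\<forall>v. H \<subseteq> Rep_point v \<longrightarrow> P v)"
  then obtain H where "finite H" "H \<subseteq> Rep_point w" "\<forall>v. H \<subseteq> Rep_point v \<longrightarrow> P v" by blast
  then show "eventually P (nhds w)"
    unfolding eventually_nhds open_point_def
    by (intro exI[of _ "{v. H \<subseteq> Rep_point v}"]) auto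
qed

context
  assumes consistent: "\<exists>w. izf.prime_theory w"
begin

lemma prime_point: "izf.prime_theory (Rep_point w)"
  using Rep_point[of w] consistent by blast

lemma point_closed: "finite H \<Longrightarrow> H \<subseteq> Rep_point w \<Longrightarrow> derives IZF H p \<Longrightarrow> p \<in> Rep_point w"
  using prime_point[of w] unfolding izf.prime_theory_def by blast

text \<open>The completeness step, read contrapositively from \<open>prime_extension\<close>.
  Finiteness of \<open>H\<close> makes the fresh variables of that construction available.\<close>

lemma derives_if_points:
  assumes "finite H" and "\<And>v. H \<subseteq> Rep_point v \<Longrightarrow> p \<in> Rep_point v"
  shows "derives IZF H p"
proof (rule ccontr)
  assume "\<not> derives IZF H p"
  then obtain w where w: "izf.prime_theory w" "H \<subseteq> w" "p \<notin> w"
    using izf.prime_extension assms(1) by blast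
  then show False using assms(2)[of "Abs_point w"] by (simp add: Abs_point_inverse)
qed

lemma And_point: "And p q \<in> Rep_point w \<longleftrightarrow> p \<in> Rep_point w \<and> q \<in> Rep_point w"
proof -
  have "p \<in> Rep_point w" if "And p q \<in> Rep_point w"
    using that by (intro point_closed[of "{And p q}"]) (auto intro: derives.AndE1 derives.Assm)
  moreover have "q \<in> Rep_point w" if "And p q \<in> Rep_point w"
    using that by (intro point_closed[of "{And p q}"]) (auto intro: derives.AndE2 derives.Assm)
  moreover have "And p q \<in> Rep_point w" if "p \<in> Rep_point w" "q \<in> Rep_point w"
    using that by (intro point_closed[of "{p, q}"]) (auto intro: derives.AndI derives.Assm)
  ultimately show ?thesis by blast
qed

lemma Or_point: "Or p q \<in> Rep_point w \<longleftrightarrow> p \<in> Rep_point w \<or> q \<in> Rep_point w"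
proof -
  have "p \<in> Rep_point w \<or> q \<in> Rep_point w" if "Or p q \<in> Rep_point w"
    using that prime_point[of w] unfolding izf.prime_theory_def by blast
  moreover have "Or p q \<in> Rep_point w" if "p \<in> Rep_point w"
    using that by (intro point_closed[of "{p}"]) (auto intro: derives.OrI1 derives.Assm)
  moreover have "Or p q \<in> Rep_point w" if "q \<in> Rep_point w"
    using that by (intro point_closed[of "{q}"]) (auto intro: derives.OrI2 derives.Assm)
  ultimately show ?thesis by blast
qed

lemma Ex_point: "Ex p \<in> Rep_point w \<longleftrightarrow> (\<exists>y. inst y p \<in> Rep_point w)"
proof -
  have "\<exists>y. inst y p \<in> Rep_point w" if "Ex p \<in> Rep_point w"
    using that prime_point[of w] unfolding izf.prime_theory_def by blast
  moreover have "Ex p \<in> Rep_point w" if "inst y p \<in> Rep_point w" for y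
    using that by (intro point_closed[of "{inst y p}"]) (auto intro: derives.ExI derives.Assm)
  ultimately show ?thesis by blast
qed

text \<open>A neighbourhood of \<open>w\<close> is given by a finite part \<open>H\<close> of its
  theory. If \<open>q\<close> holds at all points containing \<open>H\<close> and \<open>p\<close>,
  it is derivable from them, and \<open>ImpI\<close> yields an implication derived from
  \<open>H\<close>, which therefore lies in the theory.\<close>

lemma Imp_point:
  "Imp p q \<in> Rep_point w \<longleftrightarrow> (\<forall>\<^sub>F v in nhds w. p \<in> Rep_point v \<longrightarrow> q \<in> Rep_point v)"
proof
  assume *: "Imp p q \<in> Rep_point w"
  have "q \<in> Rep_point v" if "Imp p q \<in> Rep_point v" "p \<in> Rep_point v" for v
    using that by (intro point_closed[of "{Imp p q, p}"]) (auto intro: derives.ImpE derives.Assm)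
  then show "\<forall>\<^sub>F v in nhds w. p \<in> Rep_point v \<longrightarrow> q \<in> Rep_point v"
    unfolding eventually_nhds_point using * by (intro exI[of _ "{Imp p q}"]) auto
next
  assume "\<forall>\<^sub>F v in nhds w. p \<in> Rep_point v \<longrightarrow> q \<in> Rep_point v"
  then obtain H where H: "finite H" "H \<subseteq> Rep_point w"
    "\<And>v. H \<subseteq> Rep_point v \<Longrightarrow> p \<in> Rep_point v \<Longrightarrow> q \<in> Rep_point v"
    unfolding eventually_nhds_point by blast
  have "derives IZF (insert p H) q"
    using H by (intro derives_if_points) auto
  then show "Imp p q \<in> Rep_point w"
    using H by (intro point_closed[of H]) (auto intro: derives.ImpI)
qed

text \<open>\<open>All_intro_finite\<close> needs all instances derived from one finite
  \<open>H\<close>. This is why one neighbourhood serves all \<open>y\<close>, and why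
  \<open>sat\<close> puts the quantifier over individuals inside the interior.\<close>

lemma All_point:
  "All p \<in> Rep_point w \<longleftrightarrow> (\<forall>\<^sub>F v in nhds w. \<forall>y. inst y p \<in> Rep_point v)"
proof
  assume *: "All p \<in> Rep_point w"
  have "inst y p \<in> Rep_point v" if "All p \<in> Rep_point v" for v y
    using that by (intro point_closed[of "{All p}"]) (auto intro: derives.AllE derives.Assm)
  then show "\<forall>\<^sub>F v in nhds w. \<forall>y. inst y p \<in> Rep_point v"
    unfolding eventually_nhds_point using * by (intro exI[of _ "{All p}"]) auto
next
  assume "\<forall>\<^sub>F v in nhds w. \<forall>y. inst y p \<in> Rep_point v"
  then obtain H where H: "finite H" "H \<subseteq> Rep_point w"
    "\<And>v y. H \<subseteq> Rep_point v \<Longrightarrow> inst y p \<in> Rep_point v"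
    unfolding eventually_nhds_point by meson
  have "derives IZF H (inst y p)" for y
    using H by (intro derives_if_points) auto
  then show "All p \<in> Rep_point w"
    using H by (intro point_closed[of H]) (auto intro: izf.All_intro_finite)
qed

lemma Bot_point: "Bot \<notin> Rep_point w"
  using prime_point[of w] unfolding izf.prime_theory_def by blast

text \<open>The truth lemma: an environment acts on formulas as a renaming, extending it is
  instantiation below a binder, and each connective is covered by one of the equivalences
  above.\<close>

lemma sat_point: "sat point_mem point_eq w e p \<longleftrightarrow> ren e p \<in> Rep_point w"
  by (induction p arbitrary: w e)
    (simp_all add: point_mem_def point_eq_def Bot_point And_point Or_point Imp_point All_point
      Ex_point inst_ren_lift)

lemma izf_model_point: "izf_model point_mem point_eq"
proof
  fix w a b
  have "open {w. p \<in> Rep_point w}" for p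
    unfolding open_point_def by (auto intro!: exI[of _ "{p}"])
  then show "open {w. point_mem w a b}" "open {w. point_eq w a b}"
    by (simp_all add: point_mem_def point_eq_def)
next
  fix w a
  show "point_eq w a a"
    unfolding point_eq_def by (rule point_closed[of "{}"]) (auto intro: derives.EqI)
next
  \<comment> \<open>Leibniz's law. In the formula \<open>p\<close> the index 0 marks the place to be
    replaced, and an index \<open>Suc a\<close> denotes the variable \<open>a\<close>.\<close>
  have subst: "inst b p \<in> Rep_point w" if "Eq a b \<in> Rep_point w" "inst a p \<in> Rep_point w" for w a b p
    using that
    by (intro point_closed[of "{Eq a b, inst a p}"]) (auto intro: derives.EqE derives.Assm)
  show sym: "point_eq w b a" if "point_eq w a b" for w a b
    using that subst[of a b w "Eq 0 (Suc a)"] point_closed[of "{}" w "Eq a a"]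
    by (simp add: point_eq_def inst_def derives.EqI)
  show "point_eq w a c" if "point_eq w a b" "point_eq w b c" for w a b c
    using that subst[of b c w "Eq (Suc a) 0"] by (simp add: point_eq_def inst_def)
  show "point_mem w a' b'" if "point_eq w a a'" "point_eq w b b'" "point_mem w a b" for w a a' b b'
    using that subst[of a a' w "Mem 0 (Suc b)"] subst[of b b' w "Mem (Suc a') 0"]
    by (simp add: point_eq_def point_mem_def inst_def)
next
  fix p w and e :: "nat \<Rightarrow> nat"
  assume "p \<in> IZF"
  then have "derives IZF {} (ren e p)" by (simp add: derives.Axiom ren_IZF)
  then show "sat point_mem point_eq w e p"
    unfolding sat_point by (intro point_closed[of "{}"]) auto
qed

end

text \<open>It suffices to consider models over the single space \<open>point\<close>, because truth
  throughout the canonical model is membership in every prime theory.\<close>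

theorem IZF_proves_if_valid:
  assumes "\<And>M E w e. izf_model M E \<Longrightarrow> sat M E (w :: point) e (P 0)"
  shows "IZF_proves P"
proof (rule ccontr)
  assume *: "\<not> IZF_proves P"
  \<comment> \<open>By \<open>prime_extension\<close> an underivable formula provides a prime
    theory, so the type \<open>point\<close> contains no junk.\<close>
  then have consistent: "\<exists>w. izf.prime_theory w"
    using izf.prime_extension[of "{}" "P 0"] unfolding IZF_proves_def by blast
  have "P 0 \<in> Rep_point w" for w
    using assms[OF izf_model_point[OF consistent], of w "\<lambda>k. k"] by (simp add: sat_point[OF consistent])
  then show False
    using * derives_if_points[OF consistent, of "{}" "P 0"] by (simp add: IZF_proves_def)
qed

section \<open>Reasoning in a model\<close>

text \<open>Interiors are idempotent, so a block of universal quantifiers and implications collapses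
  to a single neighbourhood.\<close>

lemma eventually_all_nhds:
  "(\<forall>\<^sub>F v in nhds w. \<forall>x. \<forall>\<^sub>F u in nhds v. P u x) \<longleftrightarrow> (\<forall>\<^sub>F v in nhds w. \<forall>x. P v x)"
proof
  assume "\<forall>\<^sub>F v in nhds w. \<forall>x. \<forall>\<^sub>F u in nhds v. P u x"
  then show "\<forall>\<^sub>F v in nhds w. \<forall>x. P v x"
    by (rule eventually_mono) (blast dest: eventually_nhds_x_imp_x)
next
  assume "\<forall>\<^sub>F v in nhds w. \<forall>x. P v x"
  then have "\<forall>\<^sub>F v in nhds w. \<forall>\<^sub>F u in nhds v. \<forall>x. P u x"
    by (simp only: eventually_eventually)
  then show "\<forall>\<^sub>F v in nhds w. \<forall>x. \<forall>\<^sub>F u in nhds v. P u x"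
    by (rule eventually_mono) (blast intro: eventually_mono)
qed

lemma eventually_nhds_iff:
  "(\<forall>\<^sub>F v in nhds w. P v = Q v) \<longleftrightarrow>
    (\<forall>\<^sub>F v in nhds w. P v \<longrightarrow> Q v) \<and> (\<forall>\<^sub>F v in nhds w. Q v \<longrightarrow> P v)"
  unfolding eventually_conj_iff[symmetric] by (rule eventually_subst) (auto intro: always_eventually)

lemmas boxD = eventually_nhds_x_imp_x

text \<open>Introduction of implications and universal statements: \<open>H\<close> collects the
  assumptions, and its openness lets them persist near \<open>w\<close>. Conversely,
  \<open>boxD\<close> holds because a point lies in its neighbourhoods.\<close>

lemma boxI:
  assumes "open {v. H v}" and "H w" and "\<And>v. H v \<Longrightarrow> P v"
  shows "\<forall>\<^sub>F v in nhds w. P v"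
  unfolding eventually_nhds using assms by (intro exI[of _ "{v. H v}"]) simp

named_theorems opens

lemmas [opens] = open_Collect_conj open_Collect_disj open_Collect_ex open_Collect_const
  open_eventually_nhds

context izf_model
begin

lemmas [opens] = open_M open_E

lemma M_congL: "E w a a' \<Longrightarrow> M w a b \<Longrightarrow> M w a' b"
  using M_cong E_refl by blast

lemma M_congR: "E w b b' \<Longrightarrow> M w a b \<Longrightarrow> M w a b'"
  using M_cong E_refl by blast

lemma open_sat [opens]: "open {w. sat M E w e p}"
  by (induction p arbitrary: e) (simp_all add: opens)

text \<open>One place \<open>k\<close> of the environment is changed at a time, with
  \<open>k\<close> arbitrary because each quantifier shifts it. For implications and universal
  quantifiers, openness of \<open>E\<close> carries the equation to a neighbourhood.\<close>

lemma sat_update: "E w (e k) b \<Longrightarrow> sat M E w e p \<longleftrightarrow> sat M E w (e(k := b)) p"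
proof (induction p arbitrary: w e k)
  case (Mem i j)
  then show ?case
    by (cases "i = k"; cases "j = k"; simp; metis M_cong E_sym E_refl)
next
  case (Eq i j)
  then show ?case
    by (cases "i = k"; cases "j = k"; simp; metis E_trans E_sym E_refl)
next
  case (Imp p q)
  have "\<forall>\<^sub>F v in nhds w. E v (e k) b"
    by (rule boxI[where H = "\<lambda>v. E v (e k) b"]) (use Imp.prems in \<open>simp_all add: opens\<close>)
  then have "\<forall>\<^sub>F v in nhds w. (sat M E v e p \<longrightarrow> sat M E v e q) =
      (sat M E v (e(k := b)) p \<longrightarrow> sat M E v (e(k := b)) q)"
    by (rule eventually_mono) (use Imp.IH in blast)
  then show ?case by (simp only: sat.simps) (rule eventually_subst)
next
  case (All p)
  have upd: "(case_nat a e)(Suc k := b) = case_nat a (e(k := b))" for a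
    by (rule ext) (simp split: nat.split)
  have "\<forall>\<^sub>F v in nhds w. E v (e k) b"
    by (rule boxI[where H = "\<lambda>v. E v (e k) b"]) (use All.prems in \<open>simp_all add: opens\<close>)
  then have "\<forall>\<^sub>F v in nhds w. (\<forall>a. sat M E v (case_nat a e) p) =
      (\<forall>a. sat M E v (case_nat a (e(k := b))) p)"
  proof (rule eventually_mono)
    fix v
    assume "E v (e k) b"
    then show "(\<forall>a. sat M E v (case_nat a e) p) = (\<forall>a. sat M E v (case_nat a (e(k := b))) p)"
      using All.IH[of v "case_nat _ e" "Suc k"] by (simp only: upd nat.case)
  qed
  then show ?case by (simp only: sat.simps) (rule eventually_subst)
next
  case (Ex p)
  have upd: "(case_nat a e)(Suc k := b) = case_nat a (e(k := b))" for a
    by (rule ext) (simp split: nat.split)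
  show ?case
    using Ex.IH[of w "case_nat _ e" "Suc k"] Ex.prems by (simp only: upd nat.case sat.simps)
next
  case (And p q)
  then show ?case by simp
next
  case (Or p q)
  then show ?case by simp
qed simp

section \<open>Truth of formulas written with levels\<close>

definition env :: "nat list \<Rightarrow> (nat \<Rightarrow> nat) \<Rightarrow> nat \<Rightarrow> nat" where
  "env s e i = (if i < length s then s ! (length s - Suc i) else e (i - length s))"

text \<open>The truth of a formula whose quantifier levels have the values \<open>s\<close>.\<close>

definition holds :: "(nat \<Rightarrow> nat) \<Rightarrow> 'w \<Rightarrow> nat list \<Rightarrow> form \<Rightarrow> bool" where
  "holds e w s P = sat M E w (env s e) (P (length s))"

lemma env_snoc: "env (s @ [a]) e = case_nat a (env s e)"
  by (rule ext) (auto simp: env_def nth_append split: nat.split)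

lemma env_level: "x < length s \<Longrightarrow> env s e (length s - Suc x) = s ! x"
  by (auto simp: env_def)

lemma holds_mem [simp]:
  "x < length s \<Longrightarrow> y < length s \<Longrightarrow> holds e w s (x \<^bold>\<in> y) \<longleftrightarrow> M w (s ! x) (s ! y)"
  by (simp add: holds_def fmem_def env_level)

lemma holds_eq [simp]:
  "x < length s \<Longrightarrow> y < length s \<Longrightarrow> holds e w s (x \<^bold>= y) \<longleftrightarrow> E w (s ! x) (s ! y)"
  by (simp add: holds_def feq_def env_level)

lemma holds_and [simp]: "holds e w s (P \<^bold>\<and> Q) \<longleftrightarrow> holds e w s P \<and> holds e w s Q"
  by (simp add: holds_def fand_def)

lemma holds_or [simp]: "holds e w s (P \<^bold>\<or> Q) \<longleftrightarrow> holds e w s P \<or> holds e w s Q"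
  by (simp add: holds_def f_or_def)

lemma holds_imp [simp]:
  "holds e w s (P \<^bold>\<longrightarrow> Q) \<longleftrightarrow> (\<forall>\<^sub>F v in nhds w. holds e v s P \<longrightarrow> holds e v s Q)"
  by (simp add: holds_def fimp_def)

lemma holds_iff [simp]:
  "holds e w s (P \<^bold>\<longleftrightarrow> Q) \<longleftrightarrow> (\<forall>\<^sub>F v in nhds w. holds e v s P = holds e v s Q)"
  by (simp add: fiff_def eventually_nhds_iff)

lemma holds_not [simp]:
  "holds e w s (\<^bold>\<not> P) \<longleftrightarrow> (\<forall>\<^sub>F v in nhds w. \<not> holds e v s P)"
  by (simp add: holds_def fnot_def)

lemma holds_all [simp]:
  "holds e w s (fall F) \<longleftrightarrow> (\<forall>\<^sub>F v in nhds w. \<forall>a. holds e v (s @ [a]) (F (length s)))"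
  by (simp add: holds_def fall_def env_snoc)

lemma holds_ex [simp]:
  "holds e w s (fex F) \<longleftrightarrow> (\<exists>a. holds e w (s @ [a]) (F (length s)))"
  by (simp add: holds_def fex_def env_snoc)

lemma holds_app1 [simp]:
  "x < length s \<Longrightarrow> holds e w s (app1 p x) \<longleftrightarrow> sat M E w (case_nat (s ! x) e) p"
  unfolding holds_def app1_def sat_ren
  by (rule arg_cong[where f = "\<lambda>e. sat M E w e p"]) (auto simp: env_def fun_eq_iff split: nat.split)

declare eventually_all_nhds [simp] eventually_eventually [simp]

section \<open>Definable predicates\<close>

text \<open>Separation applies to formulas, so a predicate of the metalanguage must be certified as
  the truth of one formula in one environment, the same at all points.\<close>

definition definable :: "('w \<Rightarrow> nat \<Rightarrow> bool) \<Rightarrow> bool" where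
  "definable Q \<longleftrightarrow> (\<exists>p e. \<forall>w x. Q w x \<longleftrightarrow> sat M E w (case_nat x e) p)"

text \<open>In \<open>F\<close> the levels below \<open>length s\<close> are parameters with the
  values \<open>s\<close>, and the level \<open>length s\<close> is the argument.\<close>

lemma definableI: "(\<And>w x. Q w x \<longleftrightarrow> holds (\<lambda>_. 0) w (s @ [x]) F) \<Longrightarrow> definable Q"
  unfolding definable_def holds_def env_snoc length_append_singleton by blast

lemma definable_cong: "definable Q \<Longrightarrow> E w a b \<Longrightarrow> Q w a \<Longrightarrow> Q w b"
proof -
  assume "definable Q" "E w a b" "Q w a"
  moreover have "(case_nat a e)(0 := b) = case_nat b e" for e
    by (rule ext) (simp split: nat.split)
  ultimately show ?thesis
    unfolding definable_def using sat_update[of w "case_nat a _" 0 b] by fastforce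
qed

lemma open_definable: "definable Q \<Longrightarrow> open {w. Q w a}"
  unfolding definable_def using open_sat by auto

lemma definable_conj:
  assumes "definable Q" "definable R"
  shows "definable (\<lambda>w x. Q w x \<and> R w x)"
proof -
  obtain p e q d where p: "\<And>w x. Q w x \<longleftrightarrow> sat M E w (case_nat x e) p"
    and q: "\<And>w x. R w x \<longleftrightarrow> sat M E w (case_nat x d) q"
    using assms unfolding definable_def by blast
  \<comment> \<open>The two environments are interleaved: \<open>e\<close> occupies the even places
    and \<open>d\<close> the odd ones, and the free indices of both formulas are moved
    accordingly.\<close>
  let ?c = "\<lambda>k. if even k then e (k div 2) else d (k div 2)"
  have "(\<lambda>k. case_nat x ?c (case_nat 0 (\<lambda>k. Suc (2 * k)) k)) = case_nat x e"
    "(\<lambda>k. case_nat x ?c (case_nat 0 (\<lambda>k. Suc (Suc (2 * k))) k)) = case_nat x d" for x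
    by (auto simp: fun_eq_iff split: nat.split)
  then show ?thesis
    unfolding definable_def p q
    by (intro exI[of _ "And (ren (case_nat 0 (\<lambda>k. Suc (2 * k))) p)
      (ren (case_nat 0 (\<lambda>k. Suc (Suc (2 * k)))) q)"] exI[of _ ?c]) (simp add: sat_ren)
qed

section \<open>Semantic counterparts of the set-theoretic vocabulary\<close>

definition sub where "sub w x y \<longleftrightarrow> (\<forall>\<^sub>F v in nhds w. \<forall>z. M v z x \<longrightarrow> M v z y)"

definition empty where "empty w x \<longleftrightarrow> (\<forall>\<^sub>F v in nhds w. \<forall>z. \<not> M v z x)"

definition upair where "upair w p x y \<longleftrightarrow> (\<forall>\<^sub>F v in nhds w. \<forall>z. M v z p \<longleftrightarrow> E v z x \<or> E v z y)"

definition succ where "succ w y x \<longleftrightarrow> (\<forall>\<^sub>F v in nhds w. \<forall>z. M v z y \<longleftrightarrow> M v z x \<or> E v z x)"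

definition indset where
  "indset w i \<longleftrightarrow> (\<exists>z. M w z i \<and> empty w z) \<and>
    (\<forall>\<^sub>F v in nhds w. \<forall>x. M v x i \<longrightarrow> (\<exists>y. M v y i \<and> succ v y x))"

definition isnat where "isnat w n \<longleftrightarrow> (\<forall>\<^sub>F v in nhds w. \<forall>i. indset v i \<longrightarrow> M v n i)"

definition isone where "isone w x \<longleftrightarrow> (\<exists>z. empty w z \<and> succ w x z)"

definition isbit where "isbit w x \<longleftrightarrow> empty w x \<or> isone w x"

definition opair where
  "opair w p x y \<longleftrightarrow> (\<forall>\<^sub>F v in nhds w. \<forall>z. M v z p \<longleftrightarrow> upair v z x x \<or> upair v z x y)"

definition maps where "maps w f x y \<longleftrightarrow> (\<exists>p. M w p f \<and> opair w p x y)"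

definition func where
  "func w f A B \<longleftrightarrow>
    (\<forall>\<^sub>F v in nhds w. \<forall>p. M v p f \<longrightarrow> (\<exists>x y. A v x \<and> B v y \<and> opair v p x y)) \<and>
    (\<forall>\<^sub>F v in nhds w. \<forall>x. A v x \<longrightarrow> (\<exists>y. maps v f x y)) \<and>
    (\<forall>\<^sub>F v in nhds w. \<forall>x y z. maps v f x y \<and> maps v f x z \<longrightarrow> E v y z)"

definition seqn where "seqn B w s n \<longleftrightarrow> isnat w n \<and> func w s (\<lambda>v i. M v i n) B"

definition finseq where "finseq B w s \<longleftrightarrow> (\<exists>n. seqn B w s n)"

lemma holds_sub [simp]: "x < length s \<Longrightarrow> y < length s \<Longrightarrow>
    holds e w s (x \<^bold>\<subseteq> y) \<longleftrightarrow> sub w (s ! x) (s ! y)"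
  by (simp add: subset_fm_def sub_def nth_append)

lemma holds_prefix [simp]: "x < length s \<Longrightarrow> y < length s \<Longrightarrow>
    holds e w s (x \<^bold>\<preceq> y) \<longleftrightarrow> sub w (s ! x) (s ! y)"
  by (simp add: prefix_fm_def)

lemma holds_empty [simp]: "x < length s \<Longrightarrow> holds e w s (is_empty x) \<longleftrightarrow> empty w (s ! x)"
  by (simp add: is_empty_def empty_def nth_append)

lemma holds_upair [simp]: "p < length s \<Longrightarrow> x < length s \<Longrightarrow> y < length s \<Longrightarrow>
    holds e w s (is_upair p x y) \<longleftrightarrow> upair w (s ! p) (s ! x) (s ! y)"
  by (simp add: is_upair_def upair_def nth_append)

lemma holds_succ [simp]: "x < length s \<Longrightarrow> y < length s \<Longrightarrow>
    holds e w s (is_succ y x) \<longleftrightarrow> succ w (s ! y) (s ! x)"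
  by (simp add: is_succ_def succ_def nth_append)

lemma holds_inductive [simp]:
  "i < length s \<Longrightarrow> holds e w s (is_inductive i) \<longleftrightarrow> indset w (s ! i)"
  by (simp add: is_inductive_def indset_def nth_append)

lemma holds_nat [simp]: "n < length s \<Longrightarrow> holds e w s (is_nat n) \<longleftrightarrow> isnat w (s ! n)"
  by (simp add: is_nat_def isnat_def nth_append)

lemma holds_one [simp]: "x < length s \<Longrightarrow> holds e w s (is_one x) \<longleftrightarrow> isone w (s ! x)"
  by (simp add: is_one_def isone_def nth_append)

lemma holds_bit [simp]: "x < length s \<Longrightarrow> holds e w s (is_bit x) \<longleftrightarrow> isbit w (s ! x)"
  by (simp add: is_bit_def isbit_def nth_append)

lemma holds_opair [simp]: "p < length s \<Longrightarrow> x < length s \<Longrightarrow> y < length s \<Longrightarrow>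
    holds e w s (is_opair p x y) \<longleftrightarrow> opair w (s ! p) (s ! x) (s ! y)"
  by (simp add: is_opair_def opair_def nth_append)

lemma holds_maps [simp]: "f < length s \<Longrightarrow> x < length s \<Longrightarrow> y < length s \<Longrightarrow>
    holds e w s (maps_to f x y) \<longleftrightarrow> maps w (s ! f) (s ! x) (s ! y)"
  by (simp add: maps_to_def maps_def nth_append)

text \<open>The predicates are evaluated below the quantifiers inside \<open>is_function\<close>,
  hence the hypotheses about all longer value lists \<open>s @ t\<close>.\<close>

lemma holds_function:
  assumes "f < length s"
    and A: "\<And>v t x. x < length (s @ t) \<Longrightarrow> holds e v (s @ t) (A x) \<longleftrightarrow> A' v ((s @ t) ! x)"
    and B: "\<And>v t x. x < length (s @ t) \<Longrightarrow> holds e v (s @ t) (B x) \<longleftrightarrow> B' v ((s @ t) ! x)"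
  shows "holds e w s (is_function f A B) \<longleftrightarrow> func w (s ! f) A' B'"
  using assms(1)
  by (simp add: is_function_def func_def nth_append A[of _ "[_]", simplified]
      A[of _ "[_, _, _]", simplified] B[of _ "[_, _, _]", simplified])

lemmas [opens] =
  open_eventually_nhds[of "\<lambda>v. \<forall>z. M v z x \<longrightarrow> M v z y" for x y, folded sub_def]
  open_eventually_nhds[of "\<lambda>v. \<forall>z. \<not> M v z x" for x, folded empty_def]
  open_eventually_nhds[of "\<lambda>v. \<forall>z. M v z p \<longleftrightarrow> E v z x \<or> E v z y" for p x y, folded upair_def]
  open_eventually_nhds[of "\<lambda>v. \<forall>z. M v z y \<longleftrightarrow> M v z x \<or> E v z x" for x y, folded succ_def]
  open_eventually_nhds[of "\<lambda>v. \<forall>i. indset v i \<longrightarrow> M v n i" for n, folded isnat_def]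
  open_eventually_nhds[of "\<lambda>v. \<forall>z. M v z p \<longleftrightarrow> upair v z x x \<or> upair v z x y" for p x y,
    folded opair_def]

lemma open_preds [opens]:
  "open {w. indset w i}" "open {w. isone w x}" "open {w. isbit w x}" "open {w. maps w f x y}"
  "open {w. func w f A B}" "open {w. seqn B w s n}" "open {w. finseq B w s}"
  unfolding indset_def isone_def isbit_def maps_def func_def seqn_def finseq_def
  by (simp_all add: opens)

section \<open>The axioms\<close>

lemma holds_IZF: "P 0 \<in> IZF \<Longrightarrow> holds e w [] P"
  using sat_IZF by (simp add: holds_def)

lemma extensionality:
  assumes "\<forall>\<^sub>F v in nhds w. \<forall>z. M v z x \<longleftrightarrow> M v z y"
  shows "E w x y"
proof -
  have "holds (\<lambda>_. 0) w [] ax_extensionality" by (rule holds_IZF) (simp add: IZF_def)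
  then show ?thesis
    using assms by (simp add: ax_extensionality_def) (blast dest: boxD)
qed

lemma ex_upair: "\<exists>p. upair w p x y"
proof -
  have "holds (\<lambda>_. 0) w [] ax_pairing" by (rule holds_IZF) (simp add: IZF_def)
  then show ?thesis by (simp add: ax_pairing_def) (blast dest: boxD)
qed

lemma ex_union: "\<exists>u. \<forall>\<^sub>F v in nhds w. \<forall>x. M v x u \<longleftrightarrow> (\<exists>y. M v y a \<and> M v x y)"
proof -
  have "holds (\<lambda>_. 0) w [] ax_union" by (rule holds_IZF) (simp add: IZF_def)
  then show ?thesis by (simp add: ax_union_def) (blast dest: boxD)
qed

lemma ex_power: "\<exists>p. \<forall>\<^sub>F v in nhds w. \<forall>x. M v x p \<longleftrightarrow> sub v x a"
proof -
  have "holds (\<lambda>_. 0) w [] ax_powerset" by (rule holds_IZF) (simp add: IZF_def)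
  then show ?thesis by (simp add: ax_powerset_def) (blast dest: boxD)
qed

lemma ex_indset: "\<exists>i. indset w i"
proof -
  have "holds (\<lambda>_. 0) w [] ax_infinity" by (rule holds_IZF) (simp add: IZF_def)
  then show ?thesis by (simp add: ax_infinity_def)
qed

lemma separation:
  assumes "definable Q"
  shows "\<exists>b. \<forall>\<^sub>F v in nhds w. \<forall>x. M v x b \<longleftrightarrow> M v x a \<and> Q v x"
proof -
  obtain p e where p: "\<And>w x. Q w x \<longleftrightarrow> sat M E w (case_nat x e) p"
    using assms unfolding definable_def by blast
  have "holds e w [] (ax_separation p)" by (rule holds_IZF) (simp add: IZF_def)
  then show ?thesis by (simp add: ax_separation_def p) (blast dest: boxD)
qed

lemma subD: "sub w x y \<Longrightarrow> M w z x \<Longrightarrow> M w z y"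
  unfolding sub_def by (blast dest: boxD)

lemma emptyD: "empty w x \<Longrightarrow> \<not> M w z x"
  unfolding empty_def by (blast dest: boxD)

lemma upairD: "upair w p x y \<Longrightarrow> M w z p \<longleftrightarrow> E w z x \<or> E w z y"
  unfolding upair_def by (blast dest: boxD)

lemma succD: "succ w y x \<Longrightarrow> M w z y \<longleftrightarrow> M w z x \<or> E w z x"
  unfolding succ_def by (blast dest: boxD)

lemma indsetD: "indset w i \<Longrightarrow> M w x i \<Longrightarrow> \<exists>y. M w y i \<and> succ w y x"
  unfolding indset_def by (blast dest: boxD)

lemma isnatD: "isnat w n \<Longrightarrow> indset w i \<Longrightarrow> M w n i"
  unfolding isnat_def by (blast dest: boxD)

lemma opairD: "opair w p x y \<Longrightarrow> M w z p \<longleftrightarrow> upair w z x x \<or> upair w z x y"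
  unfolding opair_def by (blast dest: boxD)

lemma sub_refl: "sub w x x"
  unfolding sub_def by simp

lemma sub_trans: "sub w x y \<Longrightarrow> sub w y z \<Longrightarrow> sub w x z"
  unfolding sub_def by (erule (1) eventually_elim2, auto)

lemma E_sub: "E w x y \<Longrightarrow> sub w x y"
  unfolding sub_def by (rule boxI[where H = "\<lambda>v. E v x y"]) (auto simp: opens intro: M_congR)

lemma empty_unique: "empty w x \<Longrightarrow> empty w y \<Longrightarrow> E w x y"
  unfolding empty_def by (rule extensionality, erule (1) eventually_elim2, auto)

lemma upair_unique: "upair w p x y \<Longrightarrow> upair w q x y \<Longrightarrow> E w p q"
  unfolding upair_def by (rule extensionality, erule (1) eventually_elim2, auto)

lemma succ_unique: "succ w p x \<Longrightarrow> succ w q x \<Longrightarrow> E w p q"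
  unfolding succ_def by (rule extensionality, erule (1) eventually_elim2, auto)

lemma opair_unique: "opair w p x y \<Longrightarrow> opair w q x y \<Longrightarrow> E w p q"
  unfolding opair_def by (rule extensionality, erule (1) eventually_elim2, auto)

lemma empty_cong: "E w x x' \<Longrightarrow> empty w x \<Longrightarrow> empty w x'"
  by (rule definable_cong[of empty]) (rule definableI[where s = "[]" and F = "is_empty 0"], simp)

lemma isnat_cong: "E w x x' \<Longrightarrow> isnat w x \<Longrightarrow> isnat w x'"
  by (rule definable_cong[of isnat]) (rule definableI[where s = "[]" and F = "is_nat 0"], simp)

lemma isbit_cong: "E w x x' \<Longrightarrow> isbit w x \<Longrightarrow> isbit w x'"
  by (rule definable_cong[of isbit]) (rule definableI[where s = "[]" and F = "is_bit 0"], simp)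

lemma isone_cong: "E w x x' \<Longrightarrow> isone w x \<Longrightarrow> isone w x'"
  by (rule definable_cong[of isone]) (rule definableI[where s = "[]" and F = "is_one 0"], simp)

lemma succ_cong:
  assumes "E w y y'" "E w x x'" "succ w y x"
  shows "succ w y' x'"
proof -
  have d1: "definable (\<lambda>w y. succ w y x)" by (rule definableI[where s = "[x]" and F = "is_succ 1 0"]) simp
  have d2: "definable (\<lambda>w x. succ w y' x)" by (rule definableI[where s = "[y']" and F = "is_succ 0 1"]) simp
  show ?thesis by (rule definable_cong[OF d2 assms(2) definable_cong[OF d1 assms(1,3)]])
qed

lemma upair_cong:
  assumes "E w p p'" "E w x x'" "E w y y'" "upair w p x y"
  shows "upair w p' x' y'"
proof -
  have d1: "definable (\<lambda>w p. upair w p x y)"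
    by (rule definableI[where s = "[x, y]" and F = "is_upair 2 0 1"]) simp
  have d2: "definable (\<lambda>w x. upair w p' x y)"
    by (rule definableI[where s = "[p', y]" and F = "is_upair 0 2 1"]) simp
  have d3: "definable (\<lambda>w y. upair w p' x' y)"
    by (rule definableI[where s = "[p', x']" and F = "is_upair 0 1 2"]) simp
  show ?thesis by (rule definable_cong[OF d3 assms(3) definable_cong[OF d2 assms(2) definable_cong[OF d1 assms(1,4)]]])
qed

lemma opair_cong:
  assumes "E w p p'" "E w x x'" "E w y y'" "opair w p x y"
  shows "opair w p' x' y'"
proof -
  have d1: "definable (\<lambda>w p. opair w p x y)"
    by (rule definableI[where s = "[x, y]" and F = "is_opair 2 0 1"]) simp
  have d2: "definable (\<lambda>w x. opair w p' x y)"
    by (rule definableI[where s = "[p', y]" and F = "is_opair 0 2 1"]) simp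
  have d3: "definable (\<lambda>w y. opair w p' x' y)"
    by (rule definableI[where s = "[p', x']" and F = "is_opair 0 1 2"]) simp
  show ?thesis by (rule definable_cong[OF d3 assms(3) definable_cong[OF d2 assms(2) definable_cong[OF d1 assms(1,4)]]])
qed

lemma maps_cong:
  assumes "E w f f'" "E w x x'" "E w y y'" "maps w f x y"
  shows "maps w f' x' y'"
  using assms unfolding maps_def by (meson M_congR opair_cong E_refl)

section \<open>Natural numbers\<close>

lemma isnat_zero:
  assumes "empty w z"
  shows "isnat w z"
  unfolding isnat_def
proof (rule boxI[where H = "\<lambda>v. empty v z"])
  fix v
  assume "empty v z"
  then show "\<forall>i. indset v i \<longrightarrow> M v z i"
    unfolding indset_def using empty_unique M_congL by blast
qed (use assms in \<open>simp_all add: opens\<close>)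

lemma isnat_succ:
  assumes "isnat w x" "succ w y x"
  shows "isnat w y"
  unfolding isnat_def
proof (rule boxI[where H = "\<lambda>v. isnat v x \<and> succ v y x"])
  fix v
  assume v: "isnat v x \<and> succ v y x"
  show "\<forall>i. indset v i \<longrightarrow> M v y i"
  proof (intro allI impI)
    fix i
    assume i: "indset v i"
    then obtain y' where "M v y' i" "succ v y' x"
      using indsetD isnatD v by blast
    then show "M v y i" using succ_unique M_congL v by blast
  qed
qed (use assms in \<open>simp_all add: opens\<close>)

lemma definable_isnat: "definable isnat"
  by (rule definableI[where s = "[]" and F = "is_nat 0"]) simp

text \<open>Separation cuts out of an inductive set the numbers that satisfy \<open>Q\<close>. The
  result is again inductive, so it contains \<open>n\<close>. Closure under successor must hold near
  \<open>w\<close>, hence side assumptions enter through the open predicate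
  \<open>H\<close>.\<close>

lemma nat_induct:
  assumes n: "isnat w n" and definable: "definable Q" and H: "open {v. H v}" "H w"
    and zero: "\<And>v z. H v \<Longrightarrow> empty v z \<Longrightarrow> Q v z"
    and step: "\<And>v x y. H v \<Longrightarrow> isnat v x \<Longrightarrow> Q v x \<Longrightarrow> succ v y x \<Longrightarrow> Q v y"
  shows "Q w n"
proof -
  obtain i where i: "indset w i" using ex_indset by blast
  obtain b where b: "\<forall>\<^sub>F v in nhds w. \<forall>x. M v x b \<longleftrightarrow> M v x i \<and> isnat v x \<and> Q v x"
    using separation[OF definable_conj[OF definable_isnat definable]] by blast
  define K where "K v \<longleftrightarrow> H v \<and> indset v i \<and>
    (\<forall>\<^sub>F u in nhds v. \<forall>x. M u x b \<longleftrightarrow> M u x i \<and> isnat u x \<and> Q u x)" for v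
  have K: "open {v. K v}" "K w" unfolding K_def using H i b by (simp_all add: opens)
  have Kb: "M v x b \<longleftrightarrow> M v x i \<and> isnat v x \<and> Q v x" if "K v" for v x
    using that boxD unfolding K_def by blast
  have "indset w b"
    unfolding indset_def
  proof
    obtain z where "M w z i" "empty w z" using i unfolding indset_def by blast
    then show "\<exists>z. M w z b \<and> empty w z"
      using Kb[OF K(2)] isnat_zero zero[OF H(2)] by blast
    show "\<forall>\<^sub>F v in nhds w. \<forall>x. M v x b \<longrightarrow> (\<exists>y. M v y b \<and> succ v y x)"
    proof (rule boxI[OF K], intro allI impI)
      fix v x
      assume v: "K v" and x: "M v x b"
      then obtain y where "M v y i" "succ v y x"
        using indsetD Kb unfolding K_def by blast
      moreover from this have "isnat v y" "Q v y"
        using Kb[OF v] x isnat_succ step v unfolding K_def by blast+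
      ultimately show "\<exists>y. M v y b \<and> succ v y x" using Kb[OF v] by blast
    qed
  qed
  then show ?thesis using n isnatD Kb[OF K(2)] by blast
qed

lemma ex_omega: "\<exists>a. \<forall>\<^sub>F v in nhds w. \<forall>x. M v x a \<longleftrightarrow> isnat v x"
proof -
  obtain i where i: "indset w i" using ex_indset by blast
  obtain b where b: "\<forall>\<^sub>F v in nhds w. \<forall>x. M v x b \<longleftrightarrow> M v x i \<and> isnat v x"
    using separation[OF definable_isnat] by blast
  have "\<forall>\<^sub>F v in nhds w. indset v i"
    by (rule boxI[where H = "\<lambda>v. indset v i"]) (use i in \<open>simp_all add: opens\<close>)
  with b have "\<forall>\<^sub>F v in nhds w. \<forall>x. M v x b \<longleftrightarrow> isnat v x"
    by (rule eventually_elim2) (use isnatD in blast)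
  then show ?thesis ..
qed

lemma ex_empty: "\<exists>z. empty w z"
  using ex_indset unfolding indset_def by blast

lemma ex_succ:
  assumes "isnat w x"
  shows "\<exists>y. succ w y x"
  using ex_indset[of w] assms isnatD indsetD by blast

lemma isnat_mem:
  assumes "isnat w n" "M w m n"
  shows "isnat w m"
proof -
  have "\<forall>\<^sub>F v in nhds w. \<forall>m. M v m n \<longrightarrow> isnat v m"
    using assms(1)
  proof (rule nat_induct[where H = "\<lambda>_. True"])
    show "definable (\<lambda>w n. \<forall>\<^sub>F v in nhds w. \<forall>m. M v m n \<longrightarrow> isnat v m)"
      by (rule definableI[where s = "[]" and F = "\<^bold>\<forall>m. m \<^bold>\<in> 0 \<^bold>\<longrightarrow> is_nat m"]) simp
  next
    fix v z
    assume "empty v z"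
    then show "\<forall>\<^sub>F u in nhds v. \<forall>m. M u m z \<longrightarrow> isnat u m"
      unfolding empty_def by (rule eventually_mono) blast
  next
    fix v x y
    assume *: "isnat v x" "\<forall>\<^sub>F u in nhds v. \<forall>m. M u m x \<longrightarrow> isnat u m" "succ v y x"
    show "\<forall>\<^sub>F u in nhds v. \<forall>m. M u m y \<longrightarrow> isnat u m"
    proof (rule boxI[where H = "\<lambda>v. isnat v x \<and> succ v y x \<and>
        (\<forall>\<^sub>F u in nhds v. \<forall>m. M u m x \<longrightarrow> isnat u m)"])
      fix u
      assume u: "isnat u x \<and> succ u y x \<and> (\<forall>\<^sub>F u in nhds u. \<forall>m. M u m x \<longrightarrow> isnat u m)"
      then have "\<forall>m. M u m x \<longrightarrow> isnat u m" by (blast dest: boxD)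
      then show "\<forall>m. M u m y \<longrightarrow> isnat u m"
        using u succD isnat_cong E_sym by blast
    qed (use * in \<open>simp_all add: opens\<close>)
  qed (simp_all add: opens)
  then show ?thesis using assms(2) by (blast dest: boxD)
qed

lemma nat_mem_trans:
  assumes "isnat w n" "M w m n" "M w k m"
  shows "M w k n"
proof -
  have "\<forall>\<^sub>F v in nhds w. \<forall>m. M v m n \<longrightarrow> sub v m n"
    using assms(1)
  proof (rule nat_induct[where H = "\<lambda>_. True"])
    show "definable (\<lambda>w n. \<forall>\<^sub>F v in nhds w. \<forall>m. M v m n \<longrightarrow> sub v m n)"
      by (rule definableI[where s = "[]" and F = "\<^bold>\<forall>m. m \<^bold>\<in> 0 \<^bold>\<longrightarrow> m \<^bold>\<subseteq> 0"]) simp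
  next
    fix v z
    assume "empty v z"
    then show "\<forall>\<^sub>F u in nhds v. \<forall>m. M u m z \<longrightarrow> sub u m z"
      unfolding empty_def by (rule eventually_mono) blast
  next
    fix v x y
    assume *: "\<forall>\<^sub>F u in nhds v. \<forall>m. M u m x \<longrightarrow> sub u m x" "succ v y x"
    show "\<forall>\<^sub>F u in nhds v. \<forall>m. M u m y \<longrightarrow> sub u m y"
    proof (rule boxI[where H = "\<lambda>v. succ v y x \<and> (\<forall>\<^sub>F u in nhds v. \<forall>m. M u m x \<longrightarrow> sub u m x)"])
      fix u
      assume u: "succ u y x \<and> (\<forall>\<^sub>F u in nhds u. \<forall>m. M u m x \<longrightarrow> sub u m x)"
      then have "sub u x y"
        unfolding sub_def succ_def by (auto elim: eventually_mono)
      moreover have "\<forall>m. M u m x \<longrightarrow> sub u m x" using u by (blast dest: boxD)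
      ultimately show "\<forall>m. M u m y \<longrightarrow> sub u m y"
        using u succD sub_trans E_sub by blast
    qed (use * in \<open>simp_all add: opens\<close>)
  qed (simp_all add: opens)
  then show ?thesis using assms subD by (blast dest: boxD)
qed

text \<open>If the successor \<open>y\<close> of \<open>x\<close> lies in itself, then
  \<open>y\<close> lies in \<open>x\<close> or equals it; as \<open>x\<close> lies in
  \<open>y\<close>, either case puts \<open>x\<close> into itself, by transitivity or by
  congruence.\<close>

lemma nat_mem_irrefl:
  assumes "isnat w n"
  shows "\<not> M w n n"
proof -
  have "\<forall>\<^sub>F v in nhds w. \<not> M v n n"
    using assms
  proof (rule nat_induct[where H = "\<lambda>_. True"])
    show "definable (\<lambda>w n. \<forall>\<^sub>F v in nhds w. \<not> M v n n)"
      by (rule definableI[where s = "[]" and F = "\<^bold>\<not> 0 \<^bold>\<in> 0"]) simp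
  next
    fix v z
    assume "empty v z"
    then show "\<forall>\<^sub>F u in nhds v. \<not> M u z z"
      unfolding empty_def by (rule eventually_mono) blast
  next
    fix v x y
    assume *: "isnat v x" "\<forall>\<^sub>F u in nhds v. \<not> M u x x" "succ v y x"
    show "\<forall>\<^sub>F u in nhds v. \<not> M u y y"
    proof (rule boxI[where H = "\<lambda>v. isnat v x \<and> succ v y x \<and> (\<forall>\<^sub>F u in nhds v. \<not> M u x x)"])
      fix u
      assume u: "isnat u x \<and> succ u y x \<and> (\<forall>\<^sub>F u in nhds u. \<not> M u x x)"
      then have nx: "\<not> M u x x" by (blast dest: boxD)
      show "\<not> M u y y"
      proof
        assume "M u y y"
        then consider "M u y x" | "E u y x" using u succD by blast
        then show False
        proof cases
          case 1
          then show ?thesis using nx u succD E_refl nat_mem_trans by blast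
        next
          case 2
          then show ?thesis using nx \<open>M u y y\<close> M_cong by blast
        qed
      qed
    qed (use * in \<open>simp_all add: opens\<close>)
  qed (simp_all add: opens)
  then show ?thesis by (rule boxD)
qed

text \<open>Decides whether a number is zero. The second alternative later provides the first entry
  of a nonempty sequence.\<close>

lemma nat_zero_cases:
  assumes "isnat w n"
  shows "empty w n \<or> (\<exists>z. empty w z \<and> M w z n)"
  using assms
proof (rule nat_induct[where H = "\<lambda>_. True"])
  show "definable (\<lambda>w n. empty w n \<or> (\<exists>z. empty w z \<and> M w z n))"
    by (rule definableI[where s = "[]" and F = "is_empty 0 \<^bold>\<or> (\<^bold>\<exists>z. is_empty z \<^bold>\<and> z \<^bold>\<in> 0)"]) simp
next
  fix v x y
  assume "empty v x \<or> (\<exists>z. empty v z \<and> M v z x)" "succ v y x"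
  then show "empty v y \<or> (\<exists>z. empty v z \<and> M v z y)"
    using succD E_refl by blast
qed (simp_all add: opens)

lemma nat_succ_le:
  assumes "isnat w m" "M w n m" "succ w y n"
  shows "M w y m \<or> E w y m"
proof -
  have "\<forall>\<^sub>F v in nhds w. \<forall>n y. M v n m \<and> succ v y n \<longrightarrow> M v y m \<or> E v y m"
    using assms(1)
  proof (rule nat_induct[where H = "\<lambda>_. True"])
    show "definable (\<lambda>w m. \<forall>\<^sub>F v in nhds w. \<forall>n y. M v n m \<and> succ v y n \<longrightarrow> M v y m \<or> E v y m)"
      by (rule definableI[where s = "[]" and
          F = "\<^bold>\<forall>n. \<^bold>\<forall>y. n \<^bold>\<in> 0 \<^bold>\<and> is_succ y n \<^bold>\<longrightarrow> y \<^bold>\<in> 0 \<^bold>\<or> y \<^bold>= 0"]) simp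
  next
    fix v z
    assume "empty v z"
    then show "\<forall>\<^sub>F u in nhds v. \<forall>n y. M u n z \<and> succ u y n \<longrightarrow> M u y z \<or> E u y z"
      unfolding empty_def by (rule eventually_mono) blast
  next
    fix v k m
    assume *: "\<forall>\<^sub>F u in nhds v. \<forall>n y. M u n k \<and> succ u y n \<longrightarrow> M u y k \<or> E u y k" "succ v m k"
    show "\<forall>\<^sub>F u in nhds v. \<forall>n y. M u n m \<and> succ u y n \<longrightarrow> M u y m \<or> E u y m"
    proof (rule boxI[where H = "\<lambda>v. succ v m k \<and>
        (\<forall>\<^sub>F u in nhds v. \<forall>n y. M u n k \<and> succ u y n \<longrightarrow> M u y k \<or> E u y k)"])
      fix u
      assume u: "succ u m k \<and>
          (\<forall>\<^sub>F u in nhds u. \<forall>n y. M u n k \<and> succ u y n \<longrightarrow> M u y k \<or> E u y k)"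
      show "\<forall>n y. M u n m \<and> succ u y n \<longrightarrow> M u y m \<or> E u y m"
      proof (intro allI impI)
        fix n y
        assume ny: "M u n m \<and> succ u y n"
        from u ny consider "M u n k" | "E u n k" using succD by blast
        then show "M u y m \<or> E u y m"
        proof cases
          case 1
          then have "M u y k \<or> E u y k" using u ny by (blast dest: boxD)
          then show ?thesis using u succD by blast
        next
          case 2
          then show ?thesis using u ny succ_cong succ_unique E_refl by blast
        qed
      qed
    qed (use * in \<open>simp_all add: opens\<close>)
  qed (simp_all add: opens)
  then show ?thesis using assms by (blast dest: boxD)
qed

text \<open>By induction on \<open>n\<close>, where \<open>nat_succ_le\<close> treats the case of
  \<open>n\<close> below \<open>m\<close>. This is the source of all decisions about lengths of
  sequences.\<close>

lemma nat_trichotomy: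
  assumes "isnat w m" "isnat w n"
  shows "M w m n \<or> E w m n \<or> M w n m"
  using assms(2)
proof (rule nat_induct[where H = "\<lambda>v. isnat v m"])
  show "definable (\<lambda>w n. M w m n \<or> E w m n \<or> M w n m)"
    by (rule definableI[where s = "[m]" and F = "0 \<^bold>\<in> 1 \<^bold>\<or> 0 \<^bold>= 1 \<^bold>\<or> 1 \<^bold>\<in> 0"]) simp
next
  fix v z
  assume "isnat v m" "empty v z"
  then show "M v m z \<or> E v m z \<or> M v z m"
    using nat_zero_cases empty_unique M_congL by blast
next
  fix v n y
  assume "isnat v m" "M v m n \<or> E v m n \<or> M v n m" "succ v y n"
  then show "M v m y \<or> E v m y \<or> M v y m"
    using nat_succ_le succD E_sym by blast
qed (use assms in \<open>simp_all add: opens\<close>)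

lemma isbit_isnat: "isbit w b \<Longrightarrow> isnat w b"
  unfolding isbit_def isone_def using isnat_zero isnat_succ by blast

section \<open>Ordered pairs\<close>

lemma ex_opair: "\<exists>p. opair w p x y"
proof -
  obtain a where a: "upair w a x x" using ex_upair by blast
  obtain b where b: "upair w b x y" using ex_upair by blast
  obtain p where p: "upair w p a b" using ex_upair by blast
  have "opair w p x y"
    unfolding opair_def
  proof (rule boxI[where H = "\<lambda>v. upair v a x x \<and> upair v b x y \<and> upair v p a b"])
    fix v
    assume v: "upair v a x x \<and> upair v b x y \<and> upair v p a b"
    have "M v z p \<longleftrightarrow> E v z a \<or> E v z b" for z using v upairD by blast
    moreover have "E v z a \<longleftrightarrow> upair v z x x" for z
      using v upair_unique upair_cong E_refl E_sym by blast
    moreover have "E v z b \<longleftrightarrow> upair v z x y" for z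
      using v upair_unique upair_cong E_refl E_sym by blast
    ultimately show "\<forall>z. M v z p \<longleftrightarrow> upair v z x x \<or> upair v z x y" by blast
  qed (use a b p in \<open>simp_all add: opens\<close>)
  then show ?thesis ..
qed

text \<open>Only members are compared, and it is never decided whether \<open>x\<close> equals
  \<open>y\<close>. Since \<open>{x}\<close> is \<open>{x'}\<close> or \<open>{x', y'}\<close>, it
  has \<open>x'\<close> as a member. Likewise \<open>y\<close> is \<open>x'\<close> or
  \<open>y'\<close>, and \<open>y'\<close> is \<open>x\<close> or \<open>y\<close>; the combination
  of \<open>x'\<close> with \<open>x\<close> is closed by \<open>x = x'\<close>.\<close>

lemma opair_inject:
  assumes p: "opair w p x y" and q: "opair w p x' y'"
  shows "E w x x' \<and> E w y y'"
proof
  obtain a where a: "upair w a x x" using ex_upair by blast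
  then have "upair w a x' x' \<or> upair w a x' y'" using p q opairD by blast
  then have "M w x' a" using upairD E_refl by blast
  then show xx': "E w x x'" using a upairD E_sym by blast
  obtain b where b: "upair w b x y" using ex_upair by blast
  then have "upair w b x' x' \<or> upair w b x' y'" using p q opairD by blast
  moreover have "M w y b" using b upairD E_refl by blast
  ultimately have y: "E w y x' \<or> E w y y'" using upairD by blast
  obtain c where c: "upair w c x' y'" using ex_upair by blast
  then have "upair w c x x \<or> upair w c x y" using p q opairD by blast
  moreover have "M w y' c" using c upairD E_refl by blast
  ultimately have "E w y' x \<or> E w y' y" using upairD by blast
  then show "E w y y'" using y xx' E_sym E_trans by blast
qed

section \<open>Functions\<close>

text \<open>Separation needs a bound, and Kuratowski pairs of numbers lie in the double power set of
  the set of numbers.\<close>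

lemma ex_pairs:
  "\<exists>P. \<forall>\<^sub>F v in nhds w. \<forall>p x y. isnat v x \<and> isnat v y \<and> opair v p x y \<longrightarrow> M v p P"
proof -
  obtain N where N: "\<forall>\<^sub>F v in nhds w. \<forall>x. M v x N \<longleftrightarrow> isnat v x" using ex_omega by blast
  obtain P1 where P1: "\<forall>\<^sub>F v in nhds w. \<forall>x. M v x P1 \<longleftrightarrow> sub v x N" using ex_power by blast
  obtain P2 where P2: "\<forall>\<^sub>F v in nhds w. \<forall>x. M v x P2 \<longleftrightarrow> sub v x P1" using ex_power by blast
  define K where "K v \<longleftrightarrow> (\<forall>\<^sub>F u in nhds v. \<forall>x. M u x N \<longleftrightarrow> isnat u x) \<and>
    (\<forall>\<^sub>F u in nhds v. \<forall>x. M u x P1 \<longleftrightarrow> sub u x N) \<and>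
    (\<forall>\<^sub>F u in nhds v. \<forall>x. M u x P2 \<longleftrightarrow> sub u x P1)" for v
  have K: "open {v. K v}" "K w" unfolding K_def using N P1 P2 by (simp_all add: opens)
  have KD: "M v x N \<longleftrightarrow> isnat v x" "M v x P1 \<longleftrightarrow> sub v x N" "M v x P2 \<longleftrightarrow> sub v x P1"
    if "K v" for v x
    using that unfolding K_def by (blast dest: boxD)+
  have up: "sub v z N" if "K v" "isnat v x" "isnat v y" "upair v z x y" for v x y z
    unfolding sub_def
  proof (rule boxI[where H = "\<lambda>u. K u \<and> isnat u x \<and> isnat u y \<and> upair u z x y"])
    fix u
    assume "K u \<and> isnat u x \<and> isnat u y \<and> upair u z x y"
    then show "\<forall>a. M u a z \<longrightarrow> M u a N"
      using KD(1) upairD isnat_cong E_sym by blast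
  qed (use that K in \<open>simp_all add: opens\<close>)
  have "sub v p P1" if "K v" "isnat v x" "isnat v y" "opair v p x y" for v x y p
    unfolding sub_def
  proof (rule boxI[where H = "\<lambda>u. K u \<and> isnat u x \<and> isnat u y \<and> opair u p x y"])
    fix u
    assume "K u \<and> isnat u x \<and> isnat u y \<and> opair u p x y"
    then show "\<forall>a. M u a p \<longrightarrow> M u a P1"
      using KD(2) opairD up by blast
  qed (use that K in \<open>simp_all add: opens\<close>)
  then have "\<forall>\<^sub>F v in nhds w. \<forall>p x y. isnat v x \<and> isnat v y \<and> opair v p x y \<longrightarrow> M v p P2"
    using KD(3) by (intro boxI[OF K]) blast
  then show ?thesis ..
qed

text \<open>The graph is separated from the set of \<open>ex_pairs\<close>, which is why
  \<open>sort\<close> asks that arguments and values be numbers.\<close>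

lemma ex_function:
  assumes definable: "definable (\<lambda>w p. \<exists>x y. R w x y \<and> opair w p x y)"
    and cong: "\<And>v x y x' y'. R v x y \<Longrightarrow> E v x x' \<Longrightarrow> E v y y' \<Longrightarrow> R v x' y'"
    and H: "open {v. H v}" "H w"
    and sort: "\<And>v x y. H v \<Longrightarrow> R v x y \<Longrightarrow> A v x \<and> B v y \<and> isnat v x \<and> isnat v y"
    and total: "\<And>v x. H v \<Longrightarrow> A v x \<Longrightarrow> \<exists>y. R v x y"
    and single: "\<And>v x y z. H v \<Longrightarrow> R v x y \<Longrightarrow> R v x z \<Longrightarrow> E v y z"
  shows "\<exists>f. func w f A B \<and> (\<forall>\<^sub>F v in nhds w. \<forall>x y. maps v f x y \<longleftrightarrow> R v x y)"
proof -
  obtain P where P: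
    "\<forall>\<^sub>F v in nhds w. \<forall>p x y. isnat v x \<and> isnat v y \<and> opair v p x y \<longrightarrow> M v p P"
    using ex_pairs by blast
  obtain f where f: "\<forall>\<^sub>F v in nhds w. \<forall>p. M v p f \<longleftrightarrow> M v p P \<and> (\<exists>x y. R v x y \<and> opair v p x y)"
    using separation[OF definable] by blast
  define K where "K v \<longleftrightarrow> H v \<and>
    (\<forall>\<^sub>F u in nhds v. \<forall>p x y. isnat u x \<and> isnat u y \<and> opair u p x y \<longrightarrow> M u p P) \<and>
    (\<forall>\<^sub>F u in nhds v. \<forall>p. M u p f \<longleftrightarrow> M u p P \<and> (\<exists>x y. R u x y \<and> opair u p x y))" for v
  have K: "open {v. K v}" "K w" unfolding K_def using H P f by (simp_all add: opens)
  have KH: "H v" if "K v" for v using that unfolding K_def by blast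
  have KP: "M v p P" if "K v" "isnat v x" "isnat v y" "opair v p x y" for v p x y
    using that unfolding K_def by (blast dest: boxD)
  have Kf: "M v p f \<longleftrightarrow> M v p P \<and> (\<exists>x y. R v x y \<and> opair v p x y)" if "K v" for v p
    using that unfolding K_def by (blast dest: boxD)
  have mapsf: "maps v f x y \<longleftrightarrow> R v x y" if v: "K v" for v x y
  proof
    assume "maps v f x y"
    then obtain p x' y' where "opair v p x y" "R v x' y'" "opair v p x' y'"
      using Kf[OF v] unfolding maps_def by blast
    then show "R v x y" using opair_inject cong by blast
  next
    assume R: "R v x y"
    obtain p where "opair v p x y" using ex_opair by blast
    then show "maps v f x y"
      using Kf[OF v] KP[OF v] sort[OF KH[OF v] R] R unfolding maps_def by blast
  qed
  have "\<forall>\<^sub>F v in nhds w. \<forall>p. M v p f \<longrightarrow> (\<exists>x y. A v x \<and> B v y \<and> opair v p x y)"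
    using Kf sort KH by (intro boxI[OF K]) blast
  moreover have "\<forall>\<^sub>F v in nhds w. \<forall>x. A v x \<longrightarrow> (\<exists>y. maps v f x y)"
    using mapsf total KH by (intro boxI[OF K]) blast
  moreover have "\<forall>\<^sub>F v in nhds w. \<forall>x y z. maps v f x y \<and> maps v f x z \<longrightarrow> E v y z"
    using mapsf single KH by (intro boxI[OF K]) blast
  moreover have "\<forall>\<^sub>F v in nhds w. \<forall>x y. maps v f x y \<longleftrightarrow> R v x y"
    using mapsf by (intro boxI[OF K]) blast
  ultimately show ?thesis unfolding func_def by blast
qed

lemma func_total: "func w f A B \<Longrightarrow> A w x \<Longrightarrow> \<exists>y. maps w f x y"
  unfolding func_def by (blast dest: boxD)

lemma func_single: "func w f A B \<Longrightarrow> maps w f x y \<Longrightarrow> maps w f x z \<Longrightarrow> E w y z"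
  unfolding func_def by (blast dest: boxD)

text \<open>The graph only yields components of the same pair that agree with \<open>x\<close> and
  \<open>y\<close> up to \<open>E\<close>; hence \<open>A\<close> and \<open>B\<close> have to
  respect \<open>E\<close>.\<close>

lemma func_sort:
  assumes "func w f A B" and "maps w f x y"
    and A: "\<And>x x'. E w x x' \<Longrightarrow> A w x \<Longrightarrow> A w x'"
    and B: "\<And>x x'. E w x x' \<Longrightarrow> B w x \<Longrightarrow> B w x'"
  shows "A w x \<and> B w y"
proof -
  obtain p where p: "M w p f" "opair w p x y" using assms(2) unfolding maps_def by blast
  then obtain x' y' where "A w x'" "B w y'" "opair w p x' y'"
    using assms(1) unfolding func_def by (blast dest: boxD)
  then show ?thesis using opair_inject[OF p(2)] A B E_sym by blast
qed

lemma sub_maps: "sub w s t \<Longrightarrow> maps w s x y \<Longrightarrow> maps w t x y"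
  unfolding maps_def using subD by blast

end

section \<open>Finite sequences\<close>

text \<open>The two domains differ only in the alphabet, a formula \<open>A\<close> with truth
  \<open>B\<close>. Letters are numbers, so that \<open>ex_function\<close> constructs sequences,
  and an inhabited alphabet allows every sequence to be prolonged.\<close>

locale seq_domain = izf_model M E
  for M E :: "'w::topological_space \<Rightarrow> nat \<Rightarrow> nat \<Rightarrow> bool" +
  fixes A :: carrier and B :: "'w \<Rightarrow> nat \<Rightarrow> bool"
  assumes holds_A: "x < length s \<Longrightarrow> holds e w s (A x) \<longleftrightarrow> B w (s ! x)"
    and B_isnat: "B w b \<Longrightarrow> isnat w b"
    and ex_B: "\<exists>b. B w b"
begin

lemma definable_B: "definable B"
  by (rule definableI[where s = "[]" and F = "A 0"]) (simp add: holds_A)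

lemma B_cong: "E w x y \<Longrightarrow> B w x \<Longrightarrow> B w y"
  by (rule definable_cong[OF definable_B])

lemma open_B [opens]: "open {w. B w x}"
  by (rule open_definable[OF definable_B])

lemma holds_seq [simp]:
  assumes "x < length s" "n < length s"
  shows "holds e w s (is_function x (\<lambda>i. i \<^bold>\<in> n) A) \<longleftrightarrow> func w (s ! x) (\<lambda>v i. M v i (s ! n)) B"
  by (rule holds_function) (use assms in \<open>simp_all add: nth_append holds_A\<close>)

lemma holds_finseq [simp]: "x < length s \<Longrightarrow> holds e w s (is_finseq A x) \<longleftrightarrow> finseq B w (s ! x)"
  by (simp add: is_finseq_def finseq_def seqn_def nth_append)

abbreviation sq where "sq \<equiv> seqn B"
abbreviation fs where "fs \<equiv> finseq B"

lemma fsI: "sq w s n \<Longrightarrow> fs w s"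
  unfolding finseq_def by blast

lemma sq_isnat: "sq w s n \<Longrightarrow> isnat w n"
  unfolding seqn_def by blast

lemma sq_sort: "sq w s n \<Longrightarrow> maps w s x y \<Longrightarrow> M w x n \<and> B w y"
  unfolding seqn_def using func_sort[of w s "\<lambda>v i. M v i n" B] M_congL B_cong by blast

lemma sq_total: "sq w s n \<Longrightarrow> M w x n \<Longrightarrow> \<exists>y. maps w s x y"
  unfolding seqn_def using func_total[of w s "\<lambda>v i. M v i n" B] by blast

lemma sq_single: "sq w s n \<Longrightarrow> maps w s x y \<Longrightarrow> maps w s x z \<Longrightarrow> E w y z"
  unfolding seqn_def by (blast dest: func_single)

lemma fs_single: "fs w s \<Longrightarrow> maps w s x y \<Longrightarrow> maps w s x z \<Longrightarrow> E w y z"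
  unfolding finseq_def by (blast dest: sq_single)

text \<open>Inclusion of graphs can be checked on values: an element of \<open>s\<close> is a pair,
  and pairs with equal components are equal.\<close>

lemma fs_subI:
  assumes s: "fs w s" and H: "open {v. H v}" "H w"
    and maps: "\<And>v x y. H v \<Longrightarrow> fs v s \<Longrightarrow> maps v s x y \<Longrightarrow> maps v t x y"
  shows "sub w s t"
  unfolding sub_def
proof (rule boxI[where H = "\<lambda>v. H v \<and> fs v s"])
  fix v
  assume v: "H v \<and> fs v s"
  show "\<forall>p. M v p s \<longrightarrow> M v p t"
  proof (intro allI impI)
    fix p
    assume p: "M v p s"
    then obtain x y where xy: "opair v p x y"
      using v unfolding finseq_def seqn_def func_def by (blast dest: boxD)
    then have "maps v t x y" using maps p v unfolding maps_def by blast
    then obtain q where "M v q t" "opair v q x y" unfolding maps_def by blast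
    then show "M v p t" using xy opair_unique M_congL by blast
  qed
qed (use s H in \<open>simp_all add: opens\<close>)

text \<open>Both sequences take the values of their common extension \<open>r\<close>, and every
  argument of \<open>s\<close> is one of \<open>t\<close>, by transitivity of membership on
  numbers.\<close>

lemma sq_sub_if_shorter:
  assumes "sq w s n" "sq w t m" "fs w r" "sub w s r" "sub w t r" "M w n m \<or> E w n m"
  shows "sub w s t"
proof (rule fs_subI[where H = "\<lambda>v. sq v s n \<and> sq v t m \<and> fs v r \<and> sub v s r \<and> sub v t r \<and>
    (M v n m \<or> E v n m)"])
  show "fs w s" using assms fsI by blast
  fix v x y
  assume v: "sq v s n \<and> sq v t m \<and> fs v r \<and> sub v s r \<and> sub v t r \<and> (M v n m \<or> E v n m)"
    and xy: "maps v s x y"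
  have "M v x n" using v xy sq_sort by blast
  then have "M v x m" using v M_congR nat_mem_trans sq_isnat by blast
  then obtain z where z: "maps v t x z" using v sq_total by blast
  then have "E v z y" using v xy sub_maps fs_single by blast
  then show "maps v t x y" using z maps_cong E_refl by blast
qed (use assms in \<open>simp_all add: opens\<close>)

lemma fs_comparable:
  assumes "fs w s" "fs w t" "fs w r" "sub w s r" "sub w t r"
  shows "sub w s t \<or> sub w t s"
proof -
  obtain n m where nm: "sq w s n" "sq w t m" using assms unfolding finseq_def by blast
  then have "M w n m \<or> E w n m \<or> M w m n" using nat_trichotomy sq_isnat by blast
  then show ?thesis using sq_sub_if_shorter nm assms E_sym by blast
qed

lemma ex_append:
  assumes "sq w s n" "B w b" "succ w m n"
  shows "\<exists>t. sq w t m \<and> sub w s t \<and>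
    (\<forall>\<^sub>F v in nhds w. \<forall>x y. maps v t x y \<longleftrightarrow> maps v s x y \<or> E v x n \<and> E v y b)"
proof -
  let ?H = "\<lambda>v. sq v s n \<and> B v b \<and> succ v m n"
  have H: "open {v. ?H v}" "?H w" using assms by (simp_all add: opens)
  have "\<exists>t. func w t (\<lambda>v i. M v i m) B \<and>
    (\<forall>\<^sub>F v in nhds w. \<forall>x y. maps v t x y \<longleftrightarrow> maps v s x y \<or> E v x n \<and> E v y b)"
  proof (rule ex_function[OF _ _ H])
    show "definable (\<lambda>w p. \<exists>x y. (maps w s x y \<or> E w x n \<and> E w y b) \<and> opair w p x y)"
      by (rule definableI[where s = "[s, n, b]" and
          F = "\<^bold>\<exists>x. \<^bold>\<exists>y. (maps_to 0 x y \<^bold>\<or> x \<^bold>= 1 \<^bold>\<and> y \<^bold>= 2) \<^bold>\<and> is_opair 3 x y"]) simp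
  next
    fix v x y x' y'
    assume "maps v s x y \<or> E v x n \<and> E v y b" "E v x x'" "E v y y'"
    then show "maps v s x' y' \<or> E v x' n \<and> E v y' b"
      using maps_cong[of v s s x x' y y'] E_refl by (meson E_sym E_trans)
  next
    fix v x y
    assume v: "?H v" and "maps v s x y \<or> E v x n \<and> E v y b"
    then have "M v x m \<and> B v y"
      using sq_sort succD B_cong E_sym by blast
    then show "M v x m \<and> B v y \<and> isnat v x \<and> isnat v y"
      using v sq_isnat isnat_succ isnat_mem B_isnat by blast
  next
    fix v x
    assume "?H v" "M v x m"
    then show "\<exists>y. maps v s x y \<or> E v x n \<and> E v y b"
      using sq_total succD E_refl by blast
  next
    fix v x y z
    assume v: "?H v" "maps v s x y \<or> E v x n \<and> E v y b" "maps v s x z \<or> E v x n \<and> E v z b"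
    \<comment> \<open>The new argument \<open>n\<close> is not among the old ones, so adding its
      pair keeps the graph single-valued.\<close>
    have "\<not> M v n n" using v nat_mem_irrefl sq_isnat by blast
    then have "\<not> (maps v s x u \<and> E v x n)" for u
      using v sq_sort M_congL by blast
    then show "E v y z" using v sq_single E_sym E_trans by blast
  qed
  then obtain t where t: "func w t (\<lambda>v i. M v i m) B"
    "\<forall>\<^sub>F v in nhds w. \<forall>x y. maps v t x y \<longleftrightarrow> maps v s x y \<or> E v x n \<and> E v y b" by blast
  have "sub w s t"
  proof (rule fs_subI[where H = "\<lambda>v. \<forall>\<^sub>F v in nhds v.
      \<forall>x y. maps v t x y \<longleftrightarrow> maps v s x y \<or> E v x n \<and> E v y b"])
    show "fs w s" using assms fsI by blast
  next
    fix v x y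
    assume "\<forall>\<^sub>F v in nhds v. \<forall>x y. maps v t x y \<longleftrightarrow> maps v s x y \<or> E v x n \<and> E v y b"
    then show "maps v s x y \<Longrightarrow> maps v t x y" by (blast dest: boxD)
  qed (use t in \<open>simp_all add: opens\<close>)
  moreover have "sq w t m"
    unfolding seqn_def using t assms sq_isnat isnat_succ by blast
  ultimately show ?thesis using t by blast
qed

lemma ex_const:
  assumes "isnat w n" "B w b"
  shows "\<exists>t. sq w t n \<and> (\<forall>\<^sub>F v in nhds w. \<forall>x y. maps v t x y \<longleftrightarrow> M v x n \<and> E v y b)"
proof -
  let ?H = "\<lambda>v. isnat v n \<and> B v b"
  have H: "open {v. ?H v}" "?H w" using assms by (simp_all add: opens)
  have "\<exists>t. func w t (\<lambda>v i. M v i n) B \<and>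
    (\<forall>\<^sub>F v in nhds w. \<forall>x y. maps v t x y \<longleftrightarrow> M v x n \<and> E v y b)"
  proof (rule ex_function[OF _ _ H])
    show "definable (\<lambda>w p. \<exists>x y. (M w x n \<and> E w y b) \<and> opair w p x y)"
      by (rule definableI[where s = "[n, b]" and
          F = "\<^bold>\<exists>x. \<^bold>\<exists>y. (x \<^bold>\<in> 0 \<^bold>\<and> y \<^bold>= 1) \<^bold>\<and> is_opair 2 x y"]) simp
  next
    fix v x y x' y'
    assume "M v x n \<and> E v y b" "E v x x'" "E v y y'"
    then show "M v x' n \<and> E v y' b"
      using M_congL E_sym E_trans by blast
  next
    fix v x y
    assume v: "?H v" and "M v x n \<and> E v y b"
    then have "M v x n \<and> B v y" using B_cong E_sym by blast
    then show "M v x n \<and> B v y \<and> isnat v x \<and> isnat v y"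
      using v isnat_mem B_isnat by blast
  next
    fix v x
    assume "?H v" "M v x n"
    then show "\<exists>y. M v x n \<and> E v y b" using E_refl by blast
  next
    fix v x y z
    assume "?H v" "M v x n \<and> E v y b" "M v x n \<and> E v z b"
    then show "E v y z" using E_sym E_trans by blast
  qed
  then show ?thesis unfolding seqn_def using assms by blast
qed

lemma ex_nil:
  assumes z: "empty w z"
  shows "\<exists>s. sq w s z \<and> (\<forall>t. sub w s t)"
proof -
  obtain b where "B w b" using ex_B by blast
  then obtain s where s: "sq w s z" using ex_const isnat_zero z by blast
  have "sub w s t" for t
  proof (rule fs_subI[where H = "\<lambda>v. empty v z \<and> sq v s z"])
    fix v x y
    assume "empty v z \<and> sq v s z" "maps v s x y"
    then show "maps v t x y" using sq_sort emptyD by blast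
  qed (use s z fsI in \<open>simp_all add: opens\<close>)
  then show ?thesis using s by blast
qed

text \<open>Every sequence is a subset of the set of \<open>ex_pairs\<close>, so a power set serves
  as a bound for separating sets of sequences.\<close>

lemma ex_seqs: "\<exists>S. \<forall>\<^sub>F v in nhds w. \<forall>s. fs v s \<longrightarrow> M v s S"
proof -
  obtain P where P:
    "\<forall>\<^sub>F v in nhds w. \<forall>p x y. isnat v x \<and> isnat v y \<and> opair v p x y \<longrightarrow> M v p P"
    using ex_pairs by blast
  obtain S where S: "\<forall>\<^sub>F v in nhds w. \<forall>s. M v s S \<longleftrightarrow> sub v s P" using ex_power by blast
  define K where "K v \<longleftrightarrow>
    (\<forall>\<^sub>F u in nhds v. \<forall>p x y. isnat u x \<and> isnat u y \<and> opair u p x y \<longrightarrow> M u p P) \<and>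
    (\<forall>\<^sub>F u in nhds v. \<forall>s. M u s S \<longleftrightarrow> sub u s P)" for v
  have K: "open {v. K v}" "K w" unfolding K_def using S P by (simp_all add: opens)
  have KP: "M v p P" if "K v" "isnat v x" "isnat v y" "opair v p x y" for v p x y
    using that unfolding K_def by (blast dest: boxD)
  have KS: "M v s S \<longleftrightarrow> sub v s P" if "K v" for v s
    using that unfolding K_def by (blast dest: boxD)
  have "sub v s P" if "K v" "fs v s" for v s
    unfolding sub_def
  proof (rule boxI[where H = "\<lambda>v. K v \<and> fs v s"])
    fix u
    assume u: "K u \<and> fs u s"
    show "\<forall>p. M u p s \<longrightarrow> M u p P"
    proof (intro allI impI)
      fix p
      assume p: "M u p s"
      obtain n where n: "sq u s n" using u unfolding finseq_def by blast
      obtain x y where xy: "opair u p x y" "M u x n" "B u y"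
        using n p unfolding seqn_def func_def by (blast dest: boxD)
      then show "M u p P" using KP u isnat_mem sq_isnat[OF n] B_isnat by blast
    qed
  qed (use that K in \<open>simp_all add: opens\<close>)
  then have "\<forall>\<^sub>F v in nhds w. \<forall>s. fs v s \<longrightarrow> M v s S"
    using KS by (intro boxI[OF K]) blast
  then show ?thesis ..
qed

section \<open>The ideal completion\<close>

definition ideal where
  "ideal w I \<longleftrightarrow>
    (\<forall>\<^sub>F v in nhds w. \<forall>s. M v s I \<longrightarrow> fs v s) \<and>
    (\<exists>s. M w s I) \<and>
    (\<forall>\<^sub>F v in nhds w. \<forall>s t. M v s I \<and> M v t I \<longrightarrow> (\<exists>r. M v r I \<and> sub v s r \<and> sub v t r)) \<and>
    (\<forall>\<^sub>F v in nhds w. \<forall>s t. M v s I \<and> fs v t \<and> sub v t s \<longrightarrow> M v t I)"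

definition directed where
  "directed w S \<longleftrightarrow>
    (\<forall>\<^sub>F v in nhds w. \<forall>x. M v x S \<longrightarrow> ideal v x) \<and>
    (\<exists>x. M w x S) \<and>
    (\<forall>\<^sub>F v in nhds w. \<forall>x y. M v x S \<and> M v y S \<longrightarrow> (\<exists>z. M v z S \<and> sub v x z \<and> sub v y z))"

definition supr where
  "supr w S z \<longleftrightarrow> ideal w z \<and>
    (\<forall>\<^sub>F v in nhds w. \<forall>x. M v x S \<longrightarrow> sub v x z) \<and>
    (\<forall>\<^sub>F v in nhds w. \<forall>y. ideal v y \<and> (\<forall>\<^sub>F u in nhds v. \<forall>x. M u x S \<longrightarrow> sub u x y) \<longrightarrow> sub v z y)"

definition waybelow where
  "waybelow w x y \<longleftrightarrow> (\<forall>\<^sub>F v in nhds w. \<forall>S z. directed v S \<and> supr v S z \<and> sub v y z \<longrightarrow>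
    (\<exists>s. M v s S \<and> sub v x s))"

definition sopen where
  "sopen w U \<longleftrightarrow>
    (\<forall>\<^sub>F v in nhds w. \<forall>x. M v x U \<longrightarrow> ideal v x) \<and>
    (\<forall>\<^sub>F v in nhds w. \<forall>x y. M v x U \<and> ideal v y \<and> sub v x y \<longrightarrow> M v y U) \<and>
    (\<forall>\<^sub>F v in nhds w. \<forall>S z. directed v S \<and> supr v S z \<and> M v z U \<longrightarrow> (\<exists>s. M v s S \<and> M v s U))"

definition maxi where
  "maxi w x \<longleftrightarrow> (\<forall>\<^sub>F v in nhds w. \<forall>y. ideal v y \<and> sub v x y \<longrightarrow> sub v y x)"

definition sharp where
  "sharp w x \<longleftrightarrow> (\<forall>\<^sub>F v in nhds w. \<forall>u y. ideal v u \<and> ideal v y \<and> waybelow v u y \<longrightarrow>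
    waybelow v u x \<or> (\<forall>\<^sub>F v in nhds v. \<not> sub v y x))"

definition smax where
  "smax w x \<longleftrightarrow> (\<forall>\<^sub>F v in nhds w. \<forall>u y. ideal v u \<and> ideal v y \<and> waybelow v u y \<longrightarrow>
    waybelow v u x \<or>
    (\<exists>U V. sopen v U \<and> sopen v V \<and> M v y U \<and> M v x V \<and>
      (\<forall>\<^sub>F u in nhds v. \<not> (\<exists>z. M u z U \<and> M u z V))))"

lemma holds_ideal [simp]:
  "x < length s \<Longrightarrow> holds e w s (is_ideal A x) \<longleftrightarrow> ideal w (s ! x)"
  by (simp add: is_ideal_def is_directed_def ideal_def nth_append)

lemma holds_directed [simp]:
  "x < length s \<Longrightarrow> holds e w s (is_directed (is_ideal A) (\<^bold>\<subseteq>) x) \<longleftrightarrow> directed w (s ! x)"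
  by (simp add: is_directed_def directed_def nth_append)

lemma holds_supremum [simp]:
  "x < length s \<Longrightarrow> y < length s \<Longrightarrow>
    holds e w s (is_supremum (is_ideal A) (\<^bold>\<subseteq>) x y) \<longleftrightarrow> supr w (s ! x) (s ! y)"
  by (simp add: is_supremum_def supr_def nth_append)

lemma holds_way_below [simp]:
  "x < length s \<Longrightarrow> y < length s \<Longrightarrow>
    holds e w s (way_below (is_ideal A) (\<^bold>\<subseteq>) x y) \<longleftrightarrow> waybelow w (s ! x) (s ! y)"
  by (simp add: way_below_def waybelow_def nth_append)

lemma holds_scott_open [simp]:
  "x < length s \<Longrightarrow> holds e w s (scott_open (is_ideal A) (\<^bold>\<subseteq>) x) \<longleftrightarrow> sopen w (s ! x)"
  by (simp add: scott_open_def sopen_def nth_append)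

lemma holds_maximal [simp]:
  "x < length s \<Longrightarrow> holds e w s (is_maximal (is_ideal A) (\<^bold>\<subseteq>) x) \<longleftrightarrow> maxi w (s ! x)"
  by (simp add: is_maximal_def maxi_def nth_append)

lemma holds_sharp [simp]:
  "x < length s \<Longrightarrow> holds e w s (is_sharp (is_ideal A) (\<^bold>\<subseteq>) x) \<longleftrightarrow> sharp w (s ! x)"
  by (simp add: is_sharp_def sharp_def nth_append)

lemma holds_strongly_maximal [simp]:
  "x < length s \<Longrightarrow> holds e w s (is_strongly_maximal (is_ideal A) (\<^bold>\<subseteq>) x) \<longleftrightarrow> smax w (s ! x)"
  by (simp add: is_strongly_maximal_def smax_def nth_append)

lemma open_domain [opens]:
  "open {w. ideal w x}" "open {w. directed w x}" "open {w. supr w x y}" "open {w. waybelow w x y}"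
  "open {w. sopen w x}" "open {w. maxi w x}" "open {w. sharp w x}" "open {w. smax w x}"
  unfolding ideal_def directed_def supr_def waybelow_def sopen_def maxi_def sharp_def smax_def
  by (simp_all add: opens)

lemma ideal_fs: "ideal w I \<Longrightarrow> M w s I \<Longrightarrow> fs w s"
  unfolding ideal_def by (blast dest: boxD)

lemma ideal_inhabited: "ideal w I \<Longrightarrow> \<exists>s. M w s I"
  unfolding ideal_def by blast

lemma ideal_directed:
  "ideal w I \<Longrightarrow> M w s I \<Longrightarrow> M w t I \<Longrightarrow> \<exists>r. M w r I \<and> sub w s r \<and> sub w t r"
  unfolding ideal_def by (blast dest: boxD)

lemma ideal_lower: "ideal w I \<Longrightarrow> M w s I \<Longrightarrow> fs w t \<Longrightarrow> sub w t s \<Longrightarrow> M w t I"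
  unfolding ideal_def by (blast dest: boxD)

lemma directed_ideal: "directed w S \<Longrightarrow> M w x S \<Longrightarrow> ideal w x"
  unfolding directed_def by (blast dest: boxD)

lemma directed_inhabited: "directed w S \<Longrightarrow> \<exists>x. M w x S"
  unfolding directed_def by blast

lemma directed_directed:
  "directed w S \<Longrightarrow> M w x S \<Longrightarrow> M w y S \<Longrightarrow> \<exists>z. M w z S \<and> sub w x z \<and> sub w y z"
  unfolding directed_def by (blast dest: boxD)

lemma supr_least:
  assumes "supr w S z" "ideal w y" "\<forall>\<^sub>F v in nhds w. \<forall>x. M v x S \<longrightarrow> sub v x y"
  shows "sub w z y"
  using assms unfolding supr_def by (blast dest: boxD)

lemma waybelowD: "waybelow w x y \<Longrightarrow> directed w S \<Longrightarrow> supr w S z \<Longrightarrow> sub w y z \<Longrightarrow> \<exists>s. M w s S \<and> sub w x s"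
  unfolding waybelow_def by (blast dest: boxD)

lemma sopen_upper: "sopen w U \<Longrightarrow> M w x U \<Longrightarrow> ideal w y \<Longrightarrow> sub w x y \<Longrightarrow> M w y U"
  unfolding sopen_def by (blast dest: boxD)

lemma sopen_supr: "sopen w U \<Longrightarrow> directed w S \<Longrightarrow> supr w S z \<Longrightarrow> M w z U \<Longrightarrow> \<exists>s. M w s S \<and> M w s U"
  unfolding sopen_def by (blast dest: boxD)

lemma maxiD: "maxi w x \<Longrightarrow> ideal w y \<Longrightarrow> sub w x y \<Longrightarrow> sub w y x"
  unfolding maxi_def by (blast dest: boxD)

lemma sharpD': "sharp w x \<Longrightarrow> ideal w u \<Longrightarrow> ideal w y \<Longrightarrow> waybelow w u y \<Longrightarrow>
    waybelow w u x \<or> (\<forall>\<^sub>F v in nhds w. \<not> sub v y x)"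
  unfolding sharp_def by (blast dest: boxD)

lemma smaxD': "smax w x \<Longrightarrow> ideal w u \<Longrightarrow> ideal w y \<Longrightarrow> waybelow w u y \<Longrightarrow>
    waybelow w u x \<or>
    (\<exists>U V. sopen w U \<and> sopen w V \<and> M w y U \<and> M w x V \<and>
      (\<forall>\<^sub>F u in nhds w. \<not> (\<exists>z. M u z U \<and> M u z V)))"
  unfolding smax_def by (blast dest: boxD)

section \<open>Principal ideals and the way-below relation\<close>

text \<open>The principal ideal of \<open>s\<close>. Terms are variables only, so it is introduced
  as a relation and not as an operation.\<close>

definition down where
  "down w d s \<longleftrightarrow> fs w s \<and> (\<forall>\<^sub>F v in nhds w. \<forall>t. M v t d \<longleftrightarrow> fs v t \<and> sub v t s)"

lemma open_down [opens]: "open {w. down w d s}"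
  unfolding down_def by (simp add: opens)

lemma downD: "down w d s \<Longrightarrow> M w t d \<longleftrightarrow> fs w t \<and> sub w t s"
  unfolding down_def by (blast dest: boxD)

lemma down_fs: "down w d s \<Longrightarrow> fs w s"
  unfolding down_def by blast

lemma down_self: "down w d s \<Longrightarrow> M w s d"
  using downD down_fs sub_refl by blast

lemma ex_down:
  assumes "fs w s"
  shows "\<exists>d. down w d s"
proof -
  obtain P where P: "\<forall>\<^sub>F v in nhds w. \<forall>t. M v t P \<longleftrightarrow> sub v t s" using ex_power by blast
  have "definable fs" by (rule definableI[where s = "[]" and F = "is_finseq A 0"]) simp
  then obtain d where "\<forall>\<^sub>F v in nhds w. \<forall>t. M v t d \<longleftrightarrow> M v t P \<and> fs v t"
    using separation by blast
  with P have "\<forall>\<^sub>F v in nhds w. \<forall>t. M v t d \<longleftrightarrow> fs v t \<and> sub v t s"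
    by (rule eventually_elim2) blast
  then show ?thesis using assms unfolding down_def by blast
qed

lemma ideal_down:
  assumes "down w d s"
  shows "ideal w d"
proof -
  have H: "open {v. down v d s}" by (rule open_down)
  show ?thesis
    unfolding ideal_def
  proof (intro conjI)
    show "\<exists>s. M w s d" using down_self[OF assms] by blast
    show "\<forall>\<^sub>F v in nhds w. \<forall>t. M v t d \<longrightarrow> fs v t"
      by (rule boxI[OF H assms]) (use downD in blast)
    show "\<forall>\<^sub>F v in nhds w. \<forall>s t. M v s d \<and> M v t d \<longrightarrow> (\<exists>r. M v r d \<and> sub v s r \<and> sub v t r)"
      by (rule boxI[OF H assms]) (use downD down_self in blast)
    show "\<forall>\<^sub>F v in nhds w. \<forall>s t. M v s d \<and> fs v t \<and> sub v t s \<longrightarrow> M v t d"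
      by (rule boxI[OF H assms]) (use downD sub_trans in blast)
  qed
qed

lemma down_sub:
  assumes "down w d s" "ideal w x" "M w s x"
  shows "sub w d x"
  unfolding sub_def
proof (rule boxI[where H = "\<lambda>v. down v d s \<and> ideal v x \<and> M v s x"])
  fix v
  assume "down v d s \<and> ideal v x \<and> M v s x"
  then show "\<forall>t. M v t d \<longrightarrow> M v t x" using downD ideal_lower by blast
qed (use assms in \<open>simp_all add: opens\<close>)

text \<open>Directedness of \<open>S\<close> brings two sequences of the union into one member of
  \<open>S\<close>, whose own directedness gives their common extension.\<close>

lemma ex_directed_union:
  assumes "directed w S"
  shows "\<exists>z. supr w S z \<and> (\<forall>\<^sub>F v in nhds w. \<forall>t. M v t z \<longleftrightarrow> (\<exists>I. M v I S \<and> M v t I))"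
proof -
  obtain z where z: "\<forall>\<^sub>F v in nhds w. \<forall>t. M v t z \<longleftrightarrow> (\<exists>I. M v I S \<and> M v t I)"
    using ex_union by blast
  define K where "K v \<longleftrightarrow> directed v S \<and>
    (\<forall>\<^sub>F u in nhds v. \<forall>t. M u t z \<longleftrightarrow> (\<exists>I. M u I S \<and> M u t I))" for v
  have K: "open {v. K v}" "K w" unfolding K_def using z assms by (simp_all add: opens)
  have Kz: "M v t z \<longleftrightarrow> (\<exists>I. M v I S \<and> M v t I)" if "K v" for v t
    using that unfolding K_def by (blast dest: boxD)
  have KS: "directed v S" if "K v" for v
    using that unfolding K_def by blast
  have "ideal w z"
    unfolding ideal_def
  proof (intro conjI)
    show "\<exists>s. M w s z"
      using Kz[OF K(2)] directed_inhabited[OF assms] directed_ideal[OF assms] ideal_inhabited by blast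
    show "\<forall>\<^sub>F v in nhds w. \<forall>t. M v t z \<longrightarrow> fs v t"
      by (rule boxI[OF K]) (use Kz KS directed_ideal ideal_fs in blast)
    show "\<forall>\<^sub>F v in nhds w. \<forall>s t. M v s z \<and> M v t z \<longrightarrow> (\<exists>r. M v r z \<and> sub v s r \<and> sub v t r)"
    proof (rule boxI[OF K], intro allI impI)
      fix v s t
      assume v: "K v" and "M v s z \<and> M v t z"
      then obtain I J where IJ: "M v I S" "M v s I" "M v J S" "M v t J" using Kz by blast
      then obtain L where L: "M v L S" "sub v I L" "sub v J L"
        using directed_directed KS[OF v] by blast
      then have "M v s L" "M v t L" using IJ subD by blast+
      then obtain r where "M v r L" "sub v s r" "sub v t r"
        using ideal_directed directed_ideal[OF KS[OF v] L(1)] by blast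
      then show "\<exists>r. M v r z \<and> sub v s r \<and> sub v t r" using Kz[OF v] L by blast
    qed
    show "\<forall>\<^sub>F v in nhds w. \<forall>s t. M v s z \<and> fs v t \<and> sub v t s \<longrightarrow> M v t z"
      by (rule boxI[OF K]) (use Kz KS directed_ideal ideal_lower in blast)
  qed
  moreover have "\<forall>\<^sub>F v in nhds w. \<forall>x. M v x S \<longrightarrow> sub v x z"
  proof (rule boxI[OF K], intro allI impI)
    fix v x
    assume v: "K v" "M v x S"
    show "sub v x z"
      unfolding sub_def
    proof (rule boxI[where H = "\<lambda>v. K v \<and> M v x S"])
      fix u
      assume "K u \<and> M u x S"
      then show "\<forall>t. M u t x \<longrightarrow> M u t z" using Kz by blast
    qed (use v K in \<open>simp_all add: opens\<close>)
  qed
  moreover have "\<forall>\<^sub>F v in nhds w. \<forall>y. ideal v y \<and>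
      (\<forall>\<^sub>F u in nhds v. \<forall>x. M u x S \<longrightarrow> sub u x y) \<longrightarrow> sub v z y"
  proof (rule boxI[OF K], intro allI impI)
    fix v y
    assume v: "K v" and y: "ideal v y \<and> (\<forall>\<^sub>F u in nhds v. \<forall>x. M u x S \<longrightarrow> sub u x y)"
    show "sub v z y"
      unfolding sub_def
    proof (rule boxI[where H = "\<lambda>v. K v \<and> (\<forall>\<^sub>F u in nhds v. \<forall>x. M u x S \<longrightarrow> sub u x y)"])
      fix u
      assume u: "K u \<and> (\<forall>\<^sub>F u in nhds u. \<forall>x. M u x S \<longrightarrow> sub u x y)"
      then have "\<forall>x. M u x S \<longrightarrow> sub u x y" by (blast dest: boxD)
      then show "\<forall>t. M u t z \<longrightarrow> M u t y" using Kz u subD by blast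
    qed (use v y K in \<open>simp_all add: opens\<close>)
  qed
  ultimately show ?thesis using z unfolding supr_def by blast
qed

text \<open>A supremum is contained in the union, since the union is an upper bound. So
  \<open>s\<close> lies in some member of \<open>S\<close>, which then contains all prefixes of
  \<open>s\<close>, in particular all of \<open>u\<close>.\<close>

lemma waybelowI:
  assumes "ideal w u" "M w s y" "\<forall>\<^sub>F v in nhds w. \<forall>t. M v t u \<longrightarrow> sub v t s"
  shows "waybelow w u y"
  unfolding waybelow_def
proof (rule boxI[where H = "\<lambda>v. ideal v u \<and> M v s y \<and> (\<forall>\<^sub>F v in nhds v. \<forall>t. M v t u \<longrightarrow> sub v t s)"])
  fix v
  assume v: "ideal v u \<and> M v s y \<and> (\<forall>\<^sub>F v in nhds v. \<forall>t. M v t u \<longrightarrow> sub v t s)"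
  show "\<forall>S z. directed v S \<and> supr v S z \<and> sub v y z \<longrightarrow> (\<exists>x. M v x S \<and> sub v u x)"
  proof (intro allI impI)
    fix S z
    assume S: "directed v S \<and> supr v S z \<and> sub v y z"
    then obtain z' where z': "supr v S z'"
      "\<forall>\<^sub>F v in nhds v. \<forall>t. M v t z' \<longleftrightarrow> (\<exists>I. M v I S \<and> M v t I)"
      using ex_directed_union by blast
    then have "sub v z z'" using S supr_least unfolding supr_def by blast
    then have "M v s z'" using v S subD by blast
    then obtain I where I: "M v I S" "M v s I" using z'(2) by (blast dest: boxD)
    then have "ideal v I" using S directed_ideal by blast
    have "sub v u I"
      unfolding sub_def
    proof (rule boxI[where H = "\<lambda>v. ideal v u \<and> ideal v I \<and> M v s I \<and>
        (\<forall>\<^sub>F v in nhds v. \<forall>t. M v t u \<longrightarrow> sub v t s)"])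
      fix v
      assume v: "ideal v u \<and> ideal v I \<and> M v s I \<and> (\<forall>\<^sub>F v in nhds v. \<forall>t. M v t u \<longrightarrow> sub v t s)"
      then have "\<forall>t. M v t u \<longrightarrow> sub v t s" by (blast dest: boxD)
      then show "\<forall>t. M v t u \<longrightarrow> M v t I" using v ideal_fs ideal_lower by blast
    qed (use v I \<open>ideal v I\<close> in \<open>simp_all add: opens\<close>)
    then show "\<exists>x. M v x S \<and> sub v u x" using I by blast
  qed
qed (use assms in \<open>simp_all add: opens\<close>)

text \<open>Supplies the directed set on which way-below and Scott openness are tested.\<close>

lemma ex_downs:
  assumes y: "ideal w y"
  shows "\<exists>S. directed w S \<and> supr w S y \<and> (\<forall>\<^sub>F v in nhds w. \<forall>d. M v d S \<longrightarrow> (\<exists>s. M v s y \<and> down v d s))"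
proof -
  obtain P where P: "\<forall>\<^sub>F v in nhds w. \<forall>d. M v d P \<longleftrightarrow> sub v d y" using ex_power by blast
  have "definable (\<lambda>w d. \<exists>s. M w s y \<and> down w d s)"
    unfolding down_def
    by (rule definableI[where s = "[y]" and F = "\<^bold>\<exists>s. s \<^bold>\<in> 0 \<^bold>\<and> is_finseq A s \<^bold>\<and>
      (\<^bold>\<forall>t. t \<^bold>\<in> 1 \<^bold>\<longleftrightarrow> is_finseq A t \<^bold>\<and> t \<^bold>\<subseteq> s)"]) simp
  then obtain S where S: "\<forall>\<^sub>F v in nhds w. \<forall>d. M v d S \<longleftrightarrow> M v d P \<and> (\<exists>s. M v s y \<and> down v d s)"
    using separation by blast
  define K where "K v \<longleftrightarrow> ideal v y \<and> (\<forall>\<^sub>F u in nhds v. \<forall>d. M u d P \<longleftrightarrow> sub u d y) \<and>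
    (\<forall>\<^sub>F u in nhds v. \<forall>d. M u d S \<longleftrightarrow> M u d P \<and> (\<exists>s. M u s y \<and> down u d s))" for v
  have K: "open {v. K v}" "K w" unfolding K_def using y S P by (simp_all add: opens)
  have Ky: "ideal v y" if "K v" for v using that unfolding K_def by blast
  have "M v d P \<longleftrightarrow> sub v d y" "M v d S \<longleftrightarrow> M v d P \<and> (\<exists>s. M v s y \<and> down v d s)" if "K v" for v d
    using that unfolding K_def by (blast dest: boxD)+
  then have KS: "M v d S \<longleftrightarrow> (\<exists>s. M v s y \<and> down v d s)" if "K v" for v d
    using that down_sub Ky by blast
  have ex: "\<exists>d. M v d S \<and> down v d s" if "K v" "M v s y" for v s
    using that KS ex_down ideal_fs Ky by blast
  have "directed w S"
    unfolding directed_def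
  proof (intro conjI)
    show "\<exists>d. M w d S" using ex K(2) ideal_inhabited y by blast
    show "\<forall>\<^sub>F v in nhds w. \<forall>x. M v x S \<longrightarrow> ideal v x"
      by (rule boxI[OF K]) (use KS ideal_down in blast)
    show "\<forall>\<^sub>F v in nhds w. \<forall>c d. M v c S \<and> M v d S \<longrightarrow> (\<exists>z. M v z S \<and> sub v c z \<and> sub v d z)"
    proof (rule boxI[OF K], intro allI impI)
      fix v c d
      assume v: "K v" and "M v c S \<and> M v d S"
      then obtain s t where st: "M v s y" "down v c s" "M v t y" "down v d t" using KS by blast
      then obtain r where r: "M v r y" "sub v s r" "sub v t r" using ideal_directed Ky v by blast
      then obtain b where b: "M v b S" "down v b r" using ex v by blast
      then have "M v s b" "M v t b" using st r downD down_fs by blast+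
      then show "\<exists>z. M v z S \<and> sub v c z \<and> sub v d z"
        using b st down_sub ideal_down by blast
    qed
  qed
  moreover have "supr w S y"
    unfolding supr_def
  proof (intro conjI)
    show "\<forall>\<^sub>F v in nhds w. \<forall>x. M v x S \<longrightarrow> sub v x y"
      by (rule boxI[OF K]) (use KS down_sub Ky in blast)
    show "\<forall>\<^sub>F v in nhds w. \<forall>z. ideal v z \<and>
      (\<forall>\<^sub>F u in nhds v. \<forall>x. M u x S \<longrightarrow> sub u x z) \<longrightarrow> sub v y z"
    proof (rule boxI[OF K], intro allI impI)
      fix v z
      assume v: "K v" and z: "ideal v z \<and> (\<forall>\<^sub>F u in nhds v. \<forall>x. M u x S \<longrightarrow> sub u x z)"
      show "sub v y z"
        unfolding sub_def
      proof (rule boxI[where H = "\<lambda>v. K v \<and> (\<forall>\<^sub>F u in nhds v. \<forall>x. M u x S \<longrightarrow> sub u x z)"])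
        fix u
        assume u: "K u \<and> (\<forall>\<^sub>F u in nhds u. \<forall>x. M u x S \<longrightarrow> sub u x z)"
        then have "\<forall>x. M u x S \<longrightarrow> sub u x z" by (blast dest: boxD)
        then show "\<forall>t. M u t y \<longrightarrow> M u t z" using ex u subD down_self by blast
      qed (use v z K in \<open>simp_all add: opens\<close>)
    qed
  qed (rule y)
  moreover have "\<forall>\<^sub>F v in nhds w. \<forall>d. M v d S \<longrightarrow> (\<exists>s. M v s y \<and> down v d s)"
    by (rule boxI[OF K]) (use KS in blast)
  ultimately show ?thesis by blast
qed

text \<open>Among the principal ideals of elements of \<open>y\<close>, whose supremum is
  \<open>y\<close>, one contains \<open>u\<close>; its generator is \<open>s\<close>.\<close>

lemma waybelowE:
  assumes "waybelow w u y" "ideal w y"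
  obtains s where "M w s y" "\<forall>\<^sub>F v in nhds w. \<forall>t. M v t u \<longrightarrow> sub v t s"
proof -
  obtain S where S: "directed w S" "supr w S y"
    "\<forall>\<^sub>F v in nhds w. \<forall>d. M v d S \<longrightarrow> (\<exists>s. M v s y \<and> down v d s)"
    using ex_downs assms(2) by blast
  then obtain d where d: "M w d S" "sub w u d" using waybelowD assms(1) sub_refl by blast
  then obtain s where s: "M w s y" "down w d s" using S(3) by (blast dest: boxD)
  have "\<forall>\<^sub>F v in nhds w. \<forall>t. M v t u \<longrightarrow> sub v t s"
  proof (rule boxI[where H = "\<lambda>v. sub v u d \<and> down v d s"])
    fix v
    assume "sub v u d \<and> down v d s"
    then show "\<forall>t. M v t u \<longrightarrow> sub v t s" using subD downD by blast
  qed (use d s in \<open>simp_all add: opens\<close>)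
  then show thesis using s that by blast
qed

text \<open>Compactness of principal ideals, which turns sharpness and strong maximality into
  statements about sequences.\<close>

lemma waybelow_down:
  assumes "down w d s" "ideal w x"
  shows "waybelow w d x \<longleftrightarrow> M w s x"
proof
  assume "waybelow w d x"
  then obtain r where r: "M w r x" "\<forall>\<^sub>F v in nhds w. \<forall>t. M v t d \<longrightarrow> sub v t r"
    using waybelowE assms(2) by blast
  then have "sub w s r" using down_self[OF assms(1)] by (blast dest: boxD)
  then show "M w s x" using r ideal_lower assms down_fs by blast
next
  assume "M w s x"
  moreover have "\<forall>\<^sub>F v in nhds w. \<forall>t. M v t d \<longrightarrow> sub v t s"
    by (rule boxI[where H = "\<lambda>v. down v d s"]) (use assms downD in \<open>auto simp: opens\<close>)
  ultimately show "waybelow w d x" using waybelowI ideal_down assms(1) by blast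
qed

section \<open>Sharp and strongly maximal ideals\<close>

text \<open>A principal ideal is way below itself, so sharpness applies with it on both
  sides.\<close>

lemma sharpD:
  assumes x: "ideal w x" "sharp w x" and s: "fs w s"
  shows "M w s x \<or> (\<forall>\<^sub>F v in nhds w. \<not> M v s x)"
proof -
  obtain d where d: "down w d s" using ex_down s by blast
  then have "waybelow w d d" using waybelow_down ideal_down down_self by blast
  then consider "waybelow w d x" | "\<forall>\<^sub>F v in nhds w. \<not> sub v d x"
    using sharpD' x ideal_down d by blast
  then show ?thesis
  proof cases
    case 1
    then show ?thesis using waybelow_down d x by blast
  next
    case 2
    have "\<forall>\<^sub>F v in nhds w. \<not> M v s x"
    proof (rule boxI[where H = "\<lambda>v. down v d s \<and> ideal v x \<and> (\<forall>\<^sub>F v in nhds v. \<not> sub v d x)"])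
      fix v
      assume v: "down v d s \<and> ideal v x \<and> (\<forall>\<^sub>F v in nhds v. \<not> sub v d x)"
      then have "\<not> sub v d x" by (blast dest: boxD)
      then show "\<not> M v s x" using v down_sub by blast
    qed (use 2 d x in \<open>simp_all add: opens\<close>)
    then show ?thesis ..
  qed
qed

text \<open>If \<open>u\<close> is way below \<open>y\<close>, some \<open>s\<close> in
  \<open>y\<close> bounds \<open>u\<close>. In \<open>x\<close> this \<open>s\<close> puts
  \<open>u\<close> way below \<open>x\<close>; outside \<open>x\<close> it keeps \<open>y\<close>
  from lying below \<open>x\<close>.\<close>

lemma sharpI:
  assumes x: "ideal w x"
    and dec: "\<forall>\<^sub>F v in nhds w. \<forall>s. fs v s \<longrightarrow> M v s x \<or> (\<forall>\<^sub>F v in nhds v. \<not> M v s x)"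
  shows "sharp w x"
  unfolding sharp_def
proof (rule boxI[where H = "\<lambda>v. ideal v x \<and>
    (\<forall>\<^sub>F v in nhds v. \<forall>s. fs v s \<longrightarrow> M v s x \<or> (\<forall>\<^sub>F v in nhds v. \<not> M v s x))"],
    goal_cases _ _ near)
  case (near v)
  then have dec: "M v s x \<or> (\<forall>\<^sub>F v in nhds v. \<not> M v s x)" if "fs v s" for s
    using that by (blast dest: boxD)
  show ?case
  proof (intro allI impI)
    fix u y
    assume uy: "ideal v u \<and> ideal v y \<and> waybelow v u y"
    then obtain s where s: "M v s y" "\<forall>\<^sub>F v in nhds v. \<forall>t. M v t u \<longrightarrow> sub v t s"
      using waybelowE by blast
    then consider "M v s x" | "\<forall>\<^sub>F v in nhds v. \<not> M v s x" using dec ideal_fs uy by blast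
    then show "waybelow v u x \<or> (\<forall>\<^sub>F v in nhds v. \<not> sub v y x)"
    proof cases
      case 1
      then show ?thesis using waybelowI uy s by blast
    next
      case 2
      have "\<forall>\<^sub>F v in nhds v. \<not> sub v y x"
      proof (rule boxI[where H = "\<lambda>v. M v s y \<and> (\<forall>\<^sub>F v in nhds v. \<not> M v s x)"])
        fix v
        assume v: "M v s y \<and> (\<forall>\<^sub>F v in nhds v. \<not> M v s x)"
        then have "\<not> M v s x" by (blast dest: boxD)
        then show "\<not> sub v y x" using v subD by blast
      qed (use 2 s in \<open>simp_all add: opens\<close>)
      then show ?thesis ..
    qed
  qed
qed (use assms in \<open>simp_all add: opens\<close>)

text \<open>The Scott open set \<open>V\<close> contains \<open>x\<close>, the directed supremum of
  its principal ideals, and hence contains the principal ideal of some \<open>t\<close> in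
  \<open>x\<close>. If \<open>s\<close> and \<open>t\<close> were comparable, the larger of their
  principal ideals would lie in both open sets.\<close>

lemma smaxD:
  assumes x: "ideal w x" "smax w x" and s: "fs w s"
  shows "M w s x \<or> (\<exists>t. M w t x \<and> (\<forall>\<^sub>F v in nhds w. \<not> sub v s t) \<and> (\<forall>\<^sub>F v in nhds w. \<not> sub v t s))"
proof -
  obtain d where d: "down w d s" using ex_down s by blast
  then have "waybelow w d d" using waybelow_down ideal_down down_self by blast
  then consider "waybelow w d x" | U V where "sopen w U" "sopen w V" "M w d U" "M w x V"
    "\<forall>\<^sub>F u in nhds w. \<not> (\<exists>z. M u z U \<and> M u z V)"
    using smaxD' x ideal_down d by blast
  then show ?thesis
  proof cases
    case 1
    then show ?thesis using waybelow_down d x by blast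
  next
    case 2
    obtain S where S: "directed w S" "supr w S x"
      "\<forall>\<^sub>F v in nhds w. \<forall>d. M v d S \<longrightarrow> (\<exists>s. M v s x \<and> down v d s)"
      using ex_downs x(1) by blast
    then obtain c where c: "M w c S" "M w c V" using sopen_supr 2 by blast
    then obtain t where t: "M w t x" "down w c t" using S(3) by (blast dest: boxD)
    define K where "K v \<longleftrightarrow> down v d s \<and> down v c t \<and> sopen v U \<and> sopen v V \<and> M v d U \<and> M v c V \<and>
      (\<forall>\<^sub>F u in nhds v. \<not> (\<exists>z. M u z U \<and> M u z V))" for v
    have K: "open {v. K v}" "K w" unfolding K_def using 2 c t d by (simp_all add: opens)
    have inc: "\<not> sub v s t" "\<not> sub v t s" if v: "K v" for v
    proof -
      have disj: "\<not> (M v z U \<and> M v z V)" for z using v unfolding K_def by (blast dest: boxD)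
      have dn: "down v d s" "down v c t" and U: "sopen v U" "M v d U" and V: "sopen v V" "M v c V"
        using v unfolding K_def by blast+
      show "\<not> sub v s t"
      proof
        assume "sub v s t"
        then have "M v s c" using dn downD down_fs by blast
        then have "sub v d c" using dn down_sub ideal_down by blast
        then show False using disj sopen_upper U V ideal_down dn by blast
      qed
      show "\<not> sub v t s"
      proof
        assume "sub v t s"
        then have "M v t d" using dn downD down_fs by blast
        then have "sub v c d" using dn down_sub ideal_down by blast
        then show False using disj sopen_upper U V ideal_down dn by blast
      qed
    qed
    have "\<forall>\<^sub>F v in nhds w. \<not> sub v s t" by (rule boxI[OF K]) (rule inc(1))
    moreover have "\<forall>\<^sub>F v in nhds w. \<not> sub v t s" by (rule boxI[OF K]) (rule inc(2))
    ultimately show ?thesis using t by blast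
  qed
qed

text \<open>The basic open set of a sequence. It is Scott open because directed suprema are
  unions.\<close>

lemma ex_open_above: "\<exists>U. sopen w U \<and> (\<forall>\<^sub>F v in nhds w. \<forall>I. M v I U \<longleftrightarrow> ideal v I \<and> M v s I)"
proof -
  obtain Q where Q: "\<forall>\<^sub>F v in nhds w. \<forall>s. fs v s \<longrightarrow> M v s Q" using ex_seqs by blast
  obtain P where P: "\<forall>\<^sub>F v in nhds w. \<forall>I. M v I P \<longleftrightarrow> sub v I Q" using ex_power by blast
  have "definable (\<lambda>w I. ideal w I \<and> M w s I)"
    by (rule definableI[where s = "[s]" and F = "is_ideal A 1 \<^bold>\<and> 0 \<^bold>\<in> 1"]) simp
  then obtain U where U: "\<forall>\<^sub>F v in nhds w. \<forall>I. M v I U \<longleftrightarrow> M v I P \<and> ideal v I \<and> M v s I"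
    using separation by blast
  define K where "K v \<longleftrightarrow> (\<forall>\<^sub>F v in nhds v. \<forall>s. fs v s \<longrightarrow> M v s Q) \<and>
    (\<forall>\<^sub>F v in nhds v. \<forall>I. M v I P \<longleftrightarrow> sub v I Q) \<and>
    (\<forall>\<^sub>F v in nhds v. \<forall>I. M v I U \<longleftrightarrow> M v I P \<and> ideal v I \<and> M v s I)" for v
  have K: "open {v. K v}" "K w" unfolding K_def using U Q P by (simp_all add: opens)
  have KQ: "fs v t \<Longrightarrow> M v t Q" and KP: "M v I P \<longleftrightarrow> sub v I Q"
    and KU: "M v I U \<longleftrightarrow> M v I P \<and> ideal v I \<and> M v s I" if "K v" for v t I
    using that unfolding K_def by (blast dest: boxD)+
  have "sub v I Q" if "K v" "ideal v I" for v I
    unfolding sub_def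
    by (rule boxI[where H = "\<lambda>v. K v \<and> ideal v I"]) (use that K KQ ideal_fs in \<open>auto simp: opens\<close>)
  then have U': "M v I U \<longleftrightarrow> ideal v I \<and> M v s I" if "K v" for v I
    using that KP KU by blast
  have "sopen w U"
    unfolding sopen_def
  proof (intro conjI)
    show "\<forall>\<^sub>F v in nhds w. \<forall>x. M v x U \<longrightarrow> ideal v x"
      by (rule boxI[OF K]) (use U' in blast)
    show "\<forall>\<^sub>F v in nhds w. \<forall>x y. M v x U \<and> ideal v y \<and> sub v x y \<longrightarrow> M v y U"
      by (rule boxI[OF K]) (use U' subD in blast)
    show "\<forall>\<^sub>F v in nhds w. \<forall>S z. directed v S \<and> supr v S z \<and> M v z U \<longrightarrow> (\<exists>s. M v s S \<and> M v s U)"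
    proof (rule boxI[OF K], intro allI impI)
      fix v S z
      assume v: "K v" and S: "directed v S \<and> supr v S z \<and> M v z U"
      obtain z' where z': "supr v S z'"
        "\<forall>\<^sub>F v in nhds v. \<forall>t. M v t z' \<longleftrightarrow> (\<exists>I. M v I S \<and> M v t I)"
        using ex_directed_union S by blast
      then have "sub v z z'" using S supr_least unfolding supr_def by blast
      then have "M v s z'" using v S subD U' by blast
      then obtain I where I: "M v I S" "M v s I" using z'(2) by (blast dest: boxD)
      then show "\<exists>s. M v s S \<and> M v s U" using U'[OF v] directed_ideal S by blast
    qed
  qed
  moreover have "\<forall>\<^sub>F v in nhds w. \<forall>I. M v I U \<longleftrightarrow> ideal v I \<and> M v s I"
    by (rule boxI[OF K]) (use U' in blast)
  ultimately show ?thesis by blast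
qed

text \<open>A bound \<open>s\<close> of \<open>u\<close> in \<open>y\<close> either lies in
  \<open>x\<close> or is incomparable to some \<open>t\<close> in \<open>x\<close>. In the second
  case the basic open sets of \<open>s\<close> and \<open>t\<close> are disjoint, since an ideal
  containing both would make them comparable.\<close>

lemma smaxI:
  assumes x: "ideal w x"
    and inc: "\<forall>\<^sub>F v in nhds w. \<forall>s. fs v s \<longrightarrow> M v s x \<or>
      (\<exists>t. M v t x \<and> (\<forall>\<^sub>F v in nhds v. \<not> sub v s t) \<and> (\<forall>\<^sub>F v in nhds v. \<not> sub v t s))"
  shows "smax w x"
  unfolding smax_def
proof (rule boxI[where H = "\<lambda>v. ideal v x \<and>
    (\<forall>\<^sub>F v in nhds v. \<forall>s. fs v s \<longrightarrow> M v s x \<or>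
      (\<exists>t. M v t x \<and> (\<forall>\<^sub>F v in nhds v. \<not> sub v s t) \<and> (\<forall>\<^sub>F v in nhds v. \<not> sub v t s)))"],
    goal_cases _ _ near)
  case (near v)
  then have inc: "M v s x \<or>
      (\<exists>t. M v t x \<and> (\<forall>\<^sub>F v in nhds v. \<not> sub v s t) \<and> (\<forall>\<^sub>F v in nhds v. \<not> sub v t s))"
    if "fs v s" for s
    using that by (blast dest: boxD)
  show ?case
  proof (intro allI impI)
    fix u y
    assume uy: "ideal v u \<and> ideal v y \<and> waybelow v u y"
    then obtain s where s: "M v s y" "\<forall>\<^sub>F v in nhds v. \<forall>t. M v t u \<longrightarrow> sub v t s"
      using waybelowE by blast
    then consider "M v s x" | t where "M v t x" "\<forall>\<^sub>F v in nhds v. \<not> sub v s t"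
      "\<forall>\<^sub>F v in nhds v. \<not> sub v t s"
      using inc ideal_fs uy by blast
    then show "waybelow v u x \<or> (\<exists>U V. sopen v U \<and> sopen v V \<and> M v y U \<and> M v x V \<and>
      (\<forall>\<^sub>F u in nhds v. \<not> (\<exists>z. M u z U \<and> M u z V)))"
    proof cases
      case 1
      then show ?thesis using waybelowI uy s by blast
    next
      case 2
      obtain U where U: "sopen v U" "\<forall>\<^sub>F v in nhds v. \<forall>I. M v I U \<longleftrightarrow> ideal v I \<and> M v s I"
        using ex_open_above by blast
      obtain V where V: "sopen v V" "\<forall>\<^sub>F v in nhds v. \<forall>I. M v I V \<longleftrightarrow> ideal v I \<and> M v t I"
        using ex_open_above by blast
      have "M v y U" using boxD[OF U(2)] uy s by blast
      moreover have "M v x V" using boxD[OF V(2)] near 2 by blast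
      moreover have "\<forall>\<^sub>F v in nhds v. \<not> (\<exists>z. M v z U \<and> M v z V)"
      proof (rule boxI[where H = "\<lambda>v.
          (\<forall>\<^sub>F v in nhds v. \<forall>I. M v I U \<longleftrightarrow> ideal v I \<and> M v s I) \<and>
          (\<forall>\<^sub>F v in nhds v. \<forall>I. M v I V \<longleftrightarrow> ideal v I \<and> M v t I) \<and>
          (\<forall>\<^sub>F v in nhds v. \<not> sub v s t) \<and> (\<forall>\<^sub>F v in nhds v. \<not> sub v t s)"], goal_cases _ _ near)
        case (near v)
        then have inc: "\<not> sub v s t" "\<not> sub v t s"
          and UV: "\<And>I. M v I U \<Longrightarrow> ideal v I \<and> M v s I" "\<And>I. M v I V \<Longrightarrow> ideal v I \<and> M v t I"
          by (blast dest: boxD)+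
        show ?case
        proof
          assume "\<exists>z. M v z U \<and> M v z V"
          then obtain z where "ideal v z" "M v s z" "M v t z" using UV by blast
          moreover from this obtain r where "M v r z" "sub v s r" "sub v t r"
            using ideal_directed by blast
          ultimately show False using fs_comparable ideal_fs inc by blast
        qed
      qed (use U V 2 in \<open>simp_all add: opens\<close>)
      ultimately show ?thesis using U V by blast
    qed
  qed
qed (use assms in \<open>simp_all add: opens\<close>)

lemma ideal_comparable: "ideal w y \<Longrightarrow> M w s y \<Longrightarrow> M w t y \<Longrightarrow> sub w s t \<or> sub w t s"
  using ideal_directed fs_comparable ideal_fs by meson

text \<open>Elements of one ideal are comparable, so an element of \<open>x\<close> incomparable to
  \<open>s\<close> excludes \<open>s\<close> from \<open>x\<close>.\<close>

lemma smax_imp_sharp: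
  assumes x: "ideal w x" "smax w x"
  shows "sharp w x"
proof (rule sharpI[OF x(1)], rule boxI[where H = "\<lambda>v. ideal v x \<and> smax v x"], goal_cases _ _ near)
  case (near v)
  show ?case
  proof (intro allI impI)
    fix s
    assume "fs v s"
    then consider "M v s x" | t where "M v t x" "\<forall>\<^sub>F v in nhds v. \<not> sub v s t"
      "\<forall>\<^sub>F v in nhds v. \<not> sub v t s"
      using smaxD near by blast
    then show "M v s x \<or> (\<forall>\<^sub>F v in nhds v. \<not> M v s x)"
    proof cases
      case 2
      have "\<forall>\<^sub>F v in nhds v. \<not> M v s x"
      proof (rule boxI[where H = "\<lambda>v. ideal v x \<and> M v t x \<and> (\<forall>\<^sub>F v in nhds v. \<not> sub v s t) \<and>
          (\<forall>\<^sub>F v in nhds v. \<not> sub v t s)"])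
        fix v
        assume v: "ideal v x \<and> M v t x \<and> (\<forall>\<^sub>F v in nhds v. \<not> sub v s t) \<and>
          (\<forall>\<^sub>F v in nhds v. \<not> sub v t s)"
        then have "\<not> sub v s t" "\<not> sub v t s" by (blast dest: boxD)+
        then show "\<not> M v s x" using v ideal_comparable by blast
      qed (use near 2 in \<open>simp_all add: opens\<close>)
      then show ?thesis ..
    qed blast
  qed
qed (use x in \<open>simp_all add: opens\<close>)

text \<open>If \<open>y\<close> contains \<open>x\<close>, an element of \<open>x\<close>
  incomparable to \<open>s\<close> in \<open>y\<close> would also lie in \<open>y\<close>, where any
  two elements are comparable. Hence \<open>s\<close> is in \<open>x\<close>.\<close>

lemma smax_imp_maxi:
  assumes x: "ideal w x" "smax w x"
  shows "maxi w x"
  unfolding maxi_def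
proof (rule boxI[where H = "\<lambda>v. ideal v x \<and> smax v x"], goal_cases _ _ near)
  case (near v)
  show ?case
  proof (intro allI impI)
    fix y
    assume y: "ideal v y \<and> sub v x y"
    show "sub v y x"
      unfolding sub_def
    proof (rule boxI[where H = "\<lambda>v. (ideal v x \<and> smax v x) \<and> ideal v y \<and> sub v x y"], goal_cases _ _ near')
      case (near' v)
      show ?case
      proof (intro allI impI)
        fix s
        assume s: "M v s y"
        then consider "M v s x" | t where "M v t x" "\<forall>\<^sub>F v in nhds v. \<not> sub v s t"
          "\<forall>\<^sub>F v in nhds v. \<not> sub v t s"
          using smaxD ideal_fs near' by blast
        then show "M v s x"
        proof cases
          case 2
          then have "\<not> sub v s t" "\<not> sub v t s" "M v t y"
            using near' subD by (blast dest: boxD)+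
          then show ?thesis using ideal_comparable s near' by blast
        qed
      qed
    qed (use near y in \<open>simp_all add: opens\<close>)
  qed
qed (use x in \<open>simp_all add: opens\<close>)

text \<open>Otherwise the ideal of any one-step extension of \<open>t\<close> would properly contain \<open>x\<close>.\<close>

lemma maxi_not_bounded:
  assumes x: "ideal w x" "maxi w x" and t: "M w t x" "sq w t n"
    and none: "\<forall>\<^sub>F v in nhds w. \<forall>r k. M v r x \<longrightarrow> \<not> maps v r n k"
  shows False
proof -
  obtain b where "B w b" using ex_B by blast
  moreover obtain m where "succ w m n" using ex_succ sq_isnat t by blast
  ultimately obtain t' where t': "sq w t' m" "sub w t t'"
    "\<forall>\<^sub>F v in nhds w. \<forall>x y. maps v t' x y \<longleftrightarrow> maps v t x y \<or> E v x n \<and> E v y b"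
    using ex_append t(2) by blast
  obtain d where d: "down w d t'" using ex_down fsI t' by blast
  have "sub w x d"
    unfolding sub_def
  proof (rule boxI[where H = "\<lambda>v. ideal v x \<and> M v t x \<and> sq v t n \<and> sub v t t' \<and> down v d t' \<and>
      (\<forall>\<^sub>F v in nhds v. \<forall>r k. M v r x \<longrightarrow> \<not> maps v r n k)"], goal_cases _ _ near)
    case (near v)
    then have none: "\<not> maps v r n k" if "M v r x" for r k
      using that by (blast dest: boxD)
    show ?case
    proof (intro allI impI)
      fix r
      assume r: "M v r x"
      then obtain q where q: "M v q x" "sub v t q" "sub v r q"
        using near ideal_directed by blast
      then obtain k where k: "sq v q k" using ideal_fs near unfolding finseq_def by blast
      \<comment> \<open>If \<open>q\<close> were longer than \<open>n\<close>, it would have an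
        entry at \<open>n\<close>. So it is no longer than its prefix \<open>t\<close> and hence is
        a prefix of \<open>t\<close>.\<close>
      have "\<not> M v n k" using k sq_total none q by blast
      then have "M v k n \<or> E v k n"
        using nat_trichotomy sq_isnat k near E_sym by blast
      then have "sub v q t"
        using sq_sub_if_shorter[OF k _ _ sub_refl q(2)] near fsI[OF k] by blast
      then have "sub v r t'" using q near sub_trans by blast
      then show "M v r d" using downD near ideal_fs r by blast
    qed
  qed (use x t t' d none in \<open>simp_all add: opens\<close>)
  then have "sub w d x" using maxiD x ideal_down d by blast
  then have "M w t' x" using down_self d subD by blast
  moreover have "maps w t' n b" using boxD[OF t'(3)] E_refl by blast
  ultimately show False using boxD[OF none] by blast
qed

section \<open>One-step extensions within an ideal\<close>

lemma append_sub:
  assumes "fs w t'" "sub w t q" "maps w q n b"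
    and "\<forall>\<^sub>F v in nhds w. \<forall>x y. maps v t' x y \<longleftrightarrow> maps v t x y \<or> E v x n \<and> E v y b"
  shows "sub w t' q"
proof (rule fs_subI[where H = "\<lambda>v. sub v t q \<and> maps v q n b \<and>
    (\<forall>\<^sub>F v in nhds v. \<forall>x y. maps v t' x y \<longleftrightarrow> maps v t x y \<or> E v x n \<and> E v y b)"])
  fix v x y
  assume v: "sub v t q \<and> maps v q n b \<and>
    (\<forall>\<^sub>F v in nhds v. \<forall>x y. maps v t' x y \<longleftrightarrow> maps v t x y \<or> E v x n \<and> E v y b)"
    and "maps v t' x y"
  then consider "maps v t x y" | "E v x n" "E v y b" by (blast dest: boxD)
  then show "maps v q x y"
  proof cases
    case 1
    then show ?thesis using v sub_maps by blast
  next
    case 2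
    then show ?thesis using v maps_cong[OF E_refl E_sym E_sym] by blast
  qed
qed (use assms in \<open>simp_all add: opens\<close>)

text \<open>The value \<open>k\<close> occurs at position \<open>n\<close> in \<open>x\<close>
  exactly if \<open>t\<close> followed by \<open>k\<close> lies in \<open>x\<close>, and sharpness
  decides the latter.\<close>

lemma sharp_value_decidable:
  assumes x: "ideal w x" "sharp w x" and t: "M w t x" "sq w t n" and k: "B w k"
  shows "(\<exists>r. M w r x \<and> maps w r n k) \<or> (\<forall>\<^sub>F v in nhds w. \<not> (\<exists>r. M v r x \<and> maps v r n k))"
proof -
  obtain m where "succ w m n" using ex_succ sq_isnat t by blast
  then obtain t' where t': "sq w t' m" "sub w t t'"
    "\<forall>\<^sub>F v in nhds w. \<forall>x y. maps v t' x y \<longleftrightarrow> maps v t x y \<or> E v x n \<and> E v y k"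
    using ex_append t(2) k by blast
  then consider "M w t' x" | "\<forall>\<^sub>F v in nhds w. \<not> M v t' x" using sharpD x fsI by blast
  then show ?thesis
  proof cases
    case 1
    moreover have "maps w t' n k" using boxD[OF t'(3)] E_refl by blast
    ultimately show ?thesis by blast
  next
    case 2
    have "\<forall>\<^sub>F v in nhds w. \<not> (\<exists>r. M v r x \<and> maps v r n k)"
    proof (rule boxI[where H = "\<lambda>v. ideal v x \<and> M v t x \<and> sq v t' m \<and>
        (\<forall>\<^sub>F v in nhds v. \<forall>x y. maps v t' x y \<longleftrightarrow> maps v t x y \<or> E v x n \<and> E v y k) \<and>
        (\<forall>\<^sub>F v in nhds v. \<not> M v t' x)"], goal_cases _ _ near)
      case (near v)
      show ?case
      proof
        assume "\<exists>r. M v r x \<and> maps v r n k"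
        then obtain r where r: "M v r x" "maps v r n k" by blast
        then obtain q where q: "M v q x" "sub v t q" "sub v r q"
          using near ideal_directed by blast
        then have "sub v t' q" using append_sub fsI near sub_maps r by blast
        then have "M v t' x" using ideal_lower near q fsI by blast
        moreover have "\<not> M v t' x" using near by (blast dest: boxD)
        ultimately show False by contradiction
      qed
    qed (use x t t' 2 in \<open>simp_all add: opens\<close>)
    then show ?thesis ..
  qed
qed

text \<open>A common extension of \<open>t\<close> and \<open>r\<close> in \<open>x\<close> extends
  \<open>t\<close> and has the value \<open>k\<close> at \<open>n\<close>, so \<open>t\<close>
  followed by \<open>k\<close> is a prefix of it.\<close>

lemma ex_longer:
  assumes x: "ideal w x" and t: "M w t x" "sq w t n" and r: "M w r x" "maps w r n k"
    and m: "succ w m n"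
  shows "\<exists>t'. M w t' x \<and> sq w t' m"
proof -
  have "B w k" using sq_sort r ideal_fs x unfolding finseq_def by blast
  then obtain t' where t': "sq w t' m" 
    "\<forall>\<^sub>F v in nhds w. \<forall>x y. maps v t' x y \<longleftrightarrow> maps v t x y \<or> E v x n \<and> E v y k"
    using ex_append t(2) m by blast
  obtain q where q: "M w q x" "sub w t q" "sub w r q"
    using x t r ideal_directed by blast
  then have "sub w t' q" using append_sub fsI t' sub_maps r by blast
  then show ?thesis using ideal_lower q t' x fsI by blast
qed

text \<open>Given \<open>s\<close> outside \<open>x\<close>, take \<open>t\<close> in
  \<open>x\<close> of the same length. If \<open>s\<close> were a prefix of \<open>t\<close>, it
  would lie in \<open>x\<close>; if \<open>t\<close> were a prefix of \<open>s\<close>, equal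
  lengths would make \<open>s\<close> a prefix of \<open>t\<close>.\<close>

lemma smax_if_all_lengths:
  assumes x: "ideal w x" "sharp w x"
    and len: "\<forall>\<^sub>F v in nhds w. \<forall>n. isnat v n \<longrightarrow> (\<exists>t. M v t x \<and> sq v t n)"
  shows "smax w x"
proof (rule smaxI[OF x(1)], rule boxI[where H = "\<lambda>v. ideal v x \<and> sharp v x \<and>
    (\<forall>\<^sub>F v in nhds v. \<forall>n. isnat v n \<longrightarrow> (\<exists>t. M v t x \<and> sq v t n))"], goal_cases _ _ near)
  case (near v)
  then have len: "\<exists>t. M v t x \<and> sq v t n" if "isnat v n" for n
    using that by (blast dest: boxD)
  show ?case
  proof (intro allI impI)
    fix s
    assume s: "fs v s"
    then obtain n where n: "sq v s n" unfolding finseq_def by blast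
    then obtain t where t: "M v t x" "sq v t n" using len sq_isnat by blast
    consider "M v s x" | "\<forall>\<^sub>F v in nhds v. \<not> M v s x" using sharpD near s by blast
    then show "M v s x \<or>
      (\<exists>t. M v t x \<and> (\<forall>\<^sub>F v in nhds v. \<not> sub v s t) \<and> (\<forall>\<^sub>F v in nhds v. \<not> sub v t s))"
    proof cases
      case 2
      define K where "K v \<longleftrightarrow> ideal v x \<and> sq v s n \<and> M v t x \<and> sq v t n \<and>
        (\<forall>\<^sub>F v in nhds v. \<not> M v s x)" for v
      have K: "open {v. K v}" "K v" unfolding K_def using near n t 2 by (simp_all add: opens)
      have not1: "\<not> sub v s t" if "K v" for v
      proof
        assume "sub v s t"
        then have "M v s x" using that ideal_lower fsI unfolding K_def by blast
        then show False using that unfolding K_def by (blast dest: boxD)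
      qed
      have not2: "\<not> sub v t s" if "K v" for v
      proof
        assume "sub v t s"
        then have "sub v s t"
          using that sq_sub_if_shorter[OF _ _ _ sub_refl] E_refl fsI unfolding K_def by blast
        then show False using not1 that by blast
      qed
      have "\<forall>\<^sub>F v in nhds v. \<not> sub v s t" by (rule boxI[OF K]) (rule not1)
      moreover have "\<forall>\<^sub>F v in nhds v. \<not> sub v t s" by (rule boxI[OF K]) (rule not2)
      ultimately show ?thesis using t by blast
    qed blast
  qed
qed (use assms in \<open>simp_all add: opens\<close>)

text \<open>Induction on the length. The open predicate \<open>H\<close> carries an extra assumption
  along, namely Markov's Principle in the Baire domain.\<close>

lemma smax_if_extendable:
  assumes x: "ideal w x" "sharp w x" "maxi w x" and H: "open {v. H v}" "H w"
    and step: "\<And>v t n. H v \<Longrightarrow> ideal v x \<Longrightarrow> sharp v x \<Longrightarrow> maxi v x \<Longrightarrow> M v t x \<Longrightarrow> sq v t n \<Longrightarrow>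
      \<exists>r k. M v r x \<and> maps v r n k"
  shows "smax w x"
proof (rule smax_if_all_lengths[OF x(1,2)])
  let ?K = "\<lambda>v. H v \<and> ideal v x \<and> sharp v x \<and> maxi v x"
  have K: "open {v. ?K v}" "?K w" using x H by (simp_all add: opens)
  have len: "\<exists>t. M v t x \<and> sq v t n" if "?K v" "isnat v n" for v n
    using that(2)
  proof (rule nat_induct[where H = ?K])
    show "definable (\<lambda>w n. \<exists>t. M w t x \<and> sq w t n)"
      unfolding seqn_def
      by (rule definableI[where s = "[x]" and
          F = "\<^bold>\<exists>t. t \<^bold>\<in> 0 \<^bold>\<and> is_nat 1 \<^bold>\<and> is_function t (\<lambda>i. i \<^bold>\<in> 1) A"]) simp
  next
    fix v z
    assume v: "?K v" and "empty v z"
    then obtain s where s: "sq v s z" "\<And>t. sub v s t" using ex_nil by blast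
    moreover obtain t where "M v t x" using v ideal_inhabited by blast
    ultimately have "M v s x" using v ideal_lower fsI by blast
    then show "\<exists>t. M v t x \<and> sq v t z" using s by blast
  next
    fix v n m
    assume v: "?K v" and t: "\<exists>t. M v t x \<and> sq v t n" and m: "succ v m n"
    then show "\<exists>t. M v t x \<and> sq v t m" using step ex_longer by meson
  qed (use K that in simp_all)
  show "\<forall>\<^sub>F v in nhds w. \<forall>n. isnat v n \<longrightarrow> (\<exists>t. M v t x \<and> sq v t n)"
    by (rule boxI[OF K]) (use len in blast)
qed

end

context izf_model
begin

section \<open>The Cantor domain\<close>

lemma isone_unique: "isone w a \<Longrightarrow> isone w b \<Longrightarrow> E w a b"
  unfolding isone_def using empty_unique succ_cong[OF E_refl] succ_unique by blast

lemma isone_not_empty: "isone w a \<Longrightarrow> \<not> empty w a"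
  unfolding isone_def using succD emptyD E_refl by blast

lemma ex_isone: "\<exists>a. isone w a"
  unfolding isone_def using ex_empty ex_succ isnat_zero by blast

interpretation cantor: seq_domain M E is_bit isbit
  by unfold_locales (use isbit_isnat ex_isone isbit_def in \<open>simp, blast, blast\<close>)

lemma cantor_smax_iff:
  assumes "cantor.ideal w x"
  shows "cantor.smax w x \<longleftrightarrow> cantor.sharp w x \<and> cantor.maxi w x"
proof
  assume "cantor.smax w x"
  then show "cantor.sharp w x \<and> cantor.maxi w x"
    using assms cantor.smax_imp_sharp cantor.smax_imp_maxi by blast
next
  assume x: "cantor.sharp w x \<and> cantor.maxi w x"
  show "cantor.smax w x"
  proof (rule cantor.smax_if_extendable[where H = "\<lambda>_. True"])
    fix v t n
    assume v: "cantor.ideal v x" "cantor.sharp v x" "cantor.maxi v x" "M v t x" "cantor.sq v t n"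
    obtain a where a: "empty v a" using ex_empty by blast
    obtain b where b: "isone v b" using ex_isone by blast
    have dec: "(\<exists>r. M v r x \<and> maps v r n k) \<or> (\<forall>\<^sub>F v in nhds v. \<not> (\<exists>r. M v r x \<and> maps v r n k))"
      if "isbit v k" for k
      using cantor.sharp_value_decidable[OF v(1,2,4,5) that] .
    show "\<exists>r k. M v r x \<and> maps v r n k"
    proof (rule ccontr)
      assume none: "\<not> (\<exists>r k. M v r x \<and> maps v r n k)"
      \<comment> \<open>Absence at the point becomes absence near it, for either bit; on the
        intersection of the two neighbourhoods no entry at \<open>n\<close> is left.\<close>
      then have ab: "\<forall>\<^sub>F v in nhds v. \<not> (\<exists>r. M v r x \<and> maps v r n a)"
        "\<forall>\<^sub>F v in nhds v. \<not> (\<exists>r. M v r x \<and> maps v r n b)"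
        using dec[of a] dec[of b] a b unfolding isbit_def by blast+
      have "\<forall>\<^sub>F v in nhds v. \<forall>r k. M v r x \<longrightarrow> \<not> maps v r n k"
      proof (rule boxI[where H = "\<lambda>v. empty v a \<and> isone v b \<and> cantor.ideal v x \<and>
          (\<forall>\<^sub>F v in nhds v. \<not> (\<exists>r. M v r x \<and> maps v r n a)) \<and>
          (\<forall>\<^sub>F v in nhds v. \<not> (\<exists>r. M v r x \<and> maps v r n b))"], goal_cases _ _ near)
        case (near v)
        then have none: "\<not> (M v r x \<and> maps v r n a)" "\<not> (M v r x \<and> maps v r n b)" for r
          by (blast dest: boxD)+
        show ?case
        proof (intro allI impI notI)
          fix r k
          assume r: "M v r x" and k: "maps v r n k"
          then have "isbit v k"
            using cantor.sq_sort cantor.ideal_fs near unfolding finseq_def by blast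
          then have "E v k a \<or> E v k b"
            using near empty_unique isone_unique unfolding isbit_def by blast
          then show False using none r maps_cong[OF E_refl E_refl _ k] by blast
        qed
      qed (use a b ab v in \<open>simp_all add: opens\<close>)
      then show False using cantor.maxi_not_bounded v by blast
    qed
  qed (use assms x in simp_all)
qed

section \<open>The Baire domain\<close>

definition markov where
  "markov w \<longleftrightarrow> (\<forall>\<^sub>F v in nhds w. \<forall>f. func v f isnat isbit \<and>
    (\<forall>\<^sub>F v in nhds v. \<not> (\<forall>\<^sub>F v in nhds v. \<forall>n. isnat v n \<longrightarrow> (\<exists>z. empty v z \<and> maps v f n z))) \<longrightarrow>
    (\<exists>k. isnat v k \<and> (\<exists>u. isone v u \<and> maps v f k u)))"

lemma open_markov [opens]: "open {w. markov w}"
  unfolding markov_def by (simp add: opens)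

lemma holds_bitseq [simp]:
  "f < length s \<Longrightarrow> holds e w s (is_function f is_nat is_bit) \<longleftrightarrow> func w (s ! f) isnat isbit"
  by (rule holds_function) simp_all

lemma holds_markov [simp]: "holds e w s markovs_principle \<longleftrightarrow> markov w"
  by (simp add: markovs_principle_def markov_def nth_append)

interpretation baire: seq_domain M E is_nat isnat
  by unfold_locales (use ex_empty isnat_zero in \<open>simp, blast, blast\<close>)

text \<open>By \<open>sharp_value_decidable\<close> there is a function that is 1 at
  \<open>k\<close> exactly if some element of \<open>x\<close> has the value \<open>k\<close> at
  position \<open>n\<close>. By \<open>maxi_not_bounded\<close> it is not constantly 0, so Markov's
  Principle finds an entry at \<open>n\<close>.\<close>

lemma baire_smax_if_markov:
  assumes x: "baire.ideal w x" "baire.sharp w x" "baire.maxi w x" and markov: "markov w"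
  shows "baire.smax w x"
  using x
proof (rule baire.smax_if_extendable[where H = markov])
  fix v t n
  assume v: "markov v" "baire.ideal v x" "baire.sharp v x" "baire.maxi v x" "M v t x" "baire.sq v t n"
  define Q where "Q v k \<longleftrightarrow> (\<exists>r. M v r x \<and> maps v r n k)" for v k
  define R where "R v k y \<longleftrightarrow>
    isnat v k \<and> (isone v y \<and> Q v k \<or> empty v y \<and> (\<forall>\<^sub>F v in nhds v. \<not> Q v k))" for v k y
  have definable: "definable (\<lambda>w p. \<exists>k y. R w k y \<and> opair w p k y)"
    unfolding R_def Q_def
    by (rule definableI[where s = "[x, n]" and F = "\<^bold>\<exists>k. \<^bold>\<exists>y. (is_nat k \<^bold>\<and>
      (is_one y \<^bold>\<and> (\<^bold>\<exists>r. r \<^bold>\<in> 0 \<^bold>\<and> maps_to r 1 k) \<^bold>\<or>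
       is_empty y \<^bold>\<and> \<^bold>\<not> (\<^bold>\<exists>r. r \<^bold>\<in> 0 \<^bold>\<and> maps_to r 1 k))) \<^bold>\<and> is_opair 2 k y"]) simp
  have "definable Q"
    unfolding Q_def
    by (rule definableI[where s = "[x, n]" and F = "\<^bold>\<exists>r. r \<^bold>\<in> 0 \<^bold>\<and> maps_to r 1 2"]) simp
  then have Q_cong: "E v k k' \<Longrightarrow> Q v k \<Longrightarrow> Q v k'" for v k k'
    by (rule definable_cong)
  have "definable (\<lambda>v k. \<forall>\<^sub>F v in nhds v. \<not> Q v k)"
    unfolding Q_def
    by (rule definableI[where s = "[x, n]" and F = "\<^bold>\<not> (\<^bold>\<exists>r. r \<^bold>\<in> 0 \<^bold>\<and> maps_to r 1 2)"]) simp
  then have nQ_cong: "E v k k' \<Longrightarrow> \<forall>\<^sub>F v in nhds v. \<not> Q v k \<Longrightarrow> \<forall>\<^sub>F v in nhds v. \<not> Q v k'" for v k k'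
    by (rule definable_cong)
  have "\<exists>f. func v f isnat isbit \<and> (\<forall>\<^sub>F v in nhds v. \<forall>k y. maps v f k y \<longleftrightarrow> R v k y)"
  proof (rule ex_function[where H = "\<lambda>v. baire.ideal v x \<and> baire.sharp v x \<and> M v t x \<and> baire.sq v t n",
        OF definable])
    fix v k y k' y'
    assume R: "R v k y" and k: "E v k k'" and y: "E v y y'"
    show "R v k' y'"
      using R Q_cong[OF k] nQ_cong[OF k] isnat_cong[OF k] isone_cong[OF y] empty_cong[OF y]
      unfolding R_def by blast
  next
    fix v k y
    assume "R v k y"
    then have "isnat v k \<and> isbit v y" unfolding R_def isbit_def by blast
    then show "isnat v k \<and> isbit v y \<and> isnat v k \<and> isnat v y" using isbit_isnat by blast
  next
    fix v k
    assume v: "baire.ideal v x \<and> baire.sharp v x \<and> M v t x \<and> baire.sq v t n" and k: "isnat v k"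
    then have "Q v k \<or> (\<forall>\<^sub>F v in nhds v. \<not> Q v k)"
      unfolding Q_def using baire.sharp_value_decidable by blast
    then show "\<exists>y. R v k y" unfolding R_def using k ex_isone ex_empty by blast
  next
    fix v k y z
    assume "R v k y" "R v k z"
    moreover have "\<not> (Q v k \<and> (\<forall>\<^sub>F v in nhds v. \<not> Q v k))" by (blast dest: boxD)
    ultimately show "E v y z" unfolding R_def using isone_unique empty_unique by blast
  qed (use v in \<open>simp_all add: opens\<close>)
  then obtain f where f: "func v f isnat isbit"
    "\<forall>\<^sub>F v in nhds v. \<forall>k y. maps v f k y \<longleftrightarrow> R v k y" by blast
  have "\<forall>\<^sub>F v in nhds v. \<not> (\<forall>\<^sub>F v in nhds v. \<forall>n. isnat v n \<longrightarrow> (\<exists>z. empty v z \<and> maps v f n z))"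
  proof (rule boxI[where H = "\<lambda>v. baire.ideal v x \<and> baire.maxi v x \<and> M v t x \<and> baire.sq v t n \<and>
      (\<forall>\<^sub>F v in nhds v. \<forall>k y. maps v f k y \<longleftrightarrow> R v k y)"], goal_cases _ _ near)
    case (near v)
    show ?case
    proof
      assume zero: "\<forall>\<^sub>F v in nhds v. \<forall>n. isnat v n \<longrightarrow> (\<exists>z. empty v z \<and> maps v f n z)"
      have "\<forall>\<^sub>F v in nhds v. \<forall>r k. M v r x \<longrightarrow> \<not> maps v r n k"
      proof (rule boxI[where H = "\<lambda>v. baire.ideal v x \<and>
          (\<forall>\<^sub>F v in nhds v. \<forall>n. isnat v n \<longrightarrow> (\<exists>z. empty v z \<and> maps v f n z)) \<and>
          (\<forall>\<^sub>F v in nhds v. \<forall>k y. maps v f k y \<longleftrightarrow> R v k y)"], goal_cases _ _ near')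
        case (near' v)
        show ?case
        proof (intro allI impI notI)
          fix r k
          assume r: "M v r x" and k: "maps v r n k"
          then have "isnat v k"
            using baire.sq_sort baire.ideal_fs near' unfolding finseq_def by blast
          then obtain z where z: "empty v z" "maps v f k z" using near' by (blast dest: boxD)
          then have "R v k z" using near' by (blast dest: boxD)
          then have "\<forall>\<^sub>F v in nhds v. \<not> Q v k"
            unfolding R_def using isone_not_empty z by blast
          then have "\<not> Q v k" by (rule boxD)
          then show False using r k unfolding Q_def by blast
        qed
      qed (use near zero in \<open>simp_all add: opens\<close>)
      then show False using baire.maxi_not_bounded near by blast
    qed
  qed (use v f in \<open>simp_all add: opens\<close>)
  then obtain k u where "isone v u" "maps v f k u"
    using boxD[OF v(1)[unfolded markov_def]] f(1) by blast
  then have "Q v k" using boxD[OF f(2)] isone_not_empty unfolding R_def by blast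
  then show "\<exists>r k. M v r x \<and> maps v r n k" unfolding Q_def by blast
qed (use markov in \<open>simp_all add: opens\<close>)

section \<open>The least argument with value 1\<close>

text \<open>A relation with at most one solution \<open>k\<close>, whose existence may not be
  assumed: obtaining it from the mere failure of being constantly 0 is the content of Markov's
  Principle.\<close>

definition least_one where
  "least_one w f k \<longleftrightarrow> isnat w k \<and> (\<exists>u. isone w u \<and> maps w f k u) \<and>
    (\<forall>\<^sub>F v in nhds w. \<forall>j. M v j k \<longrightarrow> (\<exists>z. empty v z \<and> maps v f j z))"

abbreviation least_one_form :: "var \<Rightarrow> var \<Rightarrow> form" where
  "least_one_form f k \<equiv> is_nat k \<^bold>\<and> (\<^bold>\<exists>u. is_one u \<^bold>\<and> maps_to f k u) \<^bold>\<and>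
    (\<^bold>\<forall>j. j \<^bold>\<in> k \<^bold>\<longrightarrow> (\<^bold>\<exists>z. is_empty z \<^bold>\<and> maps_to f j z))"

lemma open_least_one [opens]: "open {w. least_one w f k}"
  unfolding least_one_def by (simp add: opens)

lemma least_one_cong: "E w k k' \<Longrightarrow> least_one w f k \<Longrightarrow> least_one w f k'"
  by (rule definable_cong[of "\<lambda>w. least_one w f"], unfold least_one_def)
    (rule definableI[where s = "[f]" and F = "least_one_form 0 1"], simp_all)

lemma bitseq_cases:
  assumes "func w f isnat isbit" "isnat w k"
  obtains z where "empty w z" "maps w f k z" | u where "isone w u" "maps w f k u"
proof -
  obtain y where y: "maps w f k y" using func_total[of w f isnat isbit] assms by blast
  then have "isbit w y"
    using func_sort[of w f isnat isbit] assms isnat_cong isbit_cong by blast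
  then show thesis using y that unfolding isbit_def by blast
qed

lemma bitseq_disjoint:
  assumes "func w f isnat isbit" "isone w u" "maps w f k u" "empty w z" "maps w f k z"
  shows False
proof -
  have "E w u z" using assms func_single by blast
  then show False using assms isone_not_empty empty_cong E_sym by blast
qed

lemma least_one_unique:
  assumes f: "func w f isnat isbit" and k: "least_one w f k" and l: "least_one w f l"
  shows "E w k l"
proof -
  have *: "\<not> M w k l" if k: "least_one w f k" and l: "least_one w f l" for k l
  proof
    assume "M w k l"
    then obtain z where z: "empty w z" "maps w f k z"
      using l unfolding least_one_def by (blast dest: boxD)
    obtain u where "isone w u" "maps w f k u" using k unfolding least_one_def by blast
    then show False using bitseq_disjoint f z by blast
  qed
  have "isnat w k" "isnat w l" using k l unfolding least_one_def by blast+
  then show ?thesis using nat_trichotomy *[OF k l] *[OF l k] by blast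
qed

text \<open>Bounded search, by induction on \<open>k\<close>: at a successor only the value of
  \<open>f\<close> at \<open>k\<close> has to be inspected, and a 1 there is the least if none was
  found before.\<close>

lemma least_one_search:
  assumes "func w f isnat isbit" "isnat w k"
  shows "(\<forall>\<^sub>F v in nhds w. \<forall>j. M v j k \<longrightarrow> (\<exists>z. empty v z \<and> maps v f j z)) \<or> (\<exists>l. least_one w f l \<and> M w l k)"
  using assms(2)
proof (rule nat_induct[where H = "\<lambda>v. func v f isnat isbit"])
  show "definable (\<lambda>w k. (\<forall>\<^sub>F v in nhds w. \<forall>j. M v j k \<longrightarrow> (\<exists>z. empty v z \<and> maps v f j z)) \<or>
      (\<exists>l. least_one w f l \<and> M w l k))"
    unfolding least_one_def
    by (rule definableI[where s = "[f]" and F = "(\<^bold>\<forall>j. j \<^bold>\<in> 1 \<^bold>\<longrightarrow> (\<^bold>\<exists>z. is_empty z \<^bold>\<and> maps_to 0 j z)) \<^bold>\<or>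
        (\<^bold>\<exists>l. least_one_form 0 l \<^bold>\<and> l \<^bold>\<in> 1)"]) simp
next
  fix v k
  assume "empty v k"
  then have "\<forall>\<^sub>F v in nhds v. \<forall>j. M v j k \<longrightarrow> (\<exists>z. empty v z \<and> maps v f j z)"
    unfolding empty_def by (rule eventually_mono) blast
  then show "(\<forall>\<^sub>F v in nhds v. \<forall>j. M v j k \<longrightarrow> (\<exists>z. empty v z \<and> maps v f j z)) \<or>
    (\<exists>l. least_one v f l \<and> M v l k)" ..
next
  fix v k m
  assume f: "func v f isnat isbit" and k: "isnat v k" and m: "succ v m k"
    and IH: "(\<forall>\<^sub>F v in nhds v. \<forall>j. M v j k \<longrightarrow> (\<exists>z. empty v z \<and> maps v f j z)) \<or>
      (\<exists>l. least_one v f l \<and> M v l k)"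
  show "(\<forall>\<^sub>F v in nhds v. \<forall>j. M v j m \<longrightarrow> (\<exists>z. empty v z \<and> maps v f j z)) \<or>
    (\<exists>l. least_one v f l \<and> M v l m)"
  proof (cases "\<exists>l. least_one v f l \<and> M v l k")
    case True
    then show ?thesis using succD[OF m] by blast
  next
    case False
    with IH have zero: "\<forall>\<^sub>F v in nhds v. \<forall>j. M v j k \<longrightarrow> (\<exists>z. empty v z \<and> maps v f j z)" by blast
    from f k show ?thesis
    proof (cases rule: bitseq_cases)
      case (1 z)
      have "\<forall>\<^sub>F v in nhds v. \<forall>j. M v j m \<longrightarrow> (\<exists>z. empty v z \<and> maps v f j z)"
      proof (rule boxI[where H = "\<lambda>v. empty v z \<and> maps v f k z \<and> succ v m k \<and>
          (\<forall>\<^sub>F v in nhds v. \<forall>j. M v j k \<longrightarrow> (\<exists>z. empty v z \<and> maps v f j z))"], goal_cases _ _ near)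
        case (near v)
        then have "\<forall>j. M v j k \<longrightarrow> (\<exists>z. empty v z \<and> maps v f j z)" by (blast dest: boxD)
        moreover have "maps v f j z" if "E v j k" for j
          using near maps_cong[OF E_refl E_sym[OF that] E_refl] by blast
        ultimately show ?case using near succD by blast
      qed (use 1 m zero in \<open>simp_all add: opens\<close>)
      then show ?thesis ..
    next
      case (2 u)
      then have "least_one v f k" unfolding least_one_def using k zero by blast
      then show ?thesis using succD[OF m] E_refl by blast
    qed
  qed
qed (use assms in \<open>simp_all add: opens\<close>)

lemma ex_least_one:
  assumes "func w f isnat isbit" "isnat w k" "isone w u" "maps w f k u"
  shows "\<exists>l. least_one w f l"
  using least_one_search[OF assms(1,2)] assms unfolding least_one_def by blast

text \<open>The value 0 at \<open>k\<close> refutes. For the value 1, bounded search below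
  \<open>k\<close> tells whether there is an earlier 1.\<close>

lemma least_one_decidable:
  assumes f: "func w f isnat isbit" and k: "isnat w k"
  shows "least_one w f k \<or> (\<forall>\<^sub>F v in nhds w. \<not> least_one v f k)"
  using f k
proof (cases rule: bitseq_cases)
  case (1 z)
  have "\<forall>\<^sub>F v in nhds w. \<not> least_one v f k"
  proof (rule boxI[where H = "\<lambda>v. func v f isnat isbit \<and> empty v z \<and> maps v f k z"])
    fix v
    assume "func v f isnat isbit \<and> empty v z \<and> maps v f k z"
    then show "\<not> least_one v f k" using bitseq_disjoint unfolding least_one_def by blast
  qed (use 1 f in \<open>simp_all add: opens\<close>)
  then show ?thesis ..
next
  case (2 u)
  show ?thesis
  proof (cases "\<exists>l. least_one w f l \<and> M w l k")
    case True
    then obtain l where l: "least_one w f l" "M w l k" by blast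
    have "\<forall>\<^sub>F v in nhds w. \<not> least_one v f k"
    proof (rule boxI[where H = "\<lambda>v. func v f isnat isbit \<and> isnat v k \<and> least_one v f l \<and> M v l k"])
      fix v
      assume v: "func v f isnat isbit \<and> isnat v k \<and> least_one v f l \<and> M v l k"
      then show "\<not> least_one v f k"
        using least_one_unique M_congL nat_mem_irrefl by blast
    qed (use l f k in \<open>simp_all add: opens\<close>)
    then show ?thesis ..
  next
    case False
    then show ?thesis using least_one_search[OF f k] 2 k unfolding least_one_def by blast
  qed
qed

text \<open>
  Markov's Principle is read off the ideal of the sequences all of whose entries are the least argument
  at which \<open>f\<close> is \<open>1\<close>: it is sharp because having only such entries is decidable.
\<close>

definition constant_least where
  "constant_least w f s \<longleftrightarrow> (\<forall>\<^sub>F v in nhds w. \<forall>i m. maps v s i m \<longrightarrow> least_one v f m)"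

definition detector where
  "detector w f x \<longleftrightarrow> (\<forall>\<^sub>F v in nhds w. \<forall>s. M v s x \<longleftrightarrow> baire.fs v s \<and> constant_least v f s)"

lemma open_detector [opens]: "open {w. constant_least w f s}" "open {w. detector w f x}"
  unfolding constant_least_def detector_def by (simp_all add: opens)

lemma detectorD: "detector w f x \<Longrightarrow> M w s x \<longleftrightarrow> baire.fs w s \<and> constant_least w f s"
  unfolding detector_def by (blast dest: boxD)

lemma constant_leastD: "constant_least w f s \<Longrightarrow> maps w s i m \<Longrightarrow> least_one w f m"
  unfolding constant_least_def by (blast dest: boxD)

lemma ex_detector: "\<exists>x. detector w f x"
proof -
  obtain S where S: "\<forall>\<^sub>F v in nhds w. \<forall>s. baire.fs v s \<longrightarrow> M v s S" using baire.ex_seqs by blast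
  have "definable (\<lambda>w s. baire.fs w s \<and> constant_least w f s)"
    unfolding constant_least_def least_one_def
    by (rule definableI[where s = "[f]" and F = "is_finseq is_nat 1 \<^bold>\<and>
        (\<^bold>\<forall>i. \<^bold>\<forall>m. maps_to 1 i m \<^bold>\<longrightarrow> least_one_form 0 m)"]) simp
  then obtain x where
    "\<forall>\<^sub>F v in nhds w. \<forall>s. M v s x \<longleftrightarrow> M v s S \<and> baire.fs v s \<and> constant_least v f s"
    using separation by blast
  with S have "\<forall>\<^sub>F v in nhds w. \<forall>s. M v s x \<longleftrightarrow> baire.fs v s \<and> constant_least v f s"
    by (rule eventually_elim2) blast
  then show ?thesis unfolding detector_def by blast
qed

text \<open>All entries agree by uniqueness of the least argument, so of two elements the shorter is
  a prefix of the longer, even if no entry is known to exist. The empty sequence inhabits the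
  ideal.\<close>

lemma detector_ideal:
  assumes f: "func w f isnat isbit" and x: "detector w f x"
  shows "baire.ideal w x"
proof -
  define K where "K v \<longleftrightarrow> func v f isnat isbit \<and> detector v f x" for v
  have K: "open {v. K v}" "K w" unfolding K_def using f x by (simp_all add: opens)
  have Kx: "M v s x \<longleftrightarrow> baire.fs v s \<and> constant_least v f s" if "K v" for v s
    using that detectorD unfolding K_def by blast
  have shorter: "sub v s t"
    if "K v" "M v s x" "M v t x" "baire.sq v s n" "baire.sq v t m" "M v n m \<or> E v n m" for v s t n m
  proof (rule baire.fs_subI[where H = "\<lambda>v. K v \<and> M v s x \<and> M v t x \<and> baire.sq v s n \<and>
      baire.sq v t m \<and> (M v n m \<or> E v n m)"])
    show "baire.fs v s" using that Kx by blast
    fix v i a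
    assume v: "K v \<and> M v s x \<and> M v t x \<and> baire.sq v s n \<and> baire.sq v t m \<and> (M v n m \<or> E v n m)"
      and a: "maps v s i a"
    then have "M v i n" using baire.sq_sort by blast
    then have "M v i m" using v nat_mem_trans baire.sq_isnat M_congR by blast
    then obtain b where b: "maps v t i b" using v baire.sq_total by blast
    then have "E v b a"
      using v a Kx constant_leastD least_one_unique unfolding K_def by blast
    then show "maps v t i a" using b maps_cong[OF E_refl E_refl] by blast
  qed (use that K in \<open>simp_all add: opens\<close>)
  show ?thesis
    unfolding baire.ideal_def
  proof (intro conjI)
    show "\<forall>\<^sub>F v in nhds w. \<forall>s. M v s x \<longrightarrow> baire.fs v s"
      by (rule boxI[OF K]) (use Kx in blast)
    obtain z where z: "empty w z" using ex_empty by blast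
    then obtain s where s: "baire.sq w s z" using baire.ex_nil by blast
    have "constant_least w f s"
      unfolding constant_least_def
    proof (rule boxI[where H = "\<lambda>v. empty v z \<and> baire.sq v s z"])
      fix v
      assume "empty v z \<and> baire.sq v s z"
      then show "\<forall>i m. maps v s i m \<longrightarrow> least_one v f m" using baire.sq_sort emptyD by blast
    qed (use s z in \<open>simp_all add: opens\<close>)
    then show "\<exists>s. M w s x" using Kx[OF K(2)] s baire.fsI by blast
    show "\<forall>\<^sub>F v in nhds w. \<forall>s t. M v s x \<and> M v t x \<longrightarrow> (\<exists>r. M v r x \<and> sub v s r \<and> sub v t r)"
    proof (rule boxI[OF K], intro allI impI)
      fix v s t
      assume v: "K v" and st: "M v s x \<and> M v t x"
      then obtain n m where nm: "baire.sq v s n" "baire.sq v t m"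
        using Kx unfolding finseq_def by blast
      then consider "M v n m \<or> E v n m" | "M v m n \<or> E v m n"
        using nat_trichotomy baire.sq_isnat by blast
      then have "sub v s t \<or> sub v t s" using shorter v st nm by cases blast+
      then show "\<exists>r. M v r x \<and> sub v s r \<and> sub v t r" using st sub_refl by blast
    qed
    show "\<forall>\<^sub>F v in nhds w. \<forall>s t. M v s x \<and> baire.fs v t \<and> sub v t s \<longrightarrow> M v t x"
    proof (rule boxI[OF K], intro allI impI)
      fix v s t
      assume v: "K v" and st: "M v s x \<and> baire.fs v t \<and> sub v t s"
      have "constant_least v f t"
        unfolding constant_least_def
      proof (rule boxI[where H = "\<lambda>v. constant_least v f s \<and> sub v t s"])
        fix u
        assume "constant_least u f s \<and> sub u t s"
        then show "\<forall>i m. maps u t i m \<longrightarrow> least_one u f m" using sub_maps constant_leastD by blast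
      qed (use Kx[OF v] st in \<open>simp_all add: opens\<close>)
      then show "M v t x" using Kx[OF v] st by blast
    qed
  qed
qed

text \<open>A sequence has finitely many entries, each decided by
  \<open>least_one_decidable\<close>. The induction runs over all \<open>k\<close> and inspects the
  entries before \<open>k\<close>; positions from the length \<open>n\<close> on contribute
  nothing.\<close>

lemma constant_least_decidable:
  assumes f: "func w f isnat isbit" and s: "baire.fs w s"
  shows "constant_least w f s \<or> (\<forall>\<^sub>F v in nhds w. \<not> constant_least v f s)"
proof -
  obtain n where n: "baire.sq w s n" using s unfolding finseq_def by blast
  let ?all = "\<lambda>v k. \<forall>\<^sub>F v in nhds v. \<forall>i m. M v i k \<and> maps v s i m \<longrightarrow> least_one v f m"
  let ?ex = "\<lambda>v. \<exists>i m. maps v s i m \<and> (\<forall>\<^sub>F v in nhds v. \<not> least_one v f m)"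
  have "?all w n \<or> ?ex w"
  proof (rule nat_induct[where Q = "\<lambda>v k. ?all v k \<or> ?ex v" and
        H = "\<lambda>v. func v f isnat isbit \<and> baire.sq v s n"])
    show "isnat w n" using n baire.sq_isnat by blast
    show "definable (\<lambda>w n. ?all w n \<or> ?ex w)"
      unfolding least_one_def
      by (rule definableI[where s = "[f, s]" and F = "
          (\<^bold>\<forall>i. \<^bold>\<forall>m. i \<^bold>\<in> 2 \<^bold>\<and> maps_to 1 i m \<^bold>\<longrightarrow> least_one_form 0 m) \<^bold>\<or>
          (\<^bold>\<exists>i. \<^bold>\<exists>m. maps_to 1 i m \<^bold>\<and> \<^bold>\<not> (least_one_form 0 m))"]) simp
  next
    fix v z
    assume "empty v z"
    then have "?all v z" unfolding empty_def by (rule eventually_mono) blast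
    then show "?all v z \<or> ?ex v" ..
  next
    fix v k y
    assume v: "func v f isnat isbit \<and> baire.sq v s n" and k: "isnat v k"
      and IH: "?all v k \<or> ?ex v" and y: "succ v y k"
    show "?all v y \<or> ?ex v"
    proof (cases "?ex v")
      case False
      with IH have all: "?all v k" by blast
      have n: "isnat v n" using v baire.sq_isnat by blast
      then consider "M v k n" | "E v k n \<or> M v n k" using nat_trichotomy k by blast
      then have "?all v y"
      proof cases
        case 1
        then obtain m where m: "maps v s k m" using baire.sq_total v by blast
        then have "isnat v m" using baire.sq_sort v by blast
        \<comment> \<open>Were the entry \<open>m\<close> refuted near the point, it would witness
          \<open>?ex\<close>, which fails here.\<close>
        then have "least_one v f m" using least_one_decidable v m False by blast
        show ?thesis
        proof (rule boxI[where H = "\<lambda>v. succ v y k \<and> least_one v f m \<and> maps v s k m \<and> baire.sq v s n \<and> ?all v k"],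
            goal_cases _ _ near)
          case (near v)
          show ?case
          proof (intro allI impI)
            fix i l
            assume il: "M v i y \<and> maps v s i l"
            then consider "M v i k" | "E v i k" using succD near by blast
            then show "least_one v f l"
            proof cases
              case 1
              then show ?thesis using near il by (blast dest: boxD)
            next
              case 2
              then have "maps v s k l" using il maps_cong[OF E_refl _ E_refl] by blast
              then have "E v m l" using near baire.sq_single by blast
              then show ?thesis using near least_one_cong by blast
            qed
          qed
        qed (use y \<open>least_one v f m\<close> m v all in \<open>simp_all add: opens\<close>)
      next
        case 2
        show ?thesis
        proof (rule boxI[where H = "\<lambda>v. succ v y k \<and> isnat v k \<and> isnat v n \<and>
            (E v k n \<or> M v n k) \<and> baire.sq v s n \<and> ?all v k"], goal_cases _ _ near)
          case (near v)
          show ?case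
          proof (intro allI impI)
            fix i l
            assume il: "M v i y \<and> maps v s i l"
            have "\<not> E v i k"
            proof
              assume "E v i k"
              then have "M v k n" using il baire.sq_sort near M_congL by blast
              then have "M v n n" using near nat_mem_trans M_congL by blast
              then show False using near nat_mem_irrefl by blast
            qed
            then have "M v i k" using il succD near by blast
            then show "least_one v f l" using near il by (blast dest: boxD)
          qed
        qed (use y k n 2 v all in \<open>simp_all add: opens\<close>)
      qed
      then show ?thesis ..
    qed blast
  qed (use f n in \<open>simp_all add: opens\<close>)
  then show ?thesis
  proof
    assume all: "?all w n"
    have "constant_least w f s"
      unfolding constant_least_def
    proof (rule boxI[where H = "\<lambda>v. baire.sq v s n \<and> ?all v n"], goal_cases _ _ near)
      case (near v)
      then have "\<forall>i m. M v i n \<and> maps v s i m \<longrightarrow> least_one v f m" by (blast dest: boxD)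
      then show ?case using near baire.sq_sort by blast
    qed (use n all in \<open>simp_all add: opens\<close>)
    then show ?thesis ..
  next
    assume "?ex w"
    then obtain i m where im: "maps w s i m" "\<forall>\<^sub>F v in nhds w. \<not> least_one v f m" by blast
    have "\<forall>\<^sub>F v in nhds w. \<not> constant_least v f s"
    proof (rule boxI[where H = "\<lambda>v. maps v s i m \<and> (\<forall>\<^sub>F v in nhds v. \<not> least_one v f m)"],
        goal_cases _ _ near)
      case (near v)
      then have "\<not> least_one v f m" by (blast dest: boxD)
      then show ?case using near constant_leastD by blast
    qed (use im in \<open>simp_all add: opens\<close>)
    then show ?thesis ..
  qed
qed

lemma detector_sharp:
  assumes f: "func w f isnat isbit" and x: "detector w f x"
  shows "baire.sharp w x"
proof (rule baire.sharpI[OF detector_ideal[OF assms]])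
  show "\<forall>\<^sub>F v in nhds w. \<forall>s. baire.fs v s \<longrightarrow> M v s x \<or> (\<forall>\<^sub>F v in nhds v. \<not> M v s x)"
  proof (intro boxI[where H = "\<lambda>v. func v f isnat isbit \<and> detector v f x"] allI impI)
    fix v s
    assume v: "func v f isnat isbit \<and> detector v f x" and s: "baire.fs v s"
    then consider "constant_least v f s" | "\<forall>\<^sub>F v in nhds v. \<not> constant_least v f s"
      using constant_least_decidable by blast
    then show "M v s x \<or> (\<forall>\<^sub>F v in nhds v. \<not> M v s x)"
    proof cases
      case 1
      then show ?thesis using detectorD v s by blast
    next
      case 2
      have "\<forall>\<^sub>F v in nhds v. \<not> M v s x"
      proof (rule boxI[where H = "\<lambda>v. detector v f x \<and> (\<forall>\<^sub>F v in nhds v. \<not> constant_least v f s)"],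
          goal_cases _ _ near)
        case (near v)
        then have "\<not> constant_least v f s" by (blast dest: boxD)
        then show ?case using near detectorD by blast
      qed (use v 2 in \<open>simp_all add: opens\<close>)
      then show ?thesis ..
    qed
  qed (use assms in \<open>simp_all add: opens\<close>)
qed

definition not_zero where
  "not_zero w f \<longleftrightarrow> (\<forall>\<^sub>F v in nhds w.
    \<not> (\<forall>\<^sub>F v in nhds v. \<forall>n. isnat v n \<longrightarrow> (\<exists>z. empty v z \<and> maps v f n z)))"

lemma open_not_zero [opens]: "open {w. not_zero w f}"
  unfolding not_zero_def by (simp add: opens)

text \<open>By decidability, an element \<open>s\<close> of a larger ideal \<open>y\<close> lies in
  \<open>x\<close> unless \<open>constant_least\<close> fails for it near the point. In that case
  \<open>f\<close> can take the value 1 nowhere nearby and is constantly 0 there, a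
  contradiction.\<close>

lemma detector_maxi:
  assumes f: "func w f isnat isbit" and x: "detector w f x" and nz: "not_zero w f"
  shows "baire.maxi w x"
  unfolding baire.maxi_def
proof (intro boxI[where H = "\<lambda>v. func v f isnat isbit \<and> detector v f x \<and> not_zero v f"] allI impI)
  fix v y
  assume v: "func v f isnat isbit \<and> detector v f x \<and> not_zero v f"
    and y: "baire.ideal v y \<and> sub v x y"
  show "sub v y x"
    unfolding sub_def
  proof (intro boxI[where H = "\<lambda>v. (func v f isnat isbit \<and> detector v f x \<and> not_zero v f) \<and>
      baire.ideal v y \<and> sub v x y"] allI impI)
    fix v s
    assume v: "(func v f isnat isbit \<and> detector v f x \<and> not_zero v f) \<and> baire.ideal v y \<and> sub v x y"
      and s: "M v s y"
    then have fs: "baire.fs v s" using baire.ideal_fs by blast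
    then consider "constant_least v f s" | "\<forall>\<^sub>F v in nhds v. \<not> constant_least v f s"
      using constant_least_decidable v by blast
    then show "M v s x"
    proof cases
      case 1
      then show ?thesis using detectorD v fs by blast
    next
      case 2
      have "\<forall>\<^sub>F v in nhds v. \<forall>n. isnat v n \<longrightarrow> (\<exists>z. empty v z \<and> maps v f n z)"
      proof (intro boxI[where H = "\<lambda>v. func v f isnat isbit \<and> detector v f x \<and> baire.ideal v y \<and> sub v x y \<and>
          M v s y \<and> (\<forall>\<^sub>F v in nhds v. \<not> constant_least v f s)"] allI impI)
        fix v n
        assume v: "func v f isnat isbit \<and> detector v f x \<and> baire.ideal v y \<and> sub v x y \<and>
            M v s y \<and> (\<forall>\<^sub>F v in nhds v. \<not> constant_least v f s)"
          and n: "isnat v n"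
        have x: "baire.ideal v x" using v detector_ideal by blast
        have "\<not> constant_least v f s" using v by (blast dest: boxD)
        \<comment> \<open>Given a least argument \<open>l\<close>, the constant sequence
          \<open>c\<close> of value \<open>l\<close> and of the length of \<open>s\<close> lies in
          \<open>x\<close> and so in \<open>y\<close>. Having a common extension with
          \<open>c\<close> in \<open>y\<close> and the same length, \<open>s\<close> is a prefix of
          \<open>c\<close> and thus lies in \<open>x\<close>.\<close>
        have none: "\<not> least_one v f l" for l
        proof
          assume l: "least_one v f l"
          obtain m where m: "baire.sq v s m"
            using v baire.ideal_fs unfolding finseq_def by blast
          obtain c where c: "baire.sq v c m"
            "\<forall>\<^sub>F v in nhds v. \<forall>x y. maps v c x y \<longleftrightarrow> M v x m \<and> E v y l"
            using baire.ex_const[OF baire.sq_isnat[OF m]] l unfolding least_one_def by blast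
          have "constant_least v f c"
            unfolding constant_least_def
          proof (rule boxI[where H = "\<lambda>v. least_one v f l \<and>
              (\<forall>\<^sub>F v in nhds v. \<forall>x y. maps v c x y \<longleftrightarrow> M v x m \<and> E v y l)"], goal_cases _ _ near)
            case (near v)
            then have "\<forall>x y. maps v c x y \<longleftrightarrow> M v x m \<and> E v y l" by (blast dest: boxD)
            then show ?case using near least_one_cong E_sym by blast
          qed (use c l in \<open>simp_all add: opens\<close>)
          then have cx: "M v c x" using detectorD v baire.fsI c by blast
          then have "M v c y" using v subD by blast
          then obtain q where "M v q y" "sub v s q" "sub v c q"
            using v baire.ideal_directed by blast
          then have "sub v s c"
            using baire.sq_sub_if_shorter[OF m c(1)] v baire.ideal_fs E_refl by blast
          then have "M v s x" using baire.ideal_lower x cx baire.fsI[OF m] by blast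
          then show False using \<open>\<not> constant_least v f s\<close> detectorD v by blast
        qed
        have f: "func v f isnat isbit" using v by blast
        from f n show "\<exists>z. empty v z \<and> maps v f n z"
        proof (cases rule: bitseq_cases)
          case (2 u)
          then show ?thesis using ex_least_one none f n by blast
        qed blast
      qed (use v s 2 in \<open>simp_all add: opens\<close>)
      moreover have "\<not> (\<forall>\<^sub>F v in nhds v. \<forall>n. isnat v n \<longrightarrow> (\<exists>z. empty v z \<and> maps v f n z))"
        using v unfolding not_zero_def by (blast dest: boxD)
      ultimately show ?thesis by contradiction
    qed
  qed (use v y in \<open>simp_all add: opens\<close>)
qed (use assms in \<open>simp_all add: opens\<close>)

text \<open>Either alternative of \<open>smaxD\<close> provides an element of \<open>x\<close> with
  an entry, and every entry is the least argument.\<close>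

lemma detector_smax:
  assumes f: "func w f isnat isbit" and x: "detector w f x" and smax: "baire.smax w x"
  shows "\<exists>k. least_one w f k"
proof -
  obtain z where z: "empty w z" using ex_empty by blast
  then have natz: "isnat w z" by (rule isnat_zero)
  \<comment> \<open>\<open>o'\<close> is the number one, so \<open>s\<close> becomes the sequence
    whose single entry is zero.\<close>
  obtain o' where o': "succ w o' z" using ex_succ natz by blast
  then obtain s where s: "baire.sq w s o'"
      "\<forall>\<^sub>F v in nhds w. \<forall>x y. maps v s x y \<longleftrightarrow> M v x o' \<and> E v y z"
    using baire.ex_const isnat_succ natz by blast
  consider "M w s x" | t where "M w t x" "\<forall>\<^sub>F v in nhds w. \<not> sub v t s"
    using baire.smaxD detector_ideal[OF f x] smax baire.fsI[OF s(1)] by blast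
  then show ?thesis
  proof cases
    case 1
    moreover have "maps w s z z" using boxD[OF s(2)] succD[OF o'] E_refl by blast
    ultimately show ?thesis using detectorD x constant_leastD by blast
  next
    case 2
    then obtain n where n: "baire.sq w t n" using detectorD x unfolding finseq_def by blast
    \<comment> \<open>An empty \<open>t\<close> would be a prefix of \<open>s\<close>, against
      incomparability; so \<open>t\<close> has a first entry.\<close>
    have "\<not> empty w n"
    proof
      assume n': "empty w n"
      have "sub w t s"
      proof (rule baire.fs_subI[where H = "\<lambda>v. empty v n \<and> baire.sq v t n"])
        fix v i m
        assume "empty v n \<and> baire.sq v t n" "maps v t i m"
        then show "maps v s i m" using baire.sq_sort emptyD by blast
      qed (use n n' baire.fsI in \<open>simp_all add: opens\<close>)
      then show False using boxD[OF 2(2)] by blast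
    qed
    then obtain i m where "maps w t i m"
      using nat_zero_cases baire.sq_isnat n baire.sq_total by blast
    then show ?thesis using detectorD x constant_leastD 2 by blast
  qed
qed

lemma markov_if_baire:
  assumes smax: "\<forall>\<^sub>F v in nhds w. \<forall>x. baire.ideal v x \<longrightarrow> baire.sharp v x \<and> baire.maxi v x \<longrightarrow> baire.smax v x"
  shows "markov w"
  unfolding markov_def not_zero_def[symmetric]
  using smax
proof (rule eventually_mono, intro allI impI)
  fix v f
  assume smax: "\<forall>x. baire.ideal v x \<longrightarrow> baire.sharp v x \<and> baire.maxi v x \<longrightarrow> baire.smax v x"
    and f: "func v f isnat isbit \<and> not_zero v f"
  obtain x where x: "detector v f x" using ex_detector by blast
  then have "baire.smax v x"
    using smax f detector_ideal detector_sharp detector_maxi by blast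
  then show "\<exists>k. isnat v k \<and> (\<exists>u. isone v u \<and> maps v f k u)"
    using detector_smax f x unfolding least_one_def by blast
qed

section \<open>The two equivalences as internal statements\<close>

lemma cantor_iff:
  "\<forall>\<^sub>F v in nhds w. \<forall>x. cantor.ideal v x \<longrightarrow>
    (\<forall>\<^sub>F v in nhds v. cantor.smax v x \<longleftrightarrow> cantor.sharp v x \<and> cantor.maxi v x)"
proof (rule always_eventually, intro allI impI)
  fix v x
  assume "cantor.ideal v x"
  then show "\<forall>\<^sub>F v in nhds v. cantor.smax v x \<longleftrightarrow> cantor.sharp v x \<and> cantor.maxi v x"
    by (rule boxI[of "\<lambda>v. cantor.ideal v x", rotated]) (simp_all add: cantor_smax_iff opens)
qed

lemma baire_iff_markov:
  "(\<forall>\<^sub>F v in nhds w. \<forall>x. baire.ideal v x \<longrightarrow>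
    (\<forall>\<^sub>F v in nhds v. baire.smax v x \<longleftrightarrow> baire.sharp v x \<and> baire.maxi v x)) \<longleftrightarrow> markov w"
proof
  assume "\<forall>\<^sub>F v in nhds w. \<forall>x. baire.ideal v x \<longrightarrow>
    (\<forall>\<^sub>F v in nhds v. baire.smax v x \<longleftrightarrow> baire.sharp v x \<and> baire.maxi v x)"
  then have "\<forall>\<^sub>F v in nhds w. \<forall>x. baire.ideal v x \<longrightarrow> baire.sharp v x \<and> baire.maxi v x \<longrightarrow> baire.smax v x"
    by (rule eventually_mono) (blast dest: boxD)
  then show "markov w" by (rule markov_if_baire)
next
  assume markov: "markov w"
  show "\<forall>\<^sub>F v in nhds w. \<forall>x. baire.ideal v x \<longrightarrow>
    (\<forall>\<^sub>F v in nhds v. baire.smax v x \<longleftrightarrow> baire.sharp v x \<and> baire.maxi v x)"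
  proof (rule boxI[OF open_markov markov], intro allI impI)
    fix v x
    assume v: "markov v" "baire.ideal v x"
    show "\<forall>\<^sub>F v in nhds v. baire.smax v x \<longleftrightarrow> baire.sharp v x \<and> baire.maxi v x"
    proof (rule boxI[where H = "\<lambda>v. markov v \<and> baire.ideal v x"])
      fix v
      assume "markov v \<and> baire.ideal v x"
      then show "baire.smax v x \<longleftrightarrow> baire.sharp v x \<and> baire.maxi v x"
        using baire_smax_if_markov baire.smax_imp_sharp baire.smax_imp_maxi by blast
    qed (use v in \<open>simp_all add: opens\<close>)
  qed
qed

theorem sat_maximality:
  "sat M E w e ((
     (\<^bold>\<forall>x. in_cantor x \<^bold>\<longrightarrow>
        (is_strongly_maximal in_cantor (\<^bold>\<subseteq>) x \<^bold>\<longleftrightarrow>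
         is_sharp in_cantor (\<^bold>\<subseteq>) x \<^bold>\<and> is_maximal in_cantor (\<^bold>\<subseteq>) x))
     \<^bold>\<and>
     ((\<^bold>\<forall>x. in_baire x \<^bold>\<longrightarrow>
         (is_strongly_maximal in_baire (\<^bold>\<subseteq>) x \<^bold>\<longleftrightarrow>
          is_sharp in_baire (\<^bold>\<subseteq>) x \<^bold>\<and> is_maximal in_baire (\<^bold>\<subseteq>) x))
      \<^bold>\<longleftrightarrow> markovs_principle)) 0)"
  (is "sat M E w e (?P 0)")
proof -
  have "holds e w [] ?P"
    by (simp add: in_cantor_def in_baire_def cantor_iff baire_iff_markov)
  moreover have "env [] e = e" by (rule ext) (simp add: env_def)
  ultimately show ?thesis by (simp add: holds_def)
qed

end

theorem theorem7p7:
  "IZF_proves (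
     (\<^bold>\<forall>x. in_cantor x \<^bold>\<longrightarrow>
        (is_strongly_maximal in_cantor (\<^bold>\<subseteq>) x \<^bold>\<longleftrightarrow>
         is_sharp in_cantor (\<^bold>\<subseteq>) x \<^bold>\<and> is_maximal in_cantor (\<^bold>\<subseteq>) x))
     \<^bold>\<and>
     ((\<^bold>\<forall>x. in_baire x \<^bold>\<longrightarrow>
         (is_strongly_maximal in_baire (\<^bold>\<subseteq>) x \<^bold>\<longleftrightarrow>
          is_sharp in_baire (\<^bold>\<subseteq>) x \<^bold>\<and> is_maximal in_baire (\<^bold>\<subseteq>) x))
      \<^bold>\<longleftrightarrow> markovs_principle))"
  by (rule IZF_proves_if_valid) (rule izf_model.sat_maximality)

end
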